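(* Let $X$ be a normed vector space. Let $\Gamma:\mathcal P(\Sigma_G^{\mathbb N})\to X$ be continuous and affine and let $\Delta:\mathcal P(\Sigma_G^{\mathbb N})\to\mathbb R$ be continuous and affine with $\Delta(\mu)\ne0$ for all $\mu\in\mathcal P(\Sigma_G^{\mathbb N})$. Define $U:\mathcal P(\Sigma_G^{\mathbb N})\to X$ by $U=\frac{\Gamma}{\Delta}$. Let $C$ be a closed and convex subset of $X$ and assume that $$\overset{\circ}{C}\cap U\big(\mathcal P_S(\Sigma_G^{\mathbb N})\big)\ne\varnothing.$$ Let $\Phi:\Sigma_G^{\mathbb N}\to\mathbb R$ be continuous with $\Phi<0$. Let $F(C)$ be the unique real number such that $$P_C^U\big(F(C)\,\Phi\big)=0;$$ alternatively, $F(C)$ is the unique real number such that $$\sigma_{\mathrm{rad}}\big(\zeta_C^{\mathrm{dyn},U}(F(C)\,\Phi;\cdot)\big)=1.$$ Then $$F(C)=\sup_{\mu\in\mathcal P_S(\Sigma_G^{\mathbb N}),\ U\mu\in C}-\frac{h(\mu)}{\int\Phi\,d\mu}.$$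
   Context: $G=(V,E)$ is a fixed finite directed multigraph (vertex set $V$, edge set $E$), assumed strongly connected. For $e\in E$, $\mathrm i(e)$ and $\mathrm t(e)$ are its initial and terminal vertices. $\Sigma_G^n$ is the set of strings $e_1\ldots e_n$ of edges with $\mathrm t(e_k)=\mathrm i(e_{k+1})$ for $1\le k<n$, and $\Sigma_G^{\mathbb N}$ is the set of infinite strings $e_1e_2\ldots$ with $\mathrm t(e_k)=\mathrm i(e_{k+1})$ for all $k\ge1$, with the product topology (discrete factors). For $\mathbf u=e_1e_2\ldots\in\Sigma_G^{\mathbb N}$, $\mathbf u|n=e_1\ldots e_n$; for $\mathbf i\in\Sigma_G^n$, the cylinder is $[\mathbf i]=\{\mathbf u\in\Sigma_G^{\mathbb N}:\mathbf u|n=\mathbf i\}$. $S(e_1e_2\ldots)=e_2e_3\ldots$ is the shift. $\mathcal P(\Sigma_G^{\mathbb N})$ (resp. $\mathcal P_S(\Sigma_G^{\mathbb N})$) is the set of Borel (resp. shift-invariant Borel) probability measures on $\Sigma_G^{\mathbb N}$, with the weak topology; $h(\mu)$ is the (Kolmogorov–Sinai) entropy of $\mu\in\mathcal P_S(\Sigma_G^{\mathbb N})$ with respect to $S$. $L_n:\Sigma_G^{\mathbb N}\to\mathcal P(\Sigma_G^{\mathbb N})$ is $L_n\mathbf u=\frac1n\sum_{k=0}^{n-1}\delta_{S^k\mathbf u}$, and $UL_n[\mathbf i]=\{U(L_n\mathbf u):\mathbf u\in[\mathbf i]\}$. For $D\subseteq X$ and continuous $\varphi:\Sigma_G^{\mathbb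 N}\to\mathbb R$ put $$Z_n(D,\varphi)=\sum_{\mathbf i\in\Sigma_G^n,\ UL_n[\mathbf i]\subseteq D}\ \sup_{\mathbf u\in[\mathbf i]}\exp\sum_{k=0}^{n-1}\varphi(S^k\mathbf u).$$ The lower and upper multifractal pressures are $\underline P^U_D(\varphi)=\liminf_n\frac1n\log Z_n(D,\varphi)$ and $\overline P^U_D(\varphi)=\limsup_n\frac1n\log Z_n(D,\varphi)$; if they coincide, $P^U_D(\varphi)$ denotes their common value (under the hypotheses of the claim they do coincide for $D=C$ and every continuous $\varphi$). The dynamical multifractal zeta-function is the power series $\zeta^{\mathrm{dyn},U}_D(\varphi;z)=\sum_n\frac{z^n}{n}Z_n(D,\varphi)$. $\sigma_{\mathrm{rad}}(f)\in[0,\infty]$ is the radius of convergence of a power series $f$. $\overset{\circ}{C}$ is the interior of $C$. "Affine" means preserving convex combinations. *)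

theory Defs
  imports
    "HOL-Probability.Probability"
    "Graph_Theory.Digraph_Component"
begin

text \<open>
  Directed multigraphs are those of the entry Graph_Theory: the initial vertex of an arc
  \<open>e\<close> is \<open>tail G e\<close>, its terminal vertex is \<open>head G e\<close>. Infinite strings are indexed from \<open>0\<close>,
  so \<open>e\<^sub>1e\<^sub>2\<dots>\<close> is the function \<open>u\<close> with \<open>u k = e\<^sub>k\<^sub>+\<^sub>1\<close>.
\<close>

definition words :: "('v, 'e) pre_digraph \<Rightarrow> nat \<Rightarrow> 'e list set" where
  "words G n = {w. length w = n \<and> set w \<subseteq> arcs G \<and>
     (\<forall>k. Suc k < n \<longrightarrow> head G (w ! k) = tail G (w ! Suc k))}"

definition paths :: "('v, 'e) pre_digraph \<Rightarrow> (nat \<Rightarrow> 'e) set" where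
  "paths G = {u. \<forall>k. u k \<in> arcs G \<and> head G (u k) = tail G (u (Suc k))}"

definition cylinder :: "('v, 'e) pre_digraph \<Rightarrow> 'e list \<Rightarrow> (nat \<Rightarrow> 'e) set" where
  "cylinder G w = {u \<in> paths G. map u [0..<length w] = w}"

definition path_shift :: "(nat \<Rightarrow> 'e) \<Rightarrow> (nat \<Rightarrow> 'e)" where
  "path_shift u = (\<lambda>k. u (Suc k))"

definition path_topology :: "('v, 'e) pre_digraph \<Rightarrow> (nat \<Rightarrow> 'e) topology" where
  "path_topology G =
     subtopology (product_topology (\<lambda>_. discrete_topology (arcs G)) UNIV) (paths G)"

lemma topspace_path_topology: "topspace (path_topology G) = paths G"
  unfolding path_topology_def by (auto simp: paths_def)

definition borel_algebra :: "'a topology \<Rightarrow> 'a measure" where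
  "borel_algebra T = sigma (topspace T) {A. openin T A}"

definition prob_measures :: "'a topology \<Rightarrow> 'a measure set" where
  "prob_measures T =
     {\<mu>. space \<mu> = topspace T \<and> sets \<mu> = sets (borel_algebra T) \<and> prob_space \<mu>}"

definition invariant_prob_measures :: "'a topology \<Rightarrow> ('a \<Rightarrow> 'a) \<Rightarrow> 'a measure set" where
  "invariant_prob_measures T f = {\<mu> \<in> prob_measures T. f \<in> measurable \<mu> \<mu> \<and> distr \<mu> \<mu> f = \<mu>}"

definition weak_topology :: "'a topology \<Rightarrow> 'a measure topology" where
  "weak_topology T = topology_generated_by
     {{\<mu> \<in> prob_measures T. integral\<^sup>L \<mu> g \<in> V} | g V.
        continuous_map T euclideanreal g \<and> bounded (g ` topspace T) \<and> open V}"

lemma topspace_weak_topology: "topspace (weak_topology T) = prob_measures T"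
proof
  show "topspace (weak_topology T) \<subseteq> prob_measures T"
    unfolding weak_topology_def topology_generated_by_topspace by auto
  have "prob_measures T \<in> {{\<mu> \<in> prob_measures T. integral\<^sup>L \<mu> g \<in> V} | g V.
        continuous_map T euclideanreal g \<and> bounded (g ` topspace T) \<and> open V}"
    apply clarify
    by (rule exI[of _ "\<lambda>_. 0"], rule exI[of _ UNIV]) (auto simp: image_constant_conv)
  then show "prob_measures T \<subseteq> topspace (weak_topology T)"
    unfolding weak_topology_def topology_generated_by_topspace by blast
qed

definition mix_measure :: "real \<Rightarrow> 'a measure \<Rightarrow> 'a measure \<Rightarrow> 'a measure" where
  "mix_measure t \<mu> \<nu> = measure_of (space \<mu>) (sets \<mu>)
     (\<lambda>A. ennreal t * emeasure \<mu> A + ennreal (1 - t) * emeasure \<nu> A)"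

lemma emeasure_mix_measure: assumes "sets \<nu> = sets \<mu>" "A \<in> sets \<mu>"
  shows "emeasure (mix_measure t \<mu> \<nu>) A = ennreal t * emeasure \<mu> A + ennreal (1 - t) * emeasure \<nu> A"
proof (rule emeasure_measure_of[OF mix_measure_def[of t \<mu> \<nu>]])
  show "countably_additive (sets (mix_measure t \<mu> \<nu>)) (\<lambda>A. ennreal t * emeasure \<mu> A + ennreal (1 - t) * emeasure \<nu> A)"
    unfolding mix_measure_def countably_additive_def using assms
    by (auto simp: suminf_add[symmetric] suminf_emeasure)
qed (use assms in \<open>auto simp: positive_def mix_measure_def sets.space_closed dest: sets.sets_into_space\<close>)

definition affine_on_prob_measures ::
    "'a topology \<Rightarrow> ('a measure \<Rightarrow> 'x :: real_vector) \<Rightarrow> bool" where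
  "affine_on_prob_measures T F \<longleftrightarrow>
     (\<forall>\<mu>\<in>prob_measures T. \<forall>\<nu>\<in>prob_measures T. \<forall>t\<in>{0..1}.
        F (mix_measure t \<mu> \<nu>) = t *\<^sub>R F \<mu> + (1 - t) *\<^sub>R F \<nu>)"

text \<open>
  Kolmogorov--Sinai entropy, with natural logarithms. Since \<open>ln 0 = 0\<close> in HOL, null atoms
  contribute \<open>0\<close>. The library's \<open>common_refinement\<close> takes a set of partitions and discards empty
  atoms, so repeated or empty preimages below are harmless.
\<close>

definition partition_entropy :: "'a measure \<Rightarrow> 'a set set \<Rightarrow> real" where
  "partition_entropy \<mu> \<xi> = - (\<Sum>A\<in>\<xi>. measure \<mu> A * ln (measure \<mu> A))"

definition iterated_partition ::
    "'a measure \<Rightarrow> ('a \<Rightarrow> 'a) \<Rightarrow> 'a set set \<Rightarrow> nat \<Rightarrow> 'a set set" where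
  "iterated_partition \<mu> f \<xi> n =
     common_refinement ((\<lambda>k. (\<lambda>A. (f ^^ k) -` A \<inter> space \<mu>) ` \<xi>) ` {..<n})"

definition ks_entropy :: "'a measure \<Rightarrow> ('a \<Rightarrow> 'a) \<Rightarrow> ereal" where
  "ks_entropy \<mu> f =
     (SUP \<xi> \<in> {\<xi>. finite \<xi> \<and> \<xi> \<subseteq> sets \<mu> \<and> partition_on (space \<mu>) \<xi>}.
        ereal (lim (\<lambda>n. partition_entropy \<mu> (iterated_partition \<mu> f \<xi> n) / real n)))"

definition path_measures :: "('v, 'e) pre_digraph \<Rightarrow> (nat \<Rightarrow> 'e) measure set" where
  "path_measures G = prob_measures (path_topology G)"

definition invariant_path_measures :: "('v, 'e) pre_digraph \<Rightarrow> (nat \<Rightarrow> 'e) measure set" where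
  "invariant_path_measures G = invariant_prob_measures (path_topology G) path_shift"

definition empirical_measure ::
    "('v, 'e) pre_digraph \<Rightarrow> nat \<Rightarrow> (nat \<Rightarrow> 'e) \<Rightarrow> (nat \<Rightarrow> 'e) measure" where
  "empirical_measure G n u =
     (let B = borel_algebra (path_topology G)
      in measure_of (space B) (sets B)
           (\<lambda>A. (\<Sum>k<n. emeasure (return B ((path_shift ^^ k) u)) A) / of_nat n))"

lemma emeasure_empirical_measure: assumes "A \<in> sets (borel_algebra (path_topology G))"
  shows "emeasure (empirical_measure G n u) A = (\<Sum>k<n. indicator A ((path_shift ^^ k) u)) / of_nat n"
proof -
  let ?B = "borel_algebra (path_topology G)"
  have "emeasure (empirical_measure G n u) A = (\<Sum>k<n. emeasure (return ?B ((path_shift ^^ k) u)) A) / of_nat n"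
  proof (rule emeasure_measure_of[OF empirical_measure_def[unfolded Let_def]])
    show "countably_additive (sets (empirical_measure G n u)) (\<lambda>A. (\<Sum>k<n. emeasure (return ?B ((path_shift ^^ k) u)) A) / of_nat n)"
      unfolding countably_additive_def
    proof (intro allI impI)
      fix A :: "nat \<Rightarrow> _" assume A: "range A \<subseteq> sets (empirical_measure G n u)" "disjoint_family A" "\<Union>(range A) \<in> sets (empirical_measure G n u)"
      have s: "sets (empirical_measure G n u) = sets ?B" by (simp add: empirical_measure_def Let_def)
      have "(\<Sum>i. emeasure (return ?B x) (A i)) = emeasure (return ?B x) (\<Union>(range A))" for x
        by (rule suminf_emeasure) (use A s in auto)
      then have "(\<Sum>i. \<Sum>k<n. emeasure (return ?B ((path_shift ^^ k) u)) (A i)) = (\<Sum>k<n. emeasure (return ?B ((path_shift ^^ k) u)) (\<Union>(range A)))"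
        by (subst suminf_sum) auto
      then show "(\<Sum>i. (\<Sum>k<n. emeasure (return ?B ((path_shift ^^ k) u)) (A i)) / of_nat n) =
          (\<Sum>k<n. emeasure (return ?B ((path_shift ^^ k) u)) (\<Union>(range A))) / of_nat n"
        by (simp add: ennreal_suminf_divide)
    qed
  qed (use assms in \<open>auto simp: positive_def empirical_measure_def Let_def sets.space_closed dest: sets.sets_into_space\<close>)
  then show ?thesis using assms by simp
qed

definition partition_sum ::
    "('v, 'e) pre_digraph \<Rightarrow> ((nat \<Rightarrow> 'e) measure \<Rightarrow> 'x) \<Rightarrow> 'x set \<Rightarrow>
     ((nat \<Rightarrow> 'e) \<Rightarrow> real) \<Rightarrow> nat \<Rightarrow> real" where
  "partition_sum G U D \<phi> n =
     (\<Sum>w \<in> {w \<in> words G n. (\<lambda>u. U (empirical_measure G n u)) ` cylinder G w \<subseteq> D}.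
        SUP u \<in> cylinder G w. exp (\<Sum>k<n. \<phi> ((path_shift ^^ k) u)))"

text \<open>
  The partition sums may vanish, and then their logarithm has to be \<open>-\<infinity>\<close> (in HOL, \<open>ln 0 = 0\<close>).
\<close>

definition ext_ln :: "real \<Rightarrow> ereal" where
  "ext_ln x = (if x \<le> 0 then - \<infinity> else ereal (ln x))"

definition lower_pressure ::
    "('v, 'e) pre_digraph \<Rightarrow> ((nat \<Rightarrow> 'e) measure \<Rightarrow> 'x) \<Rightarrow> 'x set \<Rightarrow>
     ((nat \<Rightarrow> 'e) \<Rightarrow> real) \<Rightarrow> ereal" where
  "lower_pressure G U D \<phi> =
     liminf (\<lambda>n. ereal (1 / real n) * ext_ln (partition_sum G U D \<phi> n))"

definition upper_pressure ::
    "('v, 'e) pre_digraph \<Rightarrow> ((nat \<Rightarrow> 'e) measure \<Rightarrow> 'x) \<Rightarrow> 'x set \<Rightarrow>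
     ((nat \<Rightarrow> 'e) \<Rightarrow> real) \<Rightarrow> ereal" where
  "upper_pressure G U D \<phi> =
     limsup (\<lambda>n. ereal (1 / real n) * ext_ln (partition_sum G U D \<phi> n))"

text \<open>
  \<open>has_pressure G U D \<phi> p\<close> says that the lower and upper pressures coincide, with common value \<open>p\<close>.
\<close>

definition has_pressure ::
    "('v, 'e) pre_digraph \<Rightarrow> ((nat \<Rightarrow> 'e) measure \<Rightarrow> 'x) \<Rightarrow> 'x set \<Rightarrow>
     ((nat \<Rightarrow> 'e) \<Rightarrow> real) \<Rightarrow> ereal \<Rightarrow> bool" where
  "has_pressure G U D \<phi> p \<longleftrightarrow> lower_pressure G U D \<phi> = p \<and> upper_pressure G U D \<phi> = p"

text \<open>
  The zeta series runs over \<open>n \<ge> 1\<close>; the coefficient at \<open>n = 0\<close> below is \<open>0\<close>, since \<open>x / 0 = 0\<close>.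
\<close>

definition dyn_zeta ::
    "('v, 'e) pre_digraph \<Rightarrow> ((nat \<Rightarrow> 'e) measure \<Rightarrow> 'x) \<Rightarrow> 'x set \<Rightarrow>
     ((nat \<Rightarrow> 'e) \<Rightarrow> real) \<Rightarrow> complex fps" where
  "dyn_zeta G U D \<phi> = Abs_fps (\<lambda>n. complex_of_real (partition_sum G U D \<phi> n / real n))"

end

theory Submission
  imports Defs
begin

text \<open>
  The number \<open>F(C)\<close> is the supremum itself. Write \<open>\<P>\<close> for the set of invariant measures \<open>\<mu>\<close> with \<open>U \<mu> \<in> C\<close>.
  The main point is the variational principle \<open>P\<^sub>C(\<phi>) = sup {h(\<mu>) + \<integral>\<phi> d\<mu> | \<mu> \<in> \<P>}\<close> for every continuous \<open>\<phi>\<close>.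
  For \<open>\<phi> = s\<Phi>\<close> with \<open>\<Phi> < 0\<close> the integrals \<open>\<integral>\<Phi> d\<mu>\<close> are bounded away from \<open>0\<close> and from \<open>-\<infinity>\<close>, so the right-hand
  side is positive, zero or negative according to whether \<open>s\<close> is smaller than, equal to or larger than
  the supremum of the quotients \<open>- h(\<mu>) / \<integral>\<Phi> d\<mu>\<close>. The zeta function only rephrases this: its radius of
  convergence is \<open>exp (- P\<^sub>C(s\<Phi>))\<close> by comparison with geometric series.

  The upper bound (\<open>partition_sum_growth_le\<close>). Give each word that contributes to the partition sum of
  length \<open>n\<close> its Gibbs weight, and average the empirical measures of paths chosen in the corresponding
  cylinders. As \<open>U\<close> is a quotient of affine maps and \<open>C\<close> is convex, the average \<open>\<nu>\<^sub>n\<close> still satisfies the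
  constraint. The logarithm of the partition sum is, up to \<open>ln 2\<close>, the entropy of the Gibbs weights plus
  \<open>n \<integral>\<phi> d\<nu>\<^sub>n\<close>. That entropy is at most \<open>n\<close> times the conditional entropy of one arc under \<open>\<nu>\<^sub>n\<close> given the
  \<open>j\<close> arcs before it, up to a term independent of \<open>n\<close>: compare the Gibbs weights with the Markov chain
  of order \<open>j\<close> that has the conditional probabilities of \<open>\<nu>\<^sub>n\<close> (\<open>partition_function_le\<close>). The set of
  measures is weakly compact, a limit of the \<open>\<nu>\<^sub>n\<close> is invariant, it satisfies the constraint because \<open>C\<close> is
  closed, and the bounds for all \<open>j\<close> pass to the limit (\<open>exists_invariant_limit\<close>).

  The lower bound (\<open>partition_sum_growth_ge\<close>). First let \<open>U \<mu>\<close> be in the interior of \<open>C\<close>. As \<open>\<mu>\<close>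
  need not be ergodic, its typical paths may have the wrong empirical measures; independent repetition
  restores the right ones: the law of large numbers for the distribution of words of a fixed large length \<open>m\<close> yields about
  \<open>exp (N H\<^sub>m(\<mu>))\<close> typical sequences of \<open>N\<close> words. Strong connectedness allows each word to be closed up to
  a loop at one vertex at bounded cost, so the sequences become words of the graph whose empirical
  measures are close to \<open>\<mu>\<close> (\<open>many_words_near_invariant_measure\<close>) and hence, as \<open>U\<close> is continuous, satisfy the
  constraint. If \<open>U \<mu>\<close> is only in \<open>C\<close>, mix \<open>\<mu>\<close> with a little of an invariant measure that \<open>U\<close> maps to the
  interior, which costs little entropy because entropy is concave.

  Both halves speak of the entropies of the blocks of \<open>n\<close> arcs. That their rate is the Kolmogorov--Sinai
  entropy (\<open>ks_entropy_eq_block_entropy_rate\<close>) holds because the partition by the first arc generates the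
  Borel sets.
\<close>

section \<open>Strings over the arcs\<close>

text \<open>
  Sums over cylinders run over all lists of arcs rather than over \<open>words\<close>: lists that are not words have
  empty cylinders, and appending an arc then needs no compatibility condition.
\<close>

abbreviation arc_lists :: "('v, 'e) pre_digraph \<Rightarrow> nat \<Rightarrow> 'e list set" where
  "arc_lists G n \<equiv> {v. set v \<subseteq> arcs G \<and> length v = n}"

definition window :: "(nat \<Rightarrow> 'e) \<Rightarrow> nat \<Rightarrow> nat \<Rightarrow> 'e list" where
  "window u i k = map u [i..<i + k]"

lemma length_window [simp]: "length (window u i k) = k"
  by (simp add: window_def)

lemma window_0 [simp]: "window u i 0 = []"
  by (simp add: window_def)

lemma window_Suc: "window u i (Suc k) = window u i k @ [u (i + k)]"
  by (simp add: window_def)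

lemma window_eq_iff: "window u i k = window v j k \<longleftrightarrow> (\<forall>l<k. u (i + l) = v (j + l))"
  by (auto simp: window_def list_eq_iff_nth_eq)

lemma nth_window: "l < k \<Longrightarrow> window u i k ! l = u (i + l)"
  by (simp add: window_def)

lemma window_eq_list_iff: "window u i (length v) = v \<longleftrightarrow> (\<forall>l<length v. u (i + l) = v ! l)"
  by (metis length_window nth_equalityI nth_window)

lemma path_shift_pow: "(path_shift ^^ i) u = (\<lambda>k. u (i + k))"
  by (induction i) (auto simp: path_shift_def)

lemma window_path_shift_pow [simp]: "window ((path_shift ^^ i) u) j k = window u (i + j) k"
  by (simp add: path_shift_pow window_def list_eq_iff_nth_eq add.assoc)

lemma window_take_drop: "i + k \<le> n \<Longrightarrow> window u i k = take k (drop i (window u 0 n))"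
  by (auto simp: window_def list_eq_iff_nth_eq)

lemma cylinder_iff: "u \<in> cylinder G v \<longleftrightarrow> u \<in> paths G \<and> window u 0 (length v) = v"
  by (simp add: cylinder_def window_def)

lemma cylinder_subset_paths: "cylinder G v \<subseteq> paths G"
  by (auto simp: cylinder_iff)

lemma path_shift_in_paths: "u \<in> paths G \<Longrightarrow> path_shift u \<in> paths G"
  by (auto simp: paths_def path_shift_def)

lemma path_shift_pow_in_paths: "u \<in> paths G \<Longrightarrow> (path_shift ^^ i) u \<in> paths G"
  by (auto simp: paths_def path_shift_pow)

lemma window_in_arc_lists: "u \<in> paths G \<Longrightarrow> window u i k \<in> arc_lists G k"
  by (auto simp: window_def paths_def)

lemma window_in_words: "u \<in> paths G \<Longrightarrow> window u i k \<in> words G k"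
  by (auto simp: window_def paths_def words_def)

lemma cylinder_empty_if: "v \<notin> arc_lists G (length v) \<Longrightarrow> cylinder G v = {}"
  using window_in_arc_lists[of _ G 0 "length v"] by (fastforce simp: cylinder_iff)

lemma cylinder_Nil [simp]: "cylinder G [] = paths G"
  by (auto simp: cylinder_iff)

lemma cylinder_disjoint: "length v = length w \<Longrightarrow> v \<noteq> w \<Longrightarrow> cylinder G v \<inter> cylinder G w = {}"
  by (auto simp: cylinder_iff)

lemma UN_cylinder: "(\<Union>v\<in>arc_lists G n. cylinder G v) = paths G"
  using window_in_arc_lists[of _ G 0 n] by (fastforce simp: cylinder_iff)

lemma cylinder_eq_UN_snoc: "cylinder G v = (\<Union>e\<in>arcs G. cylinder G (v @ [e]))"
  by (auto simp: cylinder_iff window_Suc) (auto simp: paths_def)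

lemma disjoint_cylinder_snoc: "disjoint_family_on (\<lambda>e. cylinder G (v @ [e])) A"
  by (auto simp: disjoint_family_on_def cylinder_iff)

lemma disjoint_cylinder: "disjoint_family_on (cylinder G) (arc_lists G n)"
  unfolding disjoint_family_on_def using cylinder_disjoint by fastforce

lemma cylinder_inter:
  "length v \<le> length w \<Longrightarrow> cylinder G v \<inter> cylinder G w = {} \<or> cylinder G v \<inter> cylinder G w = cylinder G w"
  by (auto simp: cylinder_iff window_take_drop[of 0 "length v" "length w"])

lemma arc_lists_Suc: "arc_lists G (Suc n) = (\<lambda>(v, e). v @ [e]) ` (arc_lists G n \<times> arcs G)"
proof (intro equalityI subsetI)
  fix v assume "v \<in> arc_lists G (Suc n)"
  then show "v \<in> (\<lambda>(v, e). v @ [e]) ` (arc_lists G n \<times> arcs G)"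
    by (cases v rule: rev_cases) auto
qed auto

lemma sum_arc_lists_Suc:
  "(\<Sum>v\<in>arc_lists G (Suc n). f v) = (\<Sum>v\<in>arc_lists G n. \<Sum>e\<in>arcs G. f (v @ [e]))"
  unfolding arc_lists_Suc
  by (subst sum.reindex) (auto simp: inj_on_def sum.cartesian_product intro!: sum.cong)

section \<open>The path space\<close>

locale path_space = fin_digraph G for G :: "('v, 'e) pre_digraph" +
  assumes strong: "strongly_connected G" and paths_nonempty: "paths G \<noteq> {}"
begin

lemma finite_arc_lists [simp]: "finite (arc_lists G n)"
  using finite_lists_length_eq[OF finite_arcs] by simp

lemma arcs_nonempty: "arcs G \<noteq> {}"
  using paths_nonempty by (auto simp: paths_def)

text \<open>
  The cylinders form a base of the topology: a basic open set of the product restricts only finitely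
  many coordinates.
\<close>

lemma openin_path_topology:
  "openin (path_topology G) A \<longleftrightarrow>
     A \<subseteq> paths G \<and> (\<forall>u\<in>A. \<exists>n. cylinder G (window u 0 n) \<subseteq> A)"
proof
  assume "openin (path_topology G) A"
  then obtain T where T: "openin (product_topology (\<lambda>_. discrete_topology (arcs G)) UNIV) T"
    and A: "A = T \<inter> paths G"
    by (auto simp: path_topology_def openin_subtopology)
  have "\<exists>n. cylinder G (window u 0 n) \<subseteq> A" if u: "u \<in> A" for u
  proof -
    obtain X where X: "finite {i. X i \<noteq> arcs G}" "\<And>i. u i \<in> X i" "PiE UNIV X \<subseteq> T"
      using T u A unfolding openin_product_topology_alt by (fastforce simp: PiE_iff)
    obtain n where n: "\<And>i. X i \<noteq> arcs G \<Longrightarrow> i < n"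
      using finite_nat_iff_bounded[of "{i. X i \<noteq> arcs G}"] X(1) by auto
    have "w \<in> A" if w: "w \<in> cylinder G (window u 0 n)" for w
    proof -
      have "w i \<in> X i" for i
      proof (cases "i < n")
        case True
        with w have "w i = u i"
          using window_eq_iff[of w 0 n u 0] by (simp add: cylinder_iff)
        then show ?thesis using X by metis
      next
        case False
        then have "X i = arcs G" using n by blast
        then show ?thesis using w by (auto simp: cylinder_iff paths_def)
      qed
      then show ?thesis using X(3) w A by (auto simp: cylinder_iff PiE_iff)
    qed
    then show ?thesis by blast
  qed
  then show "A \<subseteq> paths G \<and> (\<forall>u\<in>A. \<exists>n. cylinder G (window u 0 n) \<subseteq> A)"
    using A by auto
next
  have cyl: "openin (path_topology G) (cylinder G v)" for v
  proof (cases "v \<in> arc_lists G (length v)")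
    case True
    let ?X = "\<lambda>i. if i < length v then {v ! i} else arcs G"
    have "openin (product_topology (\<lambda>_. discrete_topology (arcs G)) UNIV) (PiE UNIV ?X)"
      unfolding openin_PiE_gen
    proof (intro disjI2 conjI ballI)
      show "finite {i \<in> UNIV. ?X i \<noteq> topspace (discrete_topology (arcs G))}"
        by (rule finite_subset[of _ "{..<length v}"]) (auto split: if_splits)
      have "set v \<subseteq> arcs G" using True by simp
      then show "openin (discrete_topology (arcs G)) (?X i)" for i
        by (simp add: subset_eq)
    qed
    moreover have "cylinder G v = PiE UNIV ?X \<inter> paths G"
    proof -
      have "u \<in> PiE UNIV ?X \<longleftrightarrow> window u 0 (length v) = v" if "u \<in> paths G" for u
      proof -
        have "u i \<in> arcs G" for i using that by (simp add: paths_def)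
        then have "u i \<in> ?X i \<longleftrightarrow> (i < length v \<longrightarrow> u i = v ! i)" for i by simp
        then have "u \<in> PiE UNIV ?X \<longleftrightarrow> (\<forall>i<length v. u i = v ! i)" by (auto simp only: PiE_UNIV_domain Pi_iff)
        then show ?thesis by (simp only: window_eq_list_iff add_0)
      qed
      then show ?thesis unfolding cylinder_iff set_eq_iff Int_iff by blast
    qed
    ultimately show ?thesis
      unfolding path_topology_def openin_subtopology by blast
  next
    case False
    then show ?thesis by (simp add: cylinder_empty_if)
  qed
  assume A: "A \<subseteq> paths G \<and> (\<forall>u\<in>A. \<exists>n. cylinder G (window u 0 n) \<subseteq> A)"
  have "A = \<Union> {cylinder G v | v. cylinder G v \<subseteq> A}"
  proof (intro equalityI subsetI)
    fix u assume u: "u \<in> A"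
    then obtain n where "cylinder G (window u 0 n) \<subseteq> A" "u \<in> paths G" using A by blast
    then show "u \<in> \<Union> {cylinder G v | v. cylinder G v \<subseteq> A}"
      by (intro UnionI[of "cylinder G (window u 0 n)"]) (auto simp: cylinder_iff)
  qed auto
  then show "openin (path_topology G) A"
    using cyl openin_Union[of "{cylinder G v | v. cylinder G v \<subseteq> A}" "path_topology G"] by auto
qed

lemma openin_cylinder: "openin (path_topology G) (cylinder G v)"
  unfolding openin_path_topology by (auto simp: cylinder_iff intro!: exI[of _ "length v"])

text \<open>
  Tychonoff: the alphabet is finite, and the paths are closed in the product because a violated
  adjacency is visible in two coordinates.
\<close>

lemma compact_space_path_topology: "compact_space (path_topology G)"
proof -
  let ?P = "product_topology (\<lambda>_::nat. discrete_topology (arcs G)) UNIV"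
  have "openin ?P (topspace ?P - paths G)"
    unfolding openin_product_topology_alt
  proof safe
    fix u assume u: "u \<in> topspace ?P" "u \<notin> paths G"
    then obtain k where k: "head G (u k) \<noteq> tail G (u (Suc k))"
      by (auto simp: paths_def PiE_iff)
    let ?X = "\<lambda>i. if i = k \<or> i = Suc k then {u i} else arcs G"
    have fin: "finite {i. ?X i \<noteq> topspace (discrete_topology (arcs G))}"
      by (rule finite_subset[of _ "{k, Suc k}"]) auto
    have "\<forall>i. openin (discrete_topology (arcs G)) (?X i)" and "u \<in> PiE UNIV ?X"
      using u by (auto simp: PiE_iff)
    moreover have "PiE UNIV ?X \<subseteq> topspace ?P - paths G"
    proof
      fix w assume w: "w \<in> PiE UNIV ?X"
      then have "w k \<in> ?X k" "w (Suc k) \<in> ?X (Suc k)" by (auto simp only: PiE_iff UNIV_I)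
      then have "w k = u k" "w (Suc k) = u (Suc k)" by auto
      with k have "w \<notin> paths G" unfolding paths_def by (auto intro!: exI[of _ k])
      moreover have "w i \<in> arcs G" for i
      proof -
        have "w i \<in> ?X i" using w by (auto simp only: PiE_iff UNIV_I)
        then show ?thesis using u by (auto simp: PiE_iff split: if_splits)
      qed
      ultimately show "w \<in> topspace ?P - paths G" by (auto simp: PiE_iff)
    qed
    ultimately show "\<exists>X. finite {i \<in> UNIV. X i \<noteq> topspace (discrete_topology (arcs G))} \<and>
      (\<forall>i\<in>UNIV. openin (discrete_topology (arcs G)) (X i)) \<and>
      u \<in> Pi\<^sub>E UNIV X \<and> Pi\<^sub>E UNIV X \<subseteq> topspace ?P - paths G"
      using fin by (intro exI[of _ ?X]) simp
  qed
  then have "closedin ?P (paths G)"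
    unfolding closedin_def by (auto simp: paths_def)
  moreover have "compact_space ?P"
    by (simp add: compact_space_product_topology compact_space_discrete_topology)
  ultimately have "compactin ?P (paths G)"
    using closedin_compact_space by blast
  then show ?thesis
    unfolding path_topology_def using compact_space_subtopology by blast
qed

text \<open>
  On a compact space a continuous function is uniformly continuous, and here uniformity is
  expressed by a common length of the cylinders on which the function oscillates little.
\<close>

lemma uniformly_continuous_on_cylinders:
  assumes g: "continuous_map (path_topology G) euclideanreal g" and \<epsilon>: "\<epsilon> > 0"
  obtains n where "\<And>u w. u \<in> paths G \<Longrightarrow> w \<in> paths G \<Longrightarrow> window u 0 n = window w 0 n \<Longrightarrow> \<bar>g u - g w\<bar> < \<epsilon>"
proof -
  have "\<exists>n. \<forall>w\<in>cylinder G (window u 0 n). \<bar>g w - g u\<bar> < \<epsilon> / 2" if u: "u \<in> paths G" for u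
  proof -
    have "openin (path_topology G) {w \<in> paths G. g w \<in> ball (g u) (\<epsilon> / 2)}"
      using openin_continuous_map_preimage[OF g, of "ball (g u) (\<epsilon> / 2)"]
      by (simp add: topspace_path_topology)
    then obtain n where "cylinder G (window u 0 n) \<subseteq> {w \<in> paths G. g w \<in> ball (g u) (\<epsilon> / 2)}"
      using u \<epsilon> unfolding openin_path_topology by auto
    then show ?thesis
      by (intro exI[of _ n]) (auto simp: dist_real_def subset_iff abs_minus_commute)
  qed
  then obtain N where N: "\<And>u w. u \<in> paths G \<Longrightarrow> w \<in> cylinder G (window u 0 (N u)) \<Longrightarrow> \<bar>g w - g u\<bar> < \<epsilon> / 2"
    by metis
  let ?\<U> = "(\<lambda>u. cylinder G (window u 0 (N u))) ` paths G"
  have "paths G \<subseteq> \<Union> ?\<U>" by (auto simp: cylinder_iff)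
  then obtain F where F: "finite F" "F \<subseteq> paths G" "paths G \<subseteq> (\<Union>u\<in>F. cylinder G (window u 0 (N u)))"
  proof -
    have "\<exists>\<F>. finite \<F> \<and> \<F> \<subseteq> ?\<U> \<and> paths G \<subseteq> \<Union>\<F>"
    proof -
      have op: "\<forall>U\<in>?\<U>. openin (path_topology G) U" using openin_cylinder by auto
      show ?thesis
        using compact_space_path_topology[unfolded compact_space_alt topspace_path_topology,
            rule_format, of ?\<U>] op \<open>paths G \<subseteq> \<Union> ?\<U>\<close> by auto
    qed
    then obtain \<F> where \<F>: "finite \<F>" "\<F> \<subseteq> ?\<U>" "paths G \<subseteq> \<Union>\<F>" by blast
    obtain F where "F \<subseteq> paths G" "finite F" "\<F> = (\<lambda>u. cylinder G (window u 0 (N u))) ` F"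
      using finite_subset_image[OF \<F>(1,2)] by auto
    then show ?thesis using that[of F] \<F>(3) by simp
  qed
  define n where "n = Max (insert 0 (N ` F))"
  have Nn: "N u \<le> n" if "u \<in> F" for u using F(1) that by (simp add: n_def)
  show ?thesis
  proof (rule that)
    fix u w assume uw: "u \<in> paths G" "w \<in> paths G" "window u 0 n = window w 0 n"
    then obtain x where x: "x \<in> F" "u \<in> cylinder G (window x 0 (N x))" using F(3) by auto
    then have "w \<in> cylinder G (window x 0 (N x))"
      using uw Nn[OF x(1)] by (auto simp: cylinder_iff window_eq_iff)
    then show "\<bar>g u - g w\<bar> < \<epsilon>"
      using N[of x u, OF subsetD[OF F(2) x(1)] x(2)] N[of x w, OF subsetD[OF F(2) x(1)]] by linarith
  qed
qed

lemma compact_image_paths: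
  assumes "continuous_map (path_topology G) euclideanreal g"
  shows "compact (g ` paths G)"
  using image_compactin[OF _ assms, of "paths G"] compact_space_path_topology
  by (simp add: compact_space_def topspace_path_topology)

lemma continuous_bounded:
  assumes "continuous_map (path_topology G) euclideanreal g"
  obtains M where "M \<ge> 0" "\<And>u. u \<in> paths G \<Longrightarrow> \<bar>g u\<bar> \<le> M"
proof -
  obtain M where M: "\<And>u. u \<in> paths G \<Longrightarrow> \<bar>g u\<bar> \<le> M"
    using compact_imp_bounded[OF compact_image_paths[OF assms]] by (auto simp: bounded_iff)
  then have "M \<ge> 0" using paths_nonempty by (metis abs_ge_zero all_not_in_conv order_trans)
  with M show ?thesis using that by blast
qed

subsection \<open>Every word begins a path\<close>

lemma out_arc_exists: assumes "v \<in> verts G" shows "\<exists>e\<in>arcs G. tail G e = v"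
proof -
  obtain e where e: "e \<in> arcs G" using arcs_nonempty by blast
  then have "v \<rightarrow>\<^sup>*\<^bsub>G\<^esub> tail G e" using strong assms by (auto simp: strongly_connected_def)
  then obtain p where p: "awalk v p (tail G e)" by (auto simp: reachable_awalk)
  show ?thesis
  proof (cases p)
    case Nil
    with p e show ?thesis by (auto simp: awalk_def)
  next
    case (Cons a q)
    with p show ?thesis by (auto simp: awalk_def)
  qed
qed

lemma path_from_vertex: assumes "v \<in> verts G" shows "\<exists>u\<in>paths G. tail G (u 0) = v"
proof -
  (* Follow, from each vertex, one fixed outgoing arc. *)
  define nxt where "nxt x = (SOME e. e \<in> arcs G \<and> tail G e = x)" for x
  have nxt: "nxt x \<in> arcs G" "tail G (nxt x) = x" if "x \<in> verts G" for x
    using someI_ex[of "\<lambda>e. e \<in> arcs G \<and> tail G e = x"] out_arc_exists[OF that]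
    by (auto simp: nxt_def)
  define x where "x i = ((\<lambda>x. head G (nxt x)) ^^ i) v" for i
  have x: "x i \<in> verts G" for i
    by (induction i) (use assms nxt head_in_verts in \<open>auto simp: x_def\<close>)
  have "(\<lambda>i. nxt (x i)) \<in> paths G"
    using nxt[OF x] nxt(2)[OF x, of "Suc _"] by (auto simp: paths_def x_def)
  moreover have "tail G (nxt (x 0)) = v"
    using nxt assms by (simp add: x_def)
  ultimately show ?thesis by (intro bexI[of _ "\<lambda>i. nxt (x i)"])
qed

definition prepend :: "'e list \<Rightarrow> (nat \<Rightarrow> 'e) \<Rightarrow> (nat \<Rightarrow> 'e)" where
  "prepend x u = (\<lambda>i. if i < length x then x ! i else u (i - length x))"

lemma window_prepend: "length x \<le> n \<Longrightarrow> window (prepend x u) 0 n = x @ window u 0 (n - length x)"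
  by (auto simp: window_def prepend_def list_eq_iff_nth_eq nth_append)

lemma prepend_Cons_in_paths:
  assumes "e \<in> arcs G" "u \<in> paths G" "head G e = tail G (u 0)"
  shows "prepend [e] u \<in> paths G"
  using assms by (auto simp: paths_def prepend_def gr0_conv_Suc)

lemma prepend_Cons: "prepend (e # x) u = prepend [e] (prepend x u)"
  by (auto simp: prepend_def fun_eq_iff nth_Cons split: nat.splits)

lemma prepend_awalk_in_paths:
  assumes "awalk a x b" "u \<in> paths G" "tail G (u 0) = b"
  shows "prepend x u \<in> paths G" "tail G (prepend x u 0) = a"
proof -
  have "prepend x u \<in> paths G \<and> tail G (prepend x u 0) = a"
    using assms(1)
  proof (induction x arbitrary: a)
    case Nil
    then show ?case using assms by (auto simp: prepend_def awalk_def)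
  next
    case (Cons e x)
    then have e: "e \<in> arcs G" "tail G e = a" and w: "awalk (head G e) x b"
      by (auto simp: awalk_Cons_iff)
    have "prepend x u \<in> paths G" "tail G (prepend x u 0) = head G e" using Cons.IH[OF w] by auto
    then show ?case
      using e prepend_Cons_in_paths[of e "prepend x u"] by (simp add: prepend_Cons[of e x]) (simp add: prepend_def)
  qed
  then show "prepend x u \<in> paths G" "tail G (prepend x u 0) = a" by auto
qed

lemma awalk_word:
  assumes "w \<in> words G n" "w \<noteq> []"
  shows "awalk (tail G (hd w)) w (head G (last w))"
  using assms
proof (induction w arbitrary: n)
  case Nil
  then show ?case by simp
next
  case (Cons e w)
  have e: "e \<in> arcs G" using Cons.prems by (auto simp: words_def)
  have w: "w \<in> words G (length w)"
    unfolding words_def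
  proof (intro CollectI conjI allI impI)
    fix k assume "Suc k < length w"
    then show "head G (w ! k) = tail G (w ! Suc k)"
      using Cons.prems unfolding words_def by (auto dest: spec[of _ "Suc k"])
  qed (use Cons.prems in \<open>auto simp: words_def\<close>)
  show ?case
  proof (cases "w = []")
    case True
    then show ?thesis using e by (auto simp: awalk_Cons_iff awalk_Nil_iff)
  next
    case False
    then have "head G e = tail G (hd w)"
      using Cons.prems by (auto simp: words_def hd_conv_nth dest!: spec[of _ 0])
    then show ?thesis
      using Cons.IH[OF w False] e False by (auto simp: awalk_Cons_iff)
  qed
qed

lemma cylinder_word_nonempty: assumes "w \<in> words G n" shows "cylinder G w \<noteq> {}"
proof (cases "w = []")
  case True
  then show ?thesis using paths_nonempty by simp
next
  case False
  have w: "awalk (tail G (hd w)) w (head G (last w))" by (rule awalk_word[OF assms False])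
  then obtain u where u: "u \<in> paths G" "tail G (u 0) = head G (last w)"
    using path_from_vertex awalk_last_in_verts by blast
  have "prepend w u \<in> cylinder G w"
    using prepend_awalk_in_paths(1)[OF w u] window_prepend[of w "length w" u] by (simp add: cylinder_iff)
  then show ?thesis by blast
qed

lemma finite_words: "finite (words G n)"
  by (rule finite_subset[OF _ finite_arc_lists[of n]]) (auto simp: words_def)

lemma cylinder_not_word: "w \<notin> words G (length w) \<Longrightarrow> cylinder G w = {}"
  using window_in_words[of _ G 0 "length w"] by (metis cylinder_iff ex_in_conv)

end

section \<open>Path measures and their masses on cylinders\<close>

context path_space
begin

abbreviation mass :: "(nat \<Rightarrow> 'e) measure \<Rightarrow> 'e list \<Rightarrow> real" where
  "mass \<mu> v \<equiv> measure \<mu> (cylinder G v)"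

lemma sets_borel_algebra_paths:
  "sets (borel_algebra (path_topology G)) = sigma_sets (paths G) (range (cylinder G))"
proof -
  have "A \<in> sigma_sets (paths G) (range (cylinder G))" if "openin (path_topology G) A" for A
  proof -
    have A: "A \<subseteq> paths G" "\<And>u. u \<in> A \<Longrightarrow> \<exists>n. cylinder G (window u 0 n) \<subseteq> A"
      using that by (auto simp: openin_path_topology)
    define I where "I = {v \<in> (\<Union>n. arc_lists G n). cylinder G v \<subseteq> A}"
    have "countable I"
    proof (rule countable_subset)
      show "I \<subseteq> (\<Union>n. arc_lists G n)" unfolding I_def by blast
      show "countable (\<Union>n. arc_lists G n)"
        by (rule countable_UN[OF countableI_type countable_finite[OF finite_arc_lists]])
    qed
    moreover have "A = (\<Union>v\<in>I. cylinder G v)"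
    proof (intro equalityI subsetI)
      fix u assume u: "u \<in> A"
      then obtain n where n: "cylinder G (window u 0 n) \<subseteq> A" using A by blast
      moreover have "u \<in> cylinder G (window u 0 n)" "window u 0 n \<in> arc_lists G n"
        using u A(1) window_in_arc_lists[of u G 0 n] by (auto simp: cylinder_iff)
      ultimately show "u \<in> (\<Union>v\<in>I. cylinder G v)"
        unfolding I_def by blast
    qed (auto simp: I_def)
    moreover have "(\<Union>v\<in>I. cylinder G v) \<in> sigma_sets (paths G) (range (cylinder G))"
      using \<open>countable I\<close> cylinder_subset_paths
      by (intro sigma_sets_UNION) (auto intro: sigma_sets.Basic)
    ultimately show ?thesis by simp
  qed
  then have "sigma_sets (paths G) {A. openin (path_topology G) A} = sigma_sets (paths G) (range (cylinder G))"
    by (intro sigma_sets_eqI) (auto intro: openin_cylinder sigma_sets.Basic)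
  moreover have "{A. openin (path_topology G) A} \<subseteq> Pow (paths G)"
    using openin_subset topspace_path_topology by fastforce
  ultimately show ?thesis
    by (simp add: borel_algebra_def topspace_path_topology)
qed

lemma
  assumes "\<mu> \<in> path_measures G"
  shows space_path_measure: "space \<mu> = paths G"
    and sets_path_measure: "sets \<mu> = sigma_sets (paths G) (range (cylinder G))"
    and prob_space_path_measure: "prob_space \<mu>"
  using assms sets_borel_algebra_paths
  by (auto simp: path_measures_def prob_measures_def topspace_path_topology)

lemma path_measureI:
  assumes "space \<mu> = paths G" "sets \<mu> = sigma_sets (paths G) (range (cylinder G))" "prob_space \<mu>"
  shows "\<mu> \<in> path_measures G"
  using assms sets_borel_algebra_paths
  by (auto simp: path_measures_def prob_measures_def topspace_path_topology)

lemma cylinder_in_sets: "\<mu> \<in> path_measures G \<Longrightarrow> cylinder G v \<in> sets \<mu>"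
  by (auto simp: sets_path_measure)

lemma mass_Nil: assumes "\<mu> \<in> path_measures G" shows "mass \<mu> [] = 1"
  using prob_space.prob_space[OF prob_space_path_measure[OF assms]]
  by (simp add: space_path_measure[OF assms])

lemma mass_le_1: assumes "\<mu> \<in> path_measures G" shows "mass \<mu> v \<le> 1"
  by (rule prob_space.prob_le_1[OF prob_space_path_measure[OF assms]])

lemma mass_snoc:
  assumes "\<mu> \<in> path_measures G" shows "mass \<mu> v = (\<Sum>e\<in>arcs G. mass \<mu> (v @ [e]))"
proof -
  interpret prob_space \<mu> by (rule prob_space_path_measure[OF assms])
  show ?thesis
    unfolding cylinder_eq_UN_snoc[of G v]
    by (intro finite_measure_finite_Union finite_arcs disjoint_cylinder_snoc)
      (auto simp: cylinder_in_sets[OF assms])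
qed

lemma mass_extend:
  assumes "\<mu> \<in> path_measures G" shows "mass \<mu> v = (\<Sum>w\<in>arc_lists G n. mass \<mu> (v @ w))"
proof (induction n)
  case 0
  have "{w. set w \<subseteq> arcs G \<and> length w = 0} = {[]}" by auto
  then show ?case by simp
next
  case (Suc n)
  have "mass \<mu> v = (\<Sum>w\<in>arc_lists G n. mass \<mu> (v @ w))" by (rule Suc.IH)
  also have "\<dots> = (\<Sum>w\<in>arc_lists G n. \<Sum>e\<in>arcs G. mass \<mu> ((v @ w) @ [e]))"
    by (intro sum.cong refl mass_snoc[OF assms])
  also have "\<dots> = (\<Sum>w\<in>arc_lists G (Suc n). mass \<mu> (v @ w))"
    unfolding sum_arc_lists_Suc append_assoc ..
  finally show ?case .
qed

lemma card_arc_lists_pos: "card (arc_lists G n) > 0"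
proof -
  obtain u where "u \<in> paths G" using paths_nonempty by blast
  then have "window u 0 n \<in> arc_lists G n" by (rule window_in_arc_lists)
  then show ?thesis using card_gt_0_iff finite_arc_lists[of n] by blast
qed

lemma sum_mass: "\<mu> \<in> path_measures G \<Longrightarrow> (\<Sum>w\<in>arc_lists G n. mass \<mu> w) = 1"
  using mass_extend[of \<mu> "[]" n] mass_Nil[of \<mu>] by simp

text \<open>
  The cylinders are closed under intersection up to the empty set, so Dynkin's theorem applies.
\<close>

lemma path_measure_eqI:
  assumes "\<mu> \<in> path_measures G" "\<nu> \<in> path_measures G" "\<And>v. mass \<mu> v = mass \<nu> v"
  shows "\<mu> = \<nu>"
proof (rule measure_eqI_generator_eq[where E = "insert {} (range (cylinder G))" and \<Omega> = "paths G" and A = "\<lambda>_. paths G"])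
  interpret \<mu>: prob_space \<mu> by (rule prob_space_path_measure[OF assms(1)])
  interpret \<nu>: prob_space \<nu> by (rule prob_space_path_measure[OF assms(2)])
  show "Int_stable (insert {} (range (cylinder G)))"
  proof (rule Int_stableI)
    fix a b assume ab: "a \<in> insert {} (range (cylinder G))" "b \<in> insert {} (range (cylinder G))"
    have "cylinder G v \<inter> cylinder G w \<in> insert {} (range (cylinder G))" for v w
      using cylinder_inter[of v w G] cylinder_inter[of w v G] linear[of "length v" "length w"]
      by (auto simp: Int_commute)
    then show "a \<inter> b \<in> insert {} (range (cylinder G))" using ab by blast
  qed
  show "insert {} (range (cylinder G)) \<subseteq> Pow (paths G)" using cylinder_subset_paths by blast
  have eq: "sigma_sets (paths G) (insert {} (range (cylinder G))) = sigma_sets (paths G) (range (cylinder G))"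
    by (rule sigma_sets_eqI) (auto intro: sigma_sets.Basic sigma_sets.Empty)
  show "sets \<mu> = sigma_sets (paths G) (insert {} (range (cylinder G)))"
    "sets \<nu> = sigma_sets (paths G) (insert {} (range (cylinder G)))"
    using assms by (simp_all add: eq sets_path_measure)
  show "emeasure \<mu> X = emeasure \<nu> X" if "X \<in> insert {} (range (cylinder G))" for X
    using that assms(3) by (auto simp: \<mu>.emeasure_eq_measure \<nu>.emeasure_eq_measure)
  have "cylinder G [] \<in> range (cylinder G)" by blast
  then show "range (\<lambda>_. paths G) \<subseteq> insert {} (range (cylinder G))" by auto
  show "emeasure \<mu> (paths G) \<noteq> \<infinity>" using \<mu>.emeasure_finite by simp
qed auto

lemma borel_measurable_continuous:
  assumes g: "continuous_map (path_topology G) euclideanreal g" and \<mu>: "\<mu> \<in> path_measures G"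
  shows "g \<in> borel_measurable \<mu>"
proof (rule borel_measurableI)
  fix S :: "real set" assume "open S"
  then have "openin (path_topology G) {u \<in> paths G. g u \<in> S}"
    using openin_continuous_map_preimage[OF g, of S] by (simp add: topspace_path_topology)
  moreover have "g -` S \<inter> space \<mu> = {u \<in> paths G. g u \<in> S}"
    by (auto simp: space_path_measure[OF \<mu>])
  moreover have "sets \<mu> = sigma_sets (paths G) {A. openin (path_topology G) A}"
  proof -
    have "{A. openin (path_topology G) A} \<subseteq> Pow (paths G)"
      using openin_subset topspace_path_topology by fastforce
    then show ?thesis using \<mu>
      by (simp add: path_measures_def prob_measures_def borel_algebra_def topspace_path_topology)
  qed
  ultimately show "g -` S \<inter> space \<mu> \<in> sets \<mu>"
    by (auto intro: sigma_sets.Basic)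
qed

lemma integrable_continuous:
  assumes g: "continuous_map (path_topology G) euclideanreal g" and \<mu>: "\<mu> \<in> path_measures G"
  shows "integrable \<mu> g"
proof -
  interpret prob_space \<mu> by (rule prob_space_path_measure[OF \<mu>])
  obtain M where "\<And>u. u \<in> paths G \<Longrightarrow> \<bar>g u\<bar> \<le> M" using continuous_bounded[OF g] by metis
  then show ?thesis
    by (intro integrable_const_bound[of _ M] borel_measurable_continuous[OF g \<mu>])
      (auto simp: space_path_measure[OF \<mu>])
qed

text \<open>
  A sample point of each cylinder, at which continuous functions are evaluated to obtain step functions.
\<close>

definition pick :: "'e list \<Rightarrow> (nat \<Rightarrow> 'e)" where
  "pick v = (SOME u. u \<in> cylinder G v)"

lemma pick_in_cylinder: "u \<in> cylinder G v \<Longrightarrow> pick v \<in> cylinder G v"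
  unfolding pick_def by (rule someI[of "\<lambda>u. u \<in> cylinder G v"])

text \<open>
  The step functions that are constant on the cylinders of one length approximate a continuous
  function uniformly. Hence its integral is determined, up to an error that does not depend on the
  measure, by finitely many masses of cylinders.
\<close>

lemma integral_approx:
  assumes g: "continuous_map (path_topology G) euclideanreal g" and \<epsilon>: "\<epsilon> > 0"
  obtains k where "\<And>\<mu>. \<mu> \<in> path_measures G \<Longrightarrow>
    \<bar>integral\<^sup>L \<mu> g - (\<Sum>v\<in>arc_lists G k. mass \<mu> v * g (pick v))\<bar> \<le> \<epsilon>"
proof -
  obtain k where k: "\<And>u w. u \<in> paths G \<Longrightarrow> w \<in> paths G \<Longrightarrow> window u 0 k = window w 0 k \<Longrightarrow> \<bar>g u - g w\<bar> < \<epsilon>"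
    using uniformly_continuous_on_cylinders[OF g \<epsilon>] by metis
  show ?thesis
  proof (rule that)
    fix \<mu> assume \<mu>: "\<mu> \<in> path_measures G"
    interpret prob_space \<mu> by (rule prob_space_path_measure[OF \<mu>])
    define s where "s u = (\<Sum>v\<in>arc_lists G k. indicator (cylinder G v) u *\<^sub>R g (pick v))" for u
    have ind: "has_bochner_integral \<mu> (\<lambda>u. indicator (cylinder G v) u *\<^sub>R g (pick v)) (mass \<mu> v *\<^sub>R g (pick v))" for v
      by (rule has_bochner_integral_indicator) (auto simp: cylinder_in_sets[OF \<mu>] less_top[symmetric])
    then have s: "has_bochner_integral \<mu> s (\<Sum>v\<in>arc_lists G k. mass \<mu> v *\<^sub>R g (pick v))"
      unfolding s_def by (rule has_bochner_integral_sum)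
    have s_eq: "s u = g (pick (window u 0 k))" if u: "u \<in> paths G" for u
    proof -
      have "s u = (\<Sum>v\<in>arc_lists G k. if v = window u 0 k then g (pick v) else 0)"
        unfolding s_def using u by (intro sum.cong) (auto simp: cylinder_iff indicator_def)
      also have "\<dots> = g (pick (window u 0 k))"
        using window_in_arc_lists[OF u, of 0 k] by (subst sum.delta[OF finite_arc_lists]) simp
      finally show ?thesis .
    qed
    have "\<bar>g u - s u\<bar> \<le> \<epsilon>" if u: "u \<in> paths G" for u
    proof -
      have "pick (window u 0 k) \<in> cylinder G (window u 0 k)"
        using pick_in_cylinder[of u "window u 0 k"] u by (simp add: cylinder_iff)
      then show ?thesis
        unfolding s_eq[OF u] using k[OF u, of "pick (window u 0 k)"] by (auto simp: cylinder_iff)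
    qed
    then have "\<bar>integral\<^sup>L \<mu> (\<lambda>u. g u - s u)\<bar> \<le> \<epsilon>"
      using integrable_continuous[OF g \<mu>] has_bochner_integral_integrable[of \<mu> s] s
      by (intro order_trans[OF integral_abs_bound] integral_le_const Bochner_Integration.integrable_abs
          Bochner_Integration.integrable_diff)
        (auto simp: space_path_measure[OF \<mu>] has_bochner_integral_iff)
    moreover have "integral\<^sup>L \<mu> (\<lambda>u. g u - s u) = integral\<^sup>L \<mu> g - (\<Sum>v\<in>arc_lists G k. mass \<mu> v * g (pick v))"
      using s integrable_continuous[OF g \<mu>] by (simp add: has_bochner_integral_iff)
    ultimately show "\<bar>integral\<^sup>L \<mu> g - (\<Sum>v\<in>arc_lists G k. mass \<mu> v * g (pick v))\<bar> \<le> \<epsilon>" by simp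
  qed
qed

text \<open>
  Mixtures are only assumed on cylinders; the step functions of \<open>integral_approx\<close>, whose integrals are
  finite sums of masses, carry the identity over to integrals.
\<close>

lemma integral_mixture:
  assumes g: "continuous_map (path_topology G) euclideanreal g"
    and \<nu>: "\<nu> \<in> path_measures G" and \<mu>: "\<And>i. i \<in> I \<Longrightarrow> \<mu> i \<in> path_measures G"
    and c: "\<And>i. i \<in> I \<Longrightarrow> c i \<ge> 0" "(\<Sum>i\<in>I. c i) = 1"
    and mix: "\<And>v. mass \<nu> v = (\<Sum>i\<in>I. c i * mass (\<mu> i) v)"
  shows "integral\<^sup>L \<nu> g = (\<Sum>i\<in>I. c i * integral\<^sup>L (\<mu> i) g)"
proof -
  have "\<bar>integral\<^sup>L \<nu> g - (\<Sum>i\<in>I. c i * integral\<^sup>L (\<mu> i) g)\<bar> \<le> \<epsilon>" if "\<epsilon> > 0" for \<epsilon>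
  proof -
    obtain k where k: "\<And>\<mu>. \<mu> \<in> path_measures G \<Longrightarrow>
      \<bar>integral\<^sup>L \<mu> g - (\<Sum>v\<in>arc_lists G k. mass \<mu> v * g (pick v))\<bar> \<le> \<epsilon> / 2"
      using integral_approx[OF g, of "\<epsilon> / 2"] \<open>\<epsilon> > 0\<close> by auto
    let ?s = "\<lambda>\<mu>. \<Sum>v\<in>arc_lists G k. mass \<mu> v * g (pick v)"
    have "?s \<nu> = (\<Sum>i\<in>I. c i * ?s (\<mu> i))"
      unfolding mix sum_distrib_left sum_distrib_right
      by (subst sum.swap) (simp add: mult.assoc)
    moreover have "\<bar>(\<Sum>i\<in>I. c i * ?s (\<mu> i)) - (\<Sum>i\<in>I. c i * integral\<^sup>L (\<mu> i) g)\<bar> \<le> (\<Sum>i\<in>I. c i * (\<epsilon> / 2))"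
    proof -
      have "\<bar>c i * (?s (\<mu> i) - integral\<^sup>L (\<mu> i) g)\<bar> \<le> c i * (\<epsilon> / 2)" if "i \<in> I" for i
      proof -
        have "\<bar>?s (\<mu> i) - integral\<^sup>L (\<mu> i) g\<bar> \<le> \<epsilon> / 2"
          using k[OF \<mu>[OF that]] by (simp only: abs_minus_commute)
        from mult_left_mono[OF this c(1)[OF that]] show ?thesis
          using c(1)[OF that] by (simp only: abs_mult abs_of_nonneg)
      qed
      then have "\<bar>\<Sum>i\<in>I. c i * (?s (\<mu> i) - integral\<^sup>L (\<mu> i) g)\<bar> \<le> (\<Sum>i\<in>I. c i * (\<epsilon> / 2))"
        by (intro order_trans[OF sum_abs] sum_mono)
      then show ?thesis by (simp only: sum_subtractf right_diff_distrib)
    qed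
    moreover have "(\<Sum>i\<in>I. c i * (\<epsilon> / 2)) = \<epsilon> / 2"
      using c(2) by (simp only: sum_distrib_right[symmetric] mult_1_left)
    ultimately show ?thesis using k[OF \<nu>] by linarith
  qed
  then have "\<bar>integral\<^sup>L \<nu> g - (\<Sum>i\<in>I. c i * integral\<^sup>L (\<mu> i) g)\<bar> \<le> 0"
    by (rule field_le_epsilon) simp
  then show ?thesis by simp
qed

text \<open>
  The masses of the cylinders of one length add up to \<open>1\<close>, so lower bounds for all of them give
  upper bounds as well. This is why one-sided conditions suffice to describe weak neighbourhoods.
\<close>

lemma mass_close_if_lower_bounds:
  fixes \<delta> :: real
  assumes "\<mu> \<in> path_measures G" "\<nu> \<in> path_measures G"
    and lower: "\<And>v. v \<in> arc_lists G k \<Longrightarrow> mass \<nu> v \<ge> mass \<mu> v - \<delta>" and \<delta>: "\<delta> \<ge> 0"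
    and v: "v \<in> arc_lists G k"
  shows "\<bar>mass \<nu> v - mass \<mu> v\<bar> \<le> real (card (arc_lists G k)) * \<delta>"
proof -
  have "(\<Sum>w\<in>arc_lists G k - {v}. mass \<mu> w - \<delta>) \<le> (\<Sum>w\<in>arc_lists G k - {v}. mass \<nu> w)"
    using lower by (intro sum_mono) blast
  moreover have "(\<Sum>w\<in>arc_lists G k - {v}. mass \<mu> w) = 1 - mass \<mu> v"
    "(\<Sum>w\<in>arc_lists G k - {v}. mass \<nu> w) = 1 - mass \<nu> v"
    using sum_mass[OF assms(1), of k] sum_mass[OF assms(2), of k] v
    by (simp_all add: sum.remove[OF finite_arc_lists v])
  moreover have "real (card (arc_lists G k - {v})) * \<delta> \<le> real (card (arc_lists G k)) * \<delta>"
    using \<delta> by (intro mult_right_mono of_nat_mono card_mono finite_arc_lists) auto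
  moreover have "\<delta> \<le> real (card (arc_lists G k)) * \<delta>"
    using mult_right_mono[OF _ \<delta>, of 1 "real (card (arc_lists G k))"] card_arc_lists_pos[of k] by simp
  moreover have "(\<Sum>w\<in>arc_lists G k - {v}. mass \<mu> w - \<delta>)
      = (\<Sum>w\<in>arc_lists G k - {v}. mass \<mu> w) - real (card (arc_lists G k - {v})) * \<delta>"
    by (simp add: sum_subtractf)
  ultimately show ?thesis
    using lower[OF v] by linarith
qed

text \<open>
  For the generators of the topology, sets defined by the integral of one continuous function, this is
  the approximation by step functions. Masses of longer cylinders determine those of shorter ones,
  which makes the condition stable under intersection.
\<close>

lemma weak_neighbourhood:
  assumes "openin (weak_topology (path_topology G)) A" and "\<mu> \<in> A" and "\<mu> \<in> path_measures G"
  shows "\<exists>\<delta>>0. \<exists>k>0. \<forall>\<nu>\<in>path_measures G. (\<forall>v\<in>arc_lists G k. mass \<nu> v \<ge> mass \<mu> v - \<delta>) \<longrightarrow> \<nu> \<in> A"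
proof -
  define nbhd where "nbhd k \<delta> = {\<nu> \<in> path_measures G. \<forall>v\<in>arc_lists G k. mass \<nu> v \<ge> mass \<mu> v - \<delta>}" for k \<delta>
  have longer: "nbhd (k + l) (\<delta> / card (arc_lists G l)) \<subseteq> nbhd k \<delta>" for k l \<delta>
  proof
    fix \<nu> assume \<nu>: "\<nu> \<in> nbhd (k + l) (\<delta> / card (arc_lists G l))"
    have "mass \<nu> v \<ge> mass \<mu> v - \<delta>" if v: "v \<in> arc_lists G k" for v
    proof -
      have "(\<Sum>w\<in>arc_lists G l. mass \<mu> (v @ w) - \<delta> / card (arc_lists G l)) \<le> (\<Sum>w\<in>arc_lists G l. mass \<nu> (v @ w))"
        using v \<nu> by (intro sum_mono) (auto simp: nbhd_def)
      moreover have "(\<Sum>w\<in>arc_lists G l. mass \<mu> (v @ w) - \<delta> / card (arc_lists G l))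
          = (\<Sum>w\<in>arc_lists G l. mass \<mu> (v @ w)) - \<delta>"
      proof -
        have "(\<Sum>w\<in>A. f w - \<delta> / card A) = sum f A - \<delta>" if "card A > 0" for A and f :: "'e list \<Rightarrow> real"
          using that by (simp add: sum_subtractf)
        from this[OF card_arc_lists_pos] show ?thesis .
      qed
      moreover have "mass \<mu> v = (\<Sum>w\<in>arc_lists G l. mass \<mu> (v @ w))"
        "mass \<nu> v = (\<Sum>w\<in>arc_lists G l. mass \<nu> (v @ w))"
        using mass_extend[OF assms(3)] mass_extend[of \<nu>] \<nu> by (auto simp: nbhd_def)
      ultimately show ?thesis by linarith
    qed
    then show "\<nu> \<in> nbhd k \<delta>" using \<nu> by (auto simp: nbhd_def)
  qed
  have "\<exists>k \<delta>. \<delta> > 0 \<and> nbhd k \<delta> \<subseteq> A"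
    using openin_topology_generated_by[OF assms(1)[unfolded weak_topology_def]] assms(2)
  proof (induction rule: generate_topology_on.induct)
    case (Int a b)
    then obtain k \<delta> l \<eta> where *: "\<delta> > 0" "nbhd k \<delta> \<subseteq> a" "\<eta> > 0" "nbhd l \<eta> \<subseteq> b" by blast
    define c d where "c = \<delta> / card (arc_lists G l)" and "d = \<eta> / card (arc_lists G k)"
    have "nbhd (k + l) (min c d) \<subseteq> nbhd (k + l) c \<inter> nbhd (l + k) d"
      by (force simp: nbhd_def add.commute)
    also have "\<dots> \<subseteq> nbhd k \<delta> \<inter> nbhd l \<eta>"
      unfolding c_def d_def using longer[of k l \<delta>] longer[of l k \<eta>] by blast
    finally show ?case
      using * card_arc_lists_pos[of l] card_arc_lists_pos[of k] by (intro exI[of _ "k + l"] exI[of _ "min c d"]) (auto simp: c_def d_def)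
  next
    case (UN K)
    then obtain a where a: "a \<in> K" "\<mu> \<in> a" by blast
    then obtain k \<delta> where "\<delta> > 0" "nbhd k \<delta> \<subseteq> a" using UN.IH by blast
    then show ?case using a(1) by blast
  next
    case (Basis s)
    then obtain g V where s: "s = {\<mu> \<in> path_measures G. integral\<^sup>L \<mu> g \<in> V}"
      and g: "continuous_map (path_topology G) euclideanreal g" and V: "open V"
      by (auto simp: path_measures_def)
    obtain r where r: "r > 0" "ball (integral\<^sup>L \<mu> g) r \<subseteq> V"
      using V Basis s by (auto simp: open_contains_ball)
    obtain k where k: "\<And>\<mu>. \<mu> \<in> path_measures G \<Longrightarrow>
      \<bar>integral\<^sup>L \<mu> g - (\<Sum>v\<in>arc_lists G k. mass \<mu> v * g (pick v))\<bar> \<le> r / 4"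
      using integral_approx[OF g, of "r / 4"] r(1) by auto
    define B where "B = (\<Sum>v\<in>arc_lists G k. \<bar>g (pick v)\<bar>)"
    define N where "N = real (card (arc_lists G k))"
    define \<delta> where "\<delta> = (r / 4) / ((N + 1) * (B + 1))"
    have NB: "N \<ge> 0" "B \<ge> 0" by (auto simp: N_def B_def intro: sum_nonneg)
    then have \<delta>: "\<delta> > 0" using r(1) by (simp add: \<delta>_def)
    have "nbhd k \<delta> \<subseteq> s"
    proof
      fix \<nu> assume "\<nu> \<in> nbhd k \<delta>"
      then have \<nu>: "\<nu> \<in> path_measures G" "\<And>v. v \<in> arc_lists G k \<Longrightarrow> mass \<nu> v \<ge> mass \<mu> v - \<delta>"
        by (auto simp: nbhd_def)
      have close: "\<bar>mass \<nu> v - mass \<mu> v\<bar> \<le> N * \<delta>" if "v \<in> arc_lists G k" for v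
        unfolding N_def using mass_close_if_lower_bounds[OF assms(3) \<nu>(1) \<nu>(2) _ that] \<delta> by simp
      have "\<bar>(\<Sum>v\<in>arc_lists G k. mass \<nu> v * g (pick v)) - (\<Sum>v\<in>arc_lists G k. mass \<mu> v * g (pick v))\<bar>
        \<le> (\<Sum>v\<in>arc_lists G k. N * \<delta> * \<bar>g (pick v)\<bar>)"
        unfolding sum_subtractf[symmetric] left_diff_distrib[symmetric]
        by (rule order_trans[OF sum_abs] sum_mono)+
          (use close in \<open>auto simp: abs_mult intro!: mult_right_mono\<close>)
      also have "\<dots> = N * \<delta> * B" by (simp add: B_def sum_distrib_left)
      also have "\<dots> \<le> ((N + 1) * (B + 1)) * \<delta>"
        using NB \<delta> by (simp add: algebra_simps)
      also have "\<dots> = r / 4"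
      proof -
        have "(N + 1) * (B + 1) \<noteq> 0" using NB by simp
        then show ?thesis unfolding \<delta>_def by (rule nonzero_mult_div_cancel_left[where b = "r / 4", simplified times_divide_eq_right[symmetric]])
      qed
      finally have "\<bar>integral\<^sup>L \<nu> g - integral\<^sup>L \<mu> g\<bar> < r"
        using k[OF \<nu>(1)] k[OF assms(3)] r(1) by linarith
      then show "\<nu> \<in> s"
        using r(2) \<nu>(1) unfolding s by (auto simp: dist_real_def subset_iff abs_minus_commute)
    qed
    with \<delta> show ?case by blast
  qed simp
  then obtain l \<eta> where l: "\<eta> > 0" "nbhd l \<eta> \<subseteq> A" by blast
  define k \<delta> where "k = l + 1" and "\<delta> = \<eta> / card (arc_lists G 1)"
  have k: "\<delta> > 0" "nbhd k \<delta> \<subseteq> A" "k > 0"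
    using l(1) card_arc_lists_pos[of 1] subset_trans[OF longer[of l 1 \<eta>] l(2)] by (simp_all add: k_def \<delta>_def)
  show ?thesis
  proof (intro exI[of _ \<delta>] conjI exI[of _ k] ballI impI)
    show "\<nu> \<in> A" if "\<nu> \<in> path_measures G" "\<forall>v\<in>arc_lists G k. mass \<nu> v \<ge> mass \<mu> v - \<delta>" for \<nu>
      by (rule subsetD[OF k(2)]) (use that in \<open>auto simp: nbhd_def\<close>)
  qed (rule k(1), rule k(3))
qed

lemma eventually_in_weakly_open:
  assumes "openin (weak_topology (path_topology G)) A" and "\<mu> \<in> A" and "\<mu> \<in> path_measures G"
    and X: "\<And>n. X n \<in> path_measures G" "\<And>v. (\<lambda>n. mass (X n) v) \<longlonglongrightarrow> mass \<mu> v"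
  shows "eventually (\<lambda>n. X n \<in> A) sequentially"
proof -
  obtain \<delta> k where "\<delta> > 0"
    and k: "\<forall>\<nu>\<in>path_measures G. (\<forall>v\<in>arc_lists G k. mass \<nu> v \<ge> mass \<mu> v - \<delta>) \<longrightarrow> \<nu> \<in> A"
    using weak_neighbourhood[OF assms(1-3)] by blast
  have "eventually (\<lambda>n. mass (X n) v > mass \<mu> v - \<delta>) sequentially" for v
    using order_tendstoD(1)[OF X(2)[of v], of "mass \<mu> v - \<delta>"] \<open>\<delta> > 0\<close> by simp
  then have "eventually (\<lambda>n. \<forall>v\<in>arc_lists G k. mass (X n) v > mass \<mu> v - \<delta>) sequentially"
    by (intro eventually_ball_finite[OF finite_arc_lists] ballI)
  then show ?thesis
    by eventually_elim (rule k[rule_format, OF X(1)], rule less_imp_le, blast)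
qed

lemma openin_vimage_integral:
  assumes g: "continuous_map (path_topology G) euclideanreal g" and V: "open V"
  shows "openin (weak_topology (path_topology G)) {\<mu> \<in> path_measures G. integral\<^sup>L \<mu> g \<in> V}"
proof -
  obtain M where "\<And>u. u \<in> paths G \<Longrightarrow> \<bar>g u\<bar> \<le> M" using continuous_bounded[OF g] by metis
  then have "bounded (g ` topspace (path_topology G))"
    by (auto simp: bounded_iff topspace_path_topology)
  then show ?thesis
    unfolding weak_topology_def path_measures_def using g V
    by (intro topology_generated_by_Basis) blast
qed

lemma tendsto_integral_if_masses_tendsto:
  assumes g: "continuous_map (path_topology G) euclideanreal g" and "\<mu> \<in> path_measures G"
    and X: "\<And>n. X n \<in> path_measures G" "\<And>v. (\<lambda>n. mass (X n) v) \<longlonglongrightarrow> mass \<mu> v"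
  shows "(\<lambda>n. integral\<^sup>L (X n) g) \<longlonglongrightarrow> integral\<^sup>L \<mu> g"
proof (rule topological_tendstoI)
  fix V assume V: "open V" "integral\<^sup>L \<mu> g \<in> V"
  show "eventually (\<lambda>n. integral\<^sup>L (X n) g \<in> V) sequentially"
    using eventually_in_weakly_open[OF openin_vimage_integral[OF g V(1)] _ assms(2) X] V assms(2)
    by (auto elim: eventually_mono)
qed

end

section \<open>Compactness of the set of path measures\<close>

context path_space
begin

text \<open>
  Membership in \<open>A\<close> depends on the first \<open>n\<close> arcs only; equivalently, \<open>A\<close> is a union of cylinders of
  length \<open>n\<close>. These sets are both open and closed.
\<close>

definition determined :: "nat \<Rightarrow> (nat \<Rightarrow> 'e) set \<Rightarrow> bool" where
  "determined n A \<longleftrightarrow> A \<subseteq> paths G \<and> (\<forall>u\<in>A. cylinder G (window u 0 n) \<subseteq> A)"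

lemma cylinder_window_antimono: "m \<le> n \<Longrightarrow> cylinder G (window u 0 n) \<subseteq> cylinder G (window u 0 m)"
  by (auto simp: cylinder_iff window_eq_iff)

lemma determined_mono: "determined m A \<Longrightarrow> m \<le> n \<Longrightarrow> determined n A"
  unfolding determined_def using cylinder_window_antimono by blast

lemma determined_empty: "determined n {}"
  by (simp add: determined_def)

lemma determined_Un: "determined n A \<Longrightarrow> determined n B \<Longrightarrow> determined n (A \<union> B)"
  unfolding determined_def by blast

lemma determined_Diff: assumes "determined n A" "determined n B" shows "determined n (A - B)"
proof -
  have "w \<notin> B" if "u \<in> A" "u \<notin> B" "w \<in> cylinder G (window u 0 n)" for u w
  proof
    assume "w \<in> B"
    then have "cylinder G (window w 0 n) \<subseteq> B" using assms by (simp add: determined_def)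
    moreover have "u \<in> cylinder G (window w 0 n)"
      using that assms(1) by (auto simp: cylinder_iff determined_def)
    ultimately show False using that by blast
  qed
  then show ?thesis using assms unfolding determined_def by blast
qed

lemma determined_cylinder: "determined (length v) (cylinder G v)"
  by (auto simp: determined_def cylinder_iff)

lemma determined_cylinder_cases:
  assumes "determined (length v) A" shows "cylinder G v \<subseteq> A \<or> cylinder G v \<inter> A = {}"
proof (cases "cylinder G v \<inter> A = {}")
  case False
  then obtain u where u: "u \<in> cylinder G v" "u \<in> A" by blast
  then have "cylinder G (window u 0 (length v)) \<subseteq> A" using assms by (simp add: determined_def)
  then show ?thesis using u(1) by (simp add: cylinder_iff)
qed simp

lemma openin_determined: "determined n A \<Longrightarrow> openin (path_topology G) A"
  unfolding determined_def openin_path_topology by blast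

lemma determined_paths: "determined n (paths G)"
  by (auto simp: determined_def cylinder_iff)

lemma determined_eq_UN: "determined n A \<Longrightarrow> A = (\<Union>v\<in>{v \<in> arc_lists G n. cylinder G v \<subseteq> A}. cylinder G v)"
proof (intro equalityI subsetI)
  fix u assume "determined n A" and u: "u \<in> A"
  then have "u \<in> paths G" "cylinder G (window u 0 n) \<subseteq> A" by (auto simp: determined_def)
  moreover have "window u 0 n \<in> arc_lists G n" by (rule window_in_arc_lists) fact
  ultimately show "u \<in> (\<Union>v\<in>{v \<in> arc_lists G n. cylinder G v \<subseteq> A}. cylinder G v)"
    by (intro UN_I[of "window u 0 n"]) (auto simp: cylinder_iff)
qed blast

text \<open>
  Determined sets are compact, so finitely many of their complements already cover the space.
\<close>

lemma decseq_determined_eventually_empty: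
  assumes det: "\<And>i. \<exists>n. determined n (A i)" and "decseq A" and "(\<Inter>i. A i) = {}"
  shows "\<exists>N. \<forall>i\<ge>N. A i = {}"
proof -
  let ?\<U> = "range (\<lambda>i. paths G - A i)"
  have "openin (path_topology G) (paths G - A i)" for i
    using det[of i] determined_paths determined_Diff openin_determined by meson
  then have "\<forall>U\<in>?\<U>. openin (path_topology G) U" by blast
  moreover have "paths G \<subseteq> \<Union>?\<U>" using assms(3) by auto
  ultimately have "\<exists>\<F>. finite \<F> \<and> \<F> \<subseteq> ?\<U> \<and> paths G \<subseteq> \<Union>\<F>"
    using compact_space_path_topology[unfolded compact_space_alt topspace_path_topology,
        rule_format, of ?\<U>] by auto
  then obtain \<F> where \<F>: "finite \<F>" "\<F> \<subseteq> ?\<U>" "paths G \<subseteq> \<Union>\<F>" by blast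
  obtain I where I: "finite I" "\<F> = (\<lambda>i. paths G - A i) ` I"
    using finite_subset_image[OF \<F>(1,2)] by auto
  define N where "N = Max (insert 0 I)"
  have sub: "A i \<subseteq> paths G" for i using det[of i] by (auto simp: determined_def)
  have "A i = {}" if "i \<ge> N" for i
  proof -
    have "u \<notin> A i" if "u \<in> paths G" for u
    proof -
      obtain j where j: "j \<in> I" "u \<notin> A j" using \<F>(3)[unfolded I(2)] \<open>u \<in> paths G\<close> by auto
      then have "j \<le> i" using \<open>i \<ge> N\<close> I(1) by (simp add: N_def)
      then show ?thesis using j(2) \<open>decseq A\<close> by (auto simp: decseq_def)
    qed
    then show ?thesis using sub[of i] by blast
  qed
  then show ?thesis by blast
qed

text \<open>
  A consistent family of cylinder masses is additive on the determined sets, and it is continuous at the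
  empty set by compactness; so the extension theorem of Caratheodory applies.
\<close>

lemma exists_path_measure:
  fixes q :: "'e list \<Rightarrow> real"
  assumes nonneg: "\<And>v. q v \<ge> 0" and Nil: "q [] = 1"
    and snoc: "\<And>v. q v = (\<Sum>e\<in>arcs G. q (v @ [e]))"
    and empty: "\<And>v. cylinder G v = {} \<Longrightarrow> q v = 0"
  shows "\<exists>\<mu>\<in>path_measures G. \<forall>v. mass \<mu> v = q v"
proof -
  define r where "r n A = (\<Sum>v\<in>arc_lists G n. if cylinder G v \<inter> A = {} then 0 else q v)" for n A
  have r_Suc: "r (Suc n) A = r n A" if A: "determined n A" for n A
  proof -
    have "(\<Sum>e\<in>arcs G. if cylinder G (v @ [e]) \<inter> A = {} then 0 else q (v @ [e]))
        = (if cylinder G v \<inter> A = {} then 0 else q v)" if v: "v \<in> arc_lists G n" for v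
    proof (cases "cylinder G v \<inter> A = {}")
      case True
      then have "cylinder G (v @ [e]) \<inter> A = {}" if "e \<in> arcs G" for e
        using cylinder_eq_UN_snoc[of G v] that by blast
      with True show ?thesis by simp
    next
      case False
      then have "cylinder G v \<subseteq> A" using determined_cylinder_cases[of v A] A v by auto
      then have "cylinder G (v @ [e]) \<inter> A = cylinder G (v @ [e])" if "e \<in> arcs G" for e
        using cylinder_eq_UN_snoc[of G v] that by blast
      then have "(\<Sum>e\<in>arcs G. if cylinder G (v @ [e]) \<inter> A = {} then 0 else q (v @ [e])) = (\<Sum>e\<in>arcs G. q (v @ [e]))"
        by (intro sum.cong) (auto simp: empty)
      with False show ?thesis by (simp add: snoc[symmetric])
    qed
    then show ?thesis unfolding r_def sum_arc_lists_Suc by (intro sum.cong) auto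
  qed
  (* The total weight of the cylinders of length n that meet A does not depend on n once A is
     determined by the first n arcs; take the least such n. *)
  define f where "f A = r (LEAST n. determined n A) A" for A
  have f_eq: "f A = r n A" if A: "determined n A" for n A
  proof -
    have L: "determined (LEAST n. determined n A) A" by (rule LeastI[of _ n]) (rule A)
    have "(LEAST n. determined n A) \<le> n" by (rule Least_le) (rule A)
    then have "r n A = r (LEAST n. determined n A) A"
    proof (induction n rule: dec_induct)
      case (step n)
      then show ?case using r_Suc[OF determined_mono[OF L]] by simp
    qed simp
    then show ?thesis by (simp add: f_def)
  qed
  define M where "M = {A. \<exists>n. determined n A}"
  have two: "\<exists>n. determined n A \<and> determined n B" if AB: "A \<in> M" "B \<in> M" for A B
  proof -
    obtain m n where "determined m A" "determined n B" using AB by (auto simp: M_def)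
    then show ?thesis
      by (intro exI[of _ "max m n"]) (auto intro: determined_mono)
  qed
  interpret ring_of_sets "paths G" M
  proof (rule ring_of_setsI)
    show "M \<subseteq> Pow (paths G)" by (auto simp: M_def determined_def)
    show "{} \<in> M" by (auto simp: M_def determined_empty)
    show "a \<union> b \<in> M" if "a \<in> M" "b \<in> M" for a b
      using two[OF that] determined_Un by (auto simp: M_def)
    show "a - b \<in> M" if "a \<in> M" "b \<in> M" for a b
      using two[OF that] determined_Diff by (auto simp: M_def)
  qed
  have f_nonneg: "f A \<ge> 0" for A unfolding f_def r_def by (intro sum_nonneg) (simp add: nonneg)
  have f_empty: "f {} = 0" using f_eq[OF determined_empty[of 0]] by (simp add: r_def)
  have "\<exists>\<mu>. (\<forall>A\<in>M. \<mu> A = ennreal (f A)) \<and> measure_space (paths G) (sigma_sets (paths G) M) \<mu>"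
  proof (rule caratheodory_empty_continuous)
    show "positive M (\<lambda>A. ennreal (f A))" by (simp add: positive_def f_empty)
    show "additive M (\<lambda>A. ennreal (f A))"
      unfolding additive_def
    proof (intro ballI impI)
      fix A B assume AB: "A \<in> M" "B \<in> M" "A \<inter> B = {}"
      obtain n where n: "determined n A" "determined n B" using two[OF AB(1,2)] by blast
      have "r n (A \<union> B) = r n A + r n B"
        unfolding r_def sum.distrib[symmetric]
      proof (intro sum.cong refl)
        fix v assume v: "v \<in> arc_lists G n"
        have "cylinder G v \<inter> A = {} \<or> cylinder G v \<inter> B = {}"
          using determined_cylinder_cases[of v A] n v AB(3) by blast
        then show "(if cylinder G v \<inter> (A \<union> B) = {} then 0 else q v)
          = (if cylinder G v \<inter> A = {} then 0 else q v) + (if cylinder G v \<inter> B = {} then 0 else q v)"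
          by (auto simp: Int_Un_distrib)
      qed
      then show "ennreal (f (A \<union> B)) = ennreal (f A) + ennreal (f B)"
        using f_eq[OF n(1)] f_eq[OF n(2)] f_eq[OF determined_Un[OF n]] ennreal_plus[OF f_nonneg f_nonneg, of A B]
        by simp
    qed
    fix A :: "nat \<Rightarrow> (nat \<Rightarrow> 'e) set"
    assume A: "range A \<subseteq> M" "decseq A" "(\<Inter>i. A i) = {}"
    have "\<exists>n. determined n (A i)" for i using A(1) by (auto simp: M_def)
    then obtain N where N: "\<forall>i\<ge>N. A i = {}"
      using decseq_determined_eventually_empty[of A] A(2,3) by blast
    then have "eventually (\<lambda>i. ennreal (f (A i)) = 0) sequentially"
      unfolding eventually_sequentially by (intro exI[of _ N]) (simp add: f_empty)
    then show "(\<lambda>i. ennreal (f (A i))) \<longlonglongrightarrow> 0" by (rule tendsto_eventually)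
  qed simp
  then obtain \<mu>' where \<mu>': "\<And>A. A \<in> M \<Longrightarrow> \<mu>' A = ennreal (f A)"
    and ms: "measure_space (paths G) (sigma_sets (paths G) M) \<mu>'" by blast
  define \<mu> where "\<mu> = measure_of (paths G) M \<mu>'"
  have M_Pow: "M \<subseteq> Pow (paths G)" by (auto simp: M_def determined_def)
  have em: "emeasure \<mu> A = ennreal (f A)" if "A \<in> M" for A
    using \<mu>'[OF that] emeasure_measure_of[OF \<mu>_def M_Pow, of A] ms that M_Pow
    by (simp add: measure_space_def \<mu>_def sigma_sets.Basic)
  have cyl_M: "cylinder G v \<in> M" for v using determined_cylinder by (auto simp: M_def)
  have f_cyl: "f (cylinder G v) = q v" for v
  proof (cases "cylinder G v = {}")
    case True
    then show ?thesis by (simp add: f_empty empty)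
  next
    case False
    then have v: "v \<in> arc_lists G (length v)" by (rule contrapos_np) (rule cylinder_empty_if)
    have "r (length v) (cylinder G v) = (\<Sum>w\<in>arc_lists G (length v). if w = v then q w else 0)"
      unfolding r_def using False cylinder_disjoint by (intro sum.cong) auto
    also have "\<dots> = q v" by (subst sum.delta[OF finite_arc_lists]) (use v in simp)
    finally show ?thesis by (simp add: f_eq[OF determined_cylinder])
  qed
  have "\<mu> \<in> path_measures G"
  proof (rule path_measureI)
    show sp: "space \<mu> = paths G" by (simp add: \<mu>_def space_measure_of_conv)
    have "A \<in> sigma_sets (paths G) (range (cylinder G))" if A: "A \<in> M" for A
    proof -
      obtain n where n: "determined n A" using A by (auto simp: M_def)
      have "A = (\<Union>v\<in>{v \<in> arc_lists G n. cylinder G v \<subseteq> A}. cylinder G v)"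
        by (rule determined_eq_UN[OF n])
      moreover have "(\<Union>v\<in>{v \<in> arc_lists G n. cylinder G v \<subseteq> A}. cylinder G v)
        \<in> sigma_sets (paths G) (range (cylinder G))"
        by (intro sigma_sets_UNION countable_finite finite_imageI finite_subset[OF _ finite_arc_lists[of n]])
          (auto intro: sigma_sets.Basic)
      ultimately show ?thesis by simp
    qed
    moreover have "cylinder G v \<in> sigma_sets (paths G) M" for v
      using cyl_M by (rule sigma_sets.Basic)
    ultimately have "sigma_sets (paths G) M = sigma_sets (paths G) (range (cylinder G))"
      by (intro sigma_sets_eqI) auto
    then show "sets \<mu> = sigma_sets (paths G) (range (cylinder G))"
      unfolding \<mu>_def using M_Pow by simp
    have "emeasure \<mu> (paths G) = 1"
      using em[OF cyl_M[of "[]"]] f_cyl[of "[]"] Nil by simp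
    then show "prob_space \<mu>" by (intro prob_spaceI) (simp add: sp)
  qed
  moreover have "mass \<mu> v = q v" for v
    using em[OF cyl_M[of v]] by (simp add: f_cyl measure_def nonneg)
  ultimately show ?thesis by blast
qed

text \<open>
  The masses of all cylinders form a point of a countable product of unit intervals. A limit of such
  points along a subsequence is again a consistent family.
\<close>

lemma path_measures_seq_compact:
  assumes X: "\<And>n. X n \<in> path_measures G"
  shows "\<exists>r. strict_mono (r :: nat \<Rightarrow> nat) \<and> (\<exists>\<mu>\<in>path_measures G. \<forall>v. (\<lambda>n. mass (X (r n)) v) \<longlonglongrightarrow> mass \<mu> v)"
proof -
  define L where "L = (\<Union>n. arc_lists G n)"
  have "countable L"
    unfolding L_def by (rule countable_UN[OF countableI_type countable_finite[OF finite_arc_lists]])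
  define Y where "Y n = (\<lambda>i. mass (X n) (from_nat_into L i))" for n
  have "compactin (product_topology (\<lambda>_::nat. euclideanreal) UNIV) (PiE UNIV (\<lambda>_. {0..1}))"
    unfolding compactin_PiE by simp
  then have "compact (PiE UNIV (\<lambda>_::nat. {0..1::real}))"
    by (simp add: euclidean_product_topology)
  then have "seq_compact (PiE UNIV (\<lambda>_::nat. {0..1::real}))"
    by (rule compact_imp_seq_compact)
  moreover have "\<forall>n. Y n \<in> PiE UNIV (\<lambda>_::nat. {0..1::real})"
    using mass_le_1[OF X] by (simp add: Y_def PiE_iff)
  ultimately obtain l r where r: "strict_mono (r :: nat \<Rightarrow> nat)" "(Y \<circ> r) \<longlonglongrightarrow> l"
    using seq_compactE by blast
  have "(\<lambda>n. (Y \<circ> r) n i) \<longlonglongrightarrow> l i" for i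
    using continuous_on_tendsto_compose[OF continuous_on_product_coordinates r(2)] by simp
  then have Y_lim: "(\<lambda>n. mass (X (r n)) (from_nat_into L i)) \<longlonglongrightarrow> l i" for i
    by (simp add: Y_def)
  define q where "q v = lim (\<lambda>n. mass (X (r n)) v)" for v
  have q: "(\<lambda>n. mass (X (r n)) v) \<longlonglongrightarrow> q v" for v
  proof -
    have "convergent (\<lambda>n. mass (X (r n)) v)"
    proof (cases "v \<in> L")
      case True
      then obtain i where "v = from_nat_into L i"
        using from_nat_into_surj[OF \<open>countable L\<close>] by metis
      then show ?thesis using Y_lim[of i] by (auto simp: convergent_def)
    next
      case False
      then have "cylinder G v = {}" using cylinder_empty_if[of v G] by (auto simp: L_def)
      then show ?thesis by (simp add: convergent_const)
    qed
    then show ?thesis by (simp add: q_def convergent_LIMSEQ_iff)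
  qed
  have "\<exists>\<mu>\<in>path_measures G. \<forall>v. mass \<mu> v = q v"
  proof (rule exists_path_measure)
    show "q v \<ge> 0" for v by (rule LIMSEQ_le_const[OF q]) simp
    show "q [] = 1"
      by (rule LIMSEQ_unique[OF q]) (use mass_Nil[OF X] in simp)
    show "q v = (\<Sum>e\<in>arcs G. q (v @ [e]))" for v
    proof (rule LIMSEQ_unique[OF q])
      have "(\<lambda>n. \<Sum>e\<in>arcs G. mass (X (r n)) (v @ [e])) \<longlonglongrightarrow> (\<Sum>e\<in>arcs G. q (v @ [e]))"
        by (intro tendsto_sum q)
      then show "(\<lambda>n. mass (X (r n)) v) \<longlonglongrightarrow> (\<Sum>e\<in>arcs G. q (v @ [e]))"
        by (simp only: mass_snoc[OF X, symmetric])
    qed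
    show "q v = 0" if "cylinder G v = {}" for v
      by (rule LIMSEQ_unique[OF q]) (simp add: that)
  qed
  then show ?thesis using r(1) q by metis
qed

end

section \<open>Entropy of finite-valued functions\<close>

text \<open>
  Fekete's lemma: the rate is the infimum of \<open>a n / n\<close>, because \<open>a (q m + r)\<close> is at most \<open>q (a m) + a r\<close>.
\<close>

lemma fekete:
  fixes a :: "nat \<Rightarrow> real"
  assumes sub: "\<And>m n. a (m + n) \<le> a m + a n" and nonneg: "\<And>n. a n \<ge> 0"
  shows "\<exists>L. (\<lambda>n. a n / n) \<longlonglongrightarrow> L \<and> (\<forall>n. n * L \<le> a n)"
proof -
  define S where "S = (\<lambda>n. a n / n) ` {1..}"
  have bdd: "bdd_below S" unfolding S_def by (rule bdd_belowI[of _ 0]) (auto simp: nonneg)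
  define L where "L = Inf S"
  have L_le: "L \<le> a n / n" if "n \<ge> 1" for n
    unfolding L_def by (rule cInf_lower[OF _ bdd]) (use that in \<open>auto simp: S_def\<close>)
  have mult: "a (q * m + r) \<le> q * a m + a r" for q m r
  proof (induction q)
    case (Suc q)
    have "a (Suc q * m + r) \<le> a m + a (q * m + r)" using sub[of m "q * m + r"] by (simp add: add.assoc)
    then show ?case using Suc by (simp add: algebra_simps)
  qed simp
  have "(\<lambda>n. a n / n) \<longlonglongrightarrow> L"
  proof (rule order_tendstoI)
    fix x assume "x < L"
    then have "x < a n / n" if "n \<ge> 1" for n using L_le[OF that] by linarith
    then show "eventually (\<lambda>n. x < a n / n) sequentially"
      unfolding eventually_sequentially by blast
  next
    fix x assume "L < x"
    moreover have "S \<noteq> {}" by (auto simp: S_def)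
    ultimately obtain m where m: "m \<ge> 1" "a m / m < x"
      using cInf_lessD[of S x] by (auto simp: L_def S_def)
    define K where "K = (\<Sum>r<m. a r)"
    have bound: "a n / n \<le> a m / m + K / n" if n: "n \<ge> 1" for n
    proof -
      have "a n \<le> (n div m) * a m + a (n mod m)" using mult[of "n div m" m "n mod m"] by simp
      also have "a (n mod m) \<le> K"
        unfolding K_def using m(1) nonneg by (intro member_le_sum) auto
      also have "(n div m) * a m = (n div m * m) * (a m / m)" using m(1) by simp
      also have "\<dots> \<le> n * (a m / m)"
        using nonneg[of m] div_times_less_eq_dividend[of n m] by (intro mult_right_mono) (auto simp del: of_nat_mult)
      finally show ?thesis using n by (simp add: field_simps)
    qed
    have "(\<lambda>n. a m / m + K / real n) \<longlonglongrightarrow> a m / m + 0"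
      by (intro tendsto_intros lim_const_over_n)
    then have "eventually (\<lambda>n. a m / m + K / real n < x) sequentially"
      using m(2) by (intro order_tendstoD) auto
    then show "eventually (\<lambda>n. a n / n < x) sequentially"
      using eventually_ge_at_top[of 1]
      by eventually_elim (use bound in fastforce)
  qed
  moreover have "n * L \<le> a n" for n
    using L_le[of n] nonneg[of n] by (cases "n = 0") (auto simp: field_simps)
  ultimately show ?thesis by blast
qed

text \<open>
  The tangent to the logarithm at \<open>1\<close>, in the homogeneous form in which it bounds relative entropies.
\<close>

lemma mult_ln_le:
  fixes p q :: real
  assumes "q \<ge> 0" "p > 0 \<or> q = 0" "p \<ge> 0"
  shows "q * (ln p - ln q) \<le> p - q"
proof (cases "q = 0")
  case False
  with assms have "p > 0" "q > 0" by auto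
  then have "ln p - ln q \<le> p / q - 1" using ln_le_minus_one[of "p / q"] by (simp add: ln_div)
  then have "q * (ln p - ln q) \<le> q * (p / q - 1)" using \<open>q > 0\<close> by (intro mult_left_mono) auto
  then show ?thesis using \<open>q > 0\<close> by (simp add: algebra_simps)
qed (use assms in simp)

context prob_space
begin

definition fibre_prob :: "('a \<Rightarrow> 'b) \<Rightarrow> 'b \<Rightarrow> real" where
  "fibre_prob X c = prob (X -` {c} \<inter> space M)"

text \<open>
  The entropy of the partition into the fibres of \<open>X\<close>. For functions, refinement is the formation of
  pairs, which is more convenient than the common refinement of sets of sets.
\<close>

definition fun_entropy :: "('a \<Rightarrow> 'b) \<Rightarrow> real" where
  "fun_entropy X = - (\<Sum>c\<in>X ` space M. fibre_prob X c * ln (fibre_prob X c))"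

lemma fibre_prob_nonneg: "fibre_prob X c \<ge> 0"
  by (simp add: fibre_prob_def)

lemma fibre_prob_le_1: "fibre_prob X c \<le> 1"
  by (simp add: fibre_prob_def)

lemma fibre_prob_outside: "c \<notin> X ` space M \<Longrightarrow> fibre_prob X c = 0"
proof -
  assume "c \<notin> X ` space M"
  then have "X -` {c} \<inter> space M = {}" by blast
  then show ?thesis by (simp add: fibre_prob_def)
qed

lemma fun_entropy_superset:
  assumes "finite A" "X ` space M \<subseteq> A"
  shows "fun_entropy X = - (\<Sum>c\<in>A. fibre_prob X c * ln (fibre_prob X c))"
  unfolding fun_entropy_def using assms fibre_prob_outside[of _ X]
  by (auto intro!: sum.mono_neutral_left)

lemma fun_entropy_nonneg: "fun_entropy X \<ge> 0"
proof -
  have "fibre_prob X c * ln (fibre_prob X c) \<le> 0" for c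
    using fibre_prob_nonneg[of X c] fibre_prob_le_1[of X c]
    by (cases "fibre_prob X c = 0") (auto intro!: mult_nonneg_nonpos)
  then show ?thesis unfolding fun_entropy_def by (simp add: sum_nonpos)
qed

lemma fibre_prob_comp:
  assumes X: "simple_function M X"
  shows "fibre_prob (\<lambda>\<omega>. g (X \<omega>)) c = (\<Sum>x\<in>{x \<in> X ` space M. g x = c}. fibre_prob X x)"
proof -
  have fin: "finite (X ` space M)" using X by (simp add: simple_function_def)
  have "(\<lambda>\<omega>. g (X \<omega>)) -` {c} \<inter> space M = (\<Union>x\<in>{x \<in> X ` space M. g x = c}. X -` {x} \<inter> space M)"
    by auto
  moreover have "prob (\<Union>x\<in>{x \<in> X ` space M. g x = c}. X -` {x} \<inter> space M)
    = (\<Sum>x\<in>{x \<in> X ` space M. g x = c}. prob (X -` {x} \<inter> space M))"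
  proof (rule finite_measure_finite_Union)
    show "(\<lambda>x. X -` {x} \<inter> space M) ` {x \<in> X ` space M. g x = c} \<subseteq> sets M"
      using X by (auto simp: simple_function_def)
  qed (use fin in \<open>auto simp: disjoint_family_on_def\<close>)
  ultimately show ?thesis
    unfolding fibre_prob_def by simp
qed

lemma fibre_prob_comp_ge:
  assumes X: "simple_function M X" and x: "x \<in> X ` space M"
  shows "fibre_prob (\<lambda>\<omega>. g (X \<omega>)) (g x) \<ge> fibre_prob X x"
  unfolding fibre_prob_comp[OF X]
  by (rule member_le_sum) (use x X fibre_prob_nonneg in \<open>auto simp: simple_function_def\<close>)

lemma sum_fibre_prob_comp:
  assumes X: "simple_function M X"
  shows "(\<Sum>c\<in>(\<lambda>\<omega>. g (X \<omega>)) ` space M. fibre_prob (\<lambda>\<omega>. g (X \<omega>)) c * F c)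
    = (\<Sum>x\<in>X ` space M. fibre_prob X x * F (g x))"
proof -
  have fin: "finite (X ` space M)" using X by (simp add: simple_function_def)
  have "(\<lambda>\<omega>. g (X \<omega>)) ` space M = g ` X ` space M" by auto
  then have "(\<Sum>x\<in>X ` space M. fibre_prob X x * F (g x))
    = (\<Sum>c\<in>(\<lambda>\<omega>. g (X \<omega>)) ` space M. \<Sum>x\<in>{x \<in> X ` space M. g x = c}. fibre_prob X x * F (g x))"
    using sum.image_gen[OF fin, of "\<lambda>x. fibre_prob X x * F (g x)" g] by simp
  also have "\<dots> = (\<Sum>c\<in>(\<lambda>\<omega>. g (X \<omega>)) ` space M. fibre_prob (\<lambda>\<omega>. g (X \<omega>)) c * F c)"
    unfolding fibre_prob_comp[OF X] sum_distrib_right by (intro sum.cong) auto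
  finally show ?thesis by simp
qed

lemma sum_fibre_prob:
  assumes X: "simple_function M X"
  shows "(\<Sum>x\<in>X ` space M. fibre_prob X x) = 1"
proof -
  have "fibre_prob (\<lambda>\<omega>. (\<lambda>_. ()) (X \<omega>)) () = (\<Sum>x\<in>{x \<in> X ` space M. () = ()}. fibre_prob X x)"
    by (rule fibre_prob_comp[OF X])
  moreover have "fibre_prob (\<lambda>\<omega>. (\<lambda>_. ()) (X \<omega>)) () = 1"
    by (simp add: fibre_prob_def prob_space)
  ultimately show ?thesis by simp
qed

lemma fun_entropy_comp:
  assumes X: "simple_function M X"
  shows "fun_entropy (\<lambda>\<omega>. g (X \<omega>))
    = - (\<Sum>x\<in>X ` space M. fibre_prob X x * ln (fibre_prob (\<lambda>\<omega>. g (X \<omega>)) (g x)))"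
  using sum_fibre_prob_comp[OF X, of g "\<lambda>c. ln (fibre_prob (\<lambda>\<omega>. g (X \<omega>)) c)"]
  by (simp add: fun_entropy_def)

lemma fun_entropy_cong:
  assumes "\<And>\<omega>. \<omega> \<in> space M \<Longrightarrow> X \<omega> = Y \<omega>" shows "fun_entropy X = fun_entropy Y"
proof -
  have "X ` space M = Y ` space M" using assms by (intro image_cong refl)
  moreover have "X -` {c} \<inter> space M = Y -` {c} \<inter> space M" for c
  proof (rule set_eqI)
    fix \<omega> show "\<omega> \<in> X -` {c} \<inter> space M \<longleftrightarrow> \<omega> \<in> Y -` {c} \<inter> space M"
      using assms[of \<omega>] by (cases "\<omega> \<in> space M") simp_all
  qed
  ultimately show ?thesis by (simp add: fun_entropy_def fibre_prob_def)
qed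

text \<open>
  On its range \<open>Y\<close> is a function of \<open>X\<close>, so its fibres are unions of fibres of \<open>X\<close>, and the logarithm
  is monotone.
\<close>

lemma fun_entropy_mono:
  assumes X: "simple_function M X"
    and det: "\<And>\<omega> \<omega>'. \<omega> \<in> space M \<Longrightarrow> \<omega>' \<in> space M \<Longrightarrow> X \<omega> = X \<omega>' \<Longrightarrow> Y \<omega> = Y \<omega>'"
  shows "fun_entropy Y \<le> fun_entropy X"
proof -
  define g where "g c = Y (SOME \<omega>. \<omega> \<in> space M \<and> X \<omega> = c)" for c
  have "Y \<omega> = g (X \<omega>)" if "\<omega> \<in> space M" for \<omega>
  proof -
    have "(SOME \<omega>'. \<omega>' \<in> space M \<and> X \<omega>' = X \<omega>) \<in> space M \<and> X (SOME \<omega>'. \<omega>' \<in> space M \<and> X \<omega>' = X \<omega>) = X \<omega>"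
      by (rule someI[of "\<lambda>\<omega>'. \<omega>' \<in> space M \<and> X \<omega>' = X \<omega>" \<omega>]) (simp add: that)
    then show ?thesis unfolding g_def by (intro det[OF that]) simp_all
  qed
  then have "fun_entropy Y = fun_entropy (\<lambda>\<omega>. g (X \<omega>))" by (rule fun_entropy_cong)
  also have "\<dots> \<le> fun_entropy X"
    unfolding fun_entropy_comp[OF X] fun_entropy_def neg_le_iff_le
  proof (rule sum_mono)
    fix x assume x: "x \<in> X ` space M"
    show "fibre_prob X x * ln (fibre_prob X x) \<le> fibre_prob X x * ln (fibre_prob (\<lambda>\<omega>. g (X \<omega>)) (g x))"
      using fibre_prob_comp_ge[OF X x, of g] fibre_prob_nonneg[of X x]
      by (cases "fibre_prob X x = 0") (auto intro!: mult_left_mono)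
  qed
  finally show ?thesis .
qed

text \<open>
  Strong subadditivity. The difference of the two sides is an expectation of logarithms, and
  the tangent to the logarithm at \<open>1\<close> turns it into a sum of products of conditional
  probabilities minus \<open>1\<close>.
\<close>

lemma fun_entropy_strong_subadditive:
  assumes X: "simple_function M X" and Y: "simple_function M Y" and Z: "simple_function M Z"
  shows "fun_entropy (\<lambda>\<omega>. (X \<omega>, Y \<omega>, Z \<omega>)) + fun_entropy Z
    \<le> fun_entropy (\<lambda>\<omega>. (X \<omega>, Z \<omega>)) + fun_entropy (\<lambda>\<omega>. (Y \<omega>, Z \<omega>))"
proof -
  let ?T = "\<lambda>\<omega>. (X \<omega>, Y \<omega>, Z \<omega>)" and ?XZ = "\<lambda>\<omega>. (X \<omega>, Z \<omega>)" and ?YZ = "\<lambda>\<omega>. (Y \<omega>, Z \<omega>)"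
  have T: "simple_function M ?T" using X Y Z by (intro simple_function_Pair)
  have XZ: "simple_function M ?XZ" and YZ: "simple_function M ?YZ" using X Y Z by (auto intro: simple_function_Pair)
  have fin: "finite (X ` space M)" "finite (Y ` space M)" "finite (Z ` space M)" "finite (?T ` space M)"
    using X Y Z T by (simp_all add: simple_function_def)
  define S where "S = {t \<in> ?T ` space M. fibre_prob ?T t > 0}"
  have S: "finite S" "S \<subseteq> ?T ` space M" using fin by (auto simp: S_def)
  define R where "R = (\<lambda>(x, y, z). fibre_prob ?XZ (x, z) * fibre_prob ?YZ (y, z) / fibre_prob Z z)"
  have le1: "(\<Sum>t\<in>S. R t) \<le> 1"
  proof -
    have nn: "R t \<ge> 0" for t by (cases t) (simp add: R_def fibre_prob_nonneg)
    have "(\<Sum>t\<in>S. R t) \<le> (\<Sum>t\<in>X ` space M \<times> Y ` space M \<times> Z ` space M. R t)"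
      using S fin nn by (intro sum_mono2) auto
    also have "\<dots> = (\<Sum>z\<in>Z ` space M. \<Sum>x\<in>X ` space M. \<Sum>y\<in>Y ` space M. R (x, y, z))"
    proof -
      have "sum R (X ` space M \<times> Y ` space M \<times> Z ` space M)
        = (\<Sum>x\<in>X ` space M. \<Sum>y\<in>Y ` space M. \<Sum>z\<in>Z ` space M. R (x, y, z))"
        by (simp add: sum.cartesian_product case_prod_beta)
      also have "\<dots> = (\<Sum>x\<in>X ` space M. \<Sum>z\<in>Z ` space M. \<Sum>y\<in>Y ` space M. R (x, y, z))"
        by (rule sum.cong[OF refl], rule sum.swap)
      also have "\<dots> = (\<Sum>z\<in>Z ` space M. \<Sum>x\<in>X ` space M. \<Sum>y\<in>Y ` space M. R (x, y, z))"
        by (rule sum.swap)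
      finally show ?thesis .
    qed
    also have "\<dots> = (\<Sum>z\<in>Z ` space M. fibre_prob Z z)"
    proof (intro sum.cong refl)
      fix z
      have x: "(\<Sum>x\<in>X ` space M. fibre_prob ?XZ (x, z)) = fibre_prob Z z"
      proof -
        have "fibre_prob Z z = (\<Sum>t\<in>{t \<in> ?XZ ` space M. snd t = z}. fibre_prob ?XZ t)"
          using fibre_prob_comp[OF XZ, of snd z] by simp
        also have "\<dots> = (\<Sum>t\<in>(\<lambda>x. (x, z)) ` X ` space M. fibre_prob ?XZ t)"
          using fin by (intro sum.mono_neutral_left) (auto intro: fibre_prob_outside)
        finally show ?thesis by (simp add: sum.reindex inj_on_def)
      qed
      have y: "(\<Sum>y\<in>Y ` space M. fibre_prob ?YZ (y, z)) = fibre_prob Z z"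
      proof -
        have "fibre_prob Z z = (\<Sum>t\<in>{t \<in> ?YZ ` space M. snd t = z}. fibre_prob ?YZ t)"
          using fibre_prob_comp[OF YZ, of snd z] by simp
        also have "\<dots> = (\<Sum>t\<in>(\<lambda>x. (x, z)) ` Y ` space M. fibre_prob ?YZ t)"
          using fin by (intro sum.mono_neutral_left) (auto intro: fibre_prob_outside)
        finally show ?thesis by (simp add: sum.reindex inj_on_def)
      qed
      have "(\<Sum>x\<in>X ` space M. \<Sum>y\<in>Y ` space M. R (x, y, z))
        = (\<Sum>x\<in>X ` space M. fibre_prob ?XZ (x, z)) * (\<Sum>y\<in>Y ` space M. fibre_prob ?YZ (y, z)) / fibre_prob Z z"
        unfolding R_def sum_product sum_divide_distrib by simp
      then show "(\<Sum>x\<in>X ` space M. \<Sum>y\<in>Y ` space M. R (x, y, z)) = fibre_prob Z z"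
        by (simp add: x y)
    qed
    also have "\<dots> = 1" by (rule sum_fibre_prob[OF Z])
    finally show ?thesis .
  qed
  let ?D = "\<lambda>t. fibre_prob ?T t * (ln (fibre_prob ?XZ (fst t, snd (snd t))) + ln (fibre_prob ?YZ (snd t))
       - ln (fibre_prob Z (snd (snd t))) - ln (fibre_prob ?T t))"
  have "fun_entropy ?T + fun_entropy Z - fun_entropy ?XZ - fun_entropy ?YZ = (\<Sum>t\<in>?T ` space M. ?D t)"
    using fun_entropy_comp[OF T, of "\<lambda>t. snd (snd t)"] fun_entropy_comp[OF T, of "\<lambda>t. (fst t, snd (snd t))"]
      fun_entropy_comp[OF T, of snd]
    by (simp add: fun_entropy_def[of ?T] sum.distrib sum_subtractf algebra_simps)
  also have "\<dots> = (\<Sum>t\<in>S. ?D t)"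
    using fin(4) fibre_prob_nonneg[of ?T]
    by (intro sum.mono_neutral_right) (auto simp: S_def less_le)
  also have "\<dots> \<le> (\<Sum>t\<in>S. R t - fibre_prob ?T t)"
  proof (rule sum_mono)
    fix t assume t: "t \<in> S"
    obtain x y z where xyz: "t = (x, y, z)" by (cases t)
    have pos: "fibre_prob ?T t > 0" and tT: "t \<in> ?T ` space M" using t by (auto simp: S_def)
    have "fibre_prob ?XZ (x, z) > 0" "fibre_prob ?YZ (y, z) > 0" "fibre_prob Z z > 0"
      using pos fibre_prob_comp_ge[OF T tT, of "\<lambda>t. (fst t, snd (snd t))"]
        fibre_prob_comp_ge[OF T tT, of snd] fibre_prob_comp_ge[OF T tT, of "\<lambda>t. snd (snd t)"]
      by (auto simp: xyz)
    then have "R t > 0" and "ln (R t) = ln (fibre_prob ?XZ (x, z)) + ln (fibre_prob ?YZ (y, z)) - ln (fibre_prob Z z)"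
      by (simp_all add: R_def xyz ln_mult ln_div)
    then show "?D t \<le> R t - fibre_prob ?T t"
      using mult_ln_le[of "fibre_prob ?T t" "R t"] pos by (simp add: xyz)
  qed
  also have "\<dots> \<le> 1 - (\<Sum>t\<in>S. fibre_prob ?T t)" using le1 by (simp add: sum_subtractf)
  also have "(\<Sum>t\<in>S. fibre_prob ?T t) = (\<Sum>t\<in>?T ` space M. fibre_prob ?T t)"
    using fin(4) fibre_prob_nonneg[of ?T]
    by (intro sum.mono_neutral_left) (auto simp: S_def less_le)
  finally show ?thesis using sum_fibre_prob[OF T] by simp
qed

lemma fun_entropy_const: "fun_entropy (\<lambda>_. c) = 0"
proof -
  have "fibre_prob (\<lambda>_. c) c = 1" by (simp add: fibre_prob_def prob_space)
  then show ?thesis using fun_entropy_superset[of "{c}" "\<lambda>_. c"] by auto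
qed

lemma fun_entropy_Pair_le:
  assumes X: "simple_function M X" and Y: "simple_function M Y"
  shows "fun_entropy (\<lambda>\<omega>. (X \<omega>, Y \<omega>)) \<le> fun_entropy X + fun_entropy Y"
proof -
  have c: "simple_function M (\<lambda>_. ())" by simp
  have "fun_entropy (\<lambda>\<omega>. (X \<omega>, Y \<omega>)) \<le> fun_entropy (\<lambda>\<omega>. (X \<omega>, Y \<omega>, ()))"
    by (rule fun_entropy_mono) (use X Y in \<open>auto intro!: simple_function_Pair\<close>)
  also have "\<dots> \<le> fun_entropy (\<lambda>\<omega>. (X \<omega>, ())) + fun_entropy (\<lambda>\<omega>. (Y \<omega>, ()))"
    using fun_entropy_strong_subadditive[OF X Y c] fun_entropy_const[of "()"] by simp
  also have "\<dots> \<le> fun_entropy X + fun_entropy Y"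
    by (intro add_mono fun_entropy_mono X Y) auto
  finally show ?thesis .
qed

end

section \<open>Entropy of a partition under a measure-preserving map\<close>

locale measure_preserving = prob_space M for M :: "'a measure" +
  fixes f :: "'a \<Rightarrow> 'a"
  assumes measurable_map: "f \<in> measurable M M" and invariant: "distr M M f = M"
begin

lemma measurable_pow: "(f ^^ k) \<in> measurable M M"
  by (induction k) (use measurable_map measurable_comp in \<open>auto simp: comp_def\<close>)

lemma distr_pow: "distr M M (f ^^ k) = M"
proof (induction k)
  case (Suc k)
  have "distr M M (f ^^ Suc k) = distr (distr M M (f ^^ k)) M f"
    by (simp add: distr_distr[OF measurable_map measurable_pow])
  then show ?case unfolding Suc.IH invariant .
qed (simp add: id_def distr_id)

lemma pow_in_space: "\<omega> \<in> space M \<Longrightarrow> (f ^^ k) \<omega> \<in> space M"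
  using measurable_space[OF measurable_pow] .

lemma prob_pow_vimage: "A \<in> sets M \<Longrightarrow> prob ((f ^^ k) -` A \<inter> space M) = prob A"
  using measure_distr[OF measurable_pow, of A k] by (simp add: distr_pow)

lemma simple_function_pow:
  assumes X: "simple_function M X" shows "simple_function M (\<lambda>\<omega>. X ((f ^^ k) \<omega>))"
  unfolding simple_function_def
proof
  have sub: "(\<lambda>\<omega>. X ((f ^^ k) \<omega>)) ` space M \<subseteq> X ` space M" using pow_in_space by auto
  then show "finite ((\<lambda>\<omega>. X ((f ^^ k) \<omega>)) ` space M)"
    by (rule finite_subset) (use X in \<open>simp add: simple_function_def\<close>)
  show "\<forall>x\<in>(\<lambda>\<omega>. X ((f ^^ k) \<omega>)) ` space M. (\<lambda>\<omega>. X ((f ^^ k) \<omega>)) -` {x} \<inter> space M \<in> sets M"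
  proof
    fix x assume "x \<in> (\<lambda>\<omega>. X ((f ^^ k) \<omega>)) ` space M"
    then have "X -` {x} \<inter> space M \<in> sets M" using sub X by (auto simp: simple_function_def)
    then have "(f ^^ k) -` (X -` {x} \<inter> space M) \<inter> space M \<in> sets M"
      by (rule measurable_sets[OF measurable_pow])
    moreover have "(f ^^ k) -` (X -` {x} \<inter> space M) \<inter> space M = (\<lambda>\<omega>. X ((f ^^ k) \<omega>)) -` {x} \<inter> space M"
      using pow_in_space by auto
    ultimately show "(\<lambda>\<omega>. X ((f ^^ k) \<omega>)) -` {x} \<inter> space M \<in> sets M" by simp
  qed
qed

lemma fun_entropy_pow:
  assumes X: "simple_function M X" shows "fun_entropy (\<lambda>\<omega>. X ((f ^^ k) \<omega>)) = fun_entropy X"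
proof -
  have sub: "(\<lambda>\<omega>. X ((f ^^ k) \<omega>)) ` space M \<subseteq> X ` space M" using pow_in_space by auto
  have fin: "finite (X ` space M)" using X by (simp add: simple_function_def)
  have "fibre_prob (\<lambda>\<omega>. X ((f ^^ k) \<omega>)) x = fibre_prob X x" if x: "x \<in> X ` space M" for x
  proof -
    have "X -` {x} \<inter> space M \<in> sets M" using x X by (auto simp: simple_function_def)
    moreover have "(f ^^ k) -` (X -` {x} \<inter> space M) \<inter> space M = (\<lambda>\<omega>. X ((f ^^ k) \<omega>)) -` {x} \<inter> space M"
      using pow_in_space by auto
    ultimately show ?thesis using prob_pow_vimage[of "X -` {x} \<inter> space M" k] by (simp add: fibre_prob_def)
  qed
  then show ?thesis
    unfolding fun_entropy_superset[OF fin sub] fun_entropy_superset[OF fin subset_refl] by simp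
qed

definition itinerary :: "('a \<Rightarrow> 'b) \<Rightarrow> nat \<Rightarrow> 'a \<Rightarrow> 'b list" where
  "itinerary X n \<omega> = map (\<lambda>k. X ((f ^^ k) \<omega>)) [0..<n]"

lemma itinerary_Suc: "itinerary X (Suc n) \<omega> = itinerary X n \<omega> @ [X ((f ^^ n) \<omega>)]"
  by (simp add: itinerary_def)

lemma itinerary_eq_iff: "itinerary X n \<omega> = itinerary X n \<omega>' \<longleftrightarrow> (\<forall>k<n. X ((f ^^ k) \<omega>) = X ((f ^^ k) \<omega>'))"
  by (auto simp: itinerary_def)

lemma simple_function_itinerary: "simple_function M X \<Longrightarrow> simple_function M (itinerary X n)"
proof (induction n)
  case 0
  have "itinerary X 0 = (\<lambda>_. [])" by (rule ext) (simp add: itinerary_def)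
  then show ?case by simp
next
  case (Suc n)
  have "simple_function M (\<lambda>\<omega>. (itinerary X n \<omega>, X ((f ^^ n) \<omega>)))"
    using Suc simple_function_pow by (intro simple_function_Pair) auto
  from simple_function_compose[OF this, of "\<lambda>(l, x). l @ [x]"] show ?case
    by (simp add: comp_def itinerary_Suc fun_eq_iff[symmetric] cong: simple_function_cong)
qed

lemma itinerary_entropy_subadditive:
  assumes X: "simple_function M X"
  shows "fun_entropy (itinerary X (m + n)) \<le> fun_entropy (itinerary X m) + fun_entropy (itinerary X n)"
proof -
  have s: "simple_function M (itinerary X m)" "simple_function M (itinerary X n)"
    using X by (auto intro: simple_function_itinerary)
  have "fun_entropy (itinerary X (m + n)) \<le> fun_entropy (\<lambda>\<omega>. (itinerary X m \<omega>, itinerary X n ((f ^^ m) \<omega>)))"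
  proof (rule fun_entropy_mono)
    show "simple_function M (\<lambda>\<omega>. (itinerary X m \<omega>, itinerary X n ((f ^^ m) \<omega>)))"
      using s simple_function_pow by (intro simple_function_Pair) auto
    fix \<omega> \<omega>' assume "(itinerary X m \<omega>, itinerary X n ((f ^^ m) \<omega>)) = (itinerary X m \<omega>', itinerary X n ((f ^^ m) \<omega>'))"
    then have *: "\<forall>k<m. X ((f ^^ k) \<omega>) = X ((f ^^ k) \<omega>')" "\<forall>k<n. X ((f ^^ (k + m)) \<omega>) = X ((f ^^ (k + m)) \<omega>')"
      by (auto simp: itinerary_eq_iff funpow_add)
    have "X ((f ^^ k) \<omega>) = X ((f ^^ k) \<omega>')" if "k < m + n" for k
      using * that by (cases "k < m") (auto dest: spec[of _ "k - m"])
    then show "itinerary X (m + n) \<omega> = itinerary X (m + n) \<omega>'" by (simp add: itinerary_eq_iff)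
  qed
  also have "\<dots> \<le> fun_entropy (itinerary X m) + fun_entropy (\<lambda>\<omega>. itinerary X n ((f ^^ m) \<omega>))"
    using s simple_function_pow by (intro fun_entropy_Pair_le) auto
  finally show ?thesis using fun_entropy_pow[OF s(2)] by simp
qed

lemma itinerary_entropy_limit:
  assumes X: "simple_function M X"
  shows "\<exists>L. (\<lambda>n. fun_entropy (itinerary X n) / n) \<longlonglongrightarrow> L \<and> (\<forall>n. n * L \<le> fun_entropy (itinerary X n))"
  by (rule fekete) (use itinerary_entropy_subadditive[OF X] fun_entropy_nonneg in auto)

text \<open>
  Adjoin the symbols of \<open>X\<close> one at a time to the itinerary of \<open>Y\<close>. By strong subadditivity and invariance,
  each costs at most the conditional entropy of \<open>X\<close> given the stretch of length \<open>m\<close> of the itinerary of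
  \<open>Y\<close> that starts at the same time.
\<close>

lemma itinerary_entropy_le:
  assumes X: "simple_function M X" and Y: "simple_function M Y"
  shows "fun_entropy (itinerary X n) \<le> fun_entropy (itinerary Y (n + m))
    + n * (fun_entropy (\<lambda>\<omega>. (X \<omega>, itinerary Y m \<omega>)) - fun_entropy (itinerary Y m))"
proof -
  define W where "W = itinerary Y (n + m)"
  define c where "c = fun_entropy (\<lambda>\<omega>. (X \<omega>, itinerary Y m \<omega>)) - fun_entropy (itinerary Y m)"
  have W: "simple_function M W" and Ym: "simple_function M (itinerary Y m)"
    using Y by (auto simp: W_def intro: simple_function_itinerary)
  (* W is m symbols longer than the itinerary of X, so it contains the stretch that starts at any i < n. *)
  have "fun_entropy (\<lambda>\<omega>. (itinerary X i \<omega>, W \<omega>)) \<le> fun_entropy W + i * c" if "i \<le> n" for i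
    using that
  proof (induction i)
    case 0
    have "fun_entropy (\<lambda>\<omega>. (itinerary X 0 \<omega>, W \<omega>)) \<le> fun_entropy W"
      by (rule fun_entropy_mono[OF W]) (simp add: itinerary_def)
    then show ?case by simp
  next
    case (Suc i)
    let ?X = "\<lambda>\<omega>. X ((f ^^ i) \<omega>)" and ?A = "\<lambda>\<omega>. (itinerary X i \<omega>, W \<omega>)" and ?Z = "\<lambda>\<omega>. itinerary Y m ((f ^^ i) \<omega>)"
    have A: "simple_function M ?A" using simple_function_itinerary[OF X] W by (intro simple_function_Pair) auto
    have Xi: "simple_function M ?X" and Z: "simple_function M ?Z"
      using simple_function_pow[OF X] simple_function_pow[OF Ym] by auto
    have "fun_entropy (\<lambda>\<omega>. (itinerary X (Suc i) \<omega>, W \<omega>)) \<le> fun_entropy (\<lambda>\<omega>. (?X \<omega>, ?A \<omega>, ?Z \<omega>))"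
      by (rule fun_entropy_mono) (use Xi A Z in \<open>auto simp: itinerary_Suc intro!: simple_function_Pair\<close>)
    also have "\<dots> \<le> fun_entropy (\<lambda>\<omega>. (?X \<omega>, ?Z \<omega>)) + fun_entropy (\<lambda>\<omega>. (?A \<omega>, ?Z \<omega>)) - fun_entropy ?Z"
      using fun_entropy_strong_subadditive[OF Xi A Z] by simp
    also have "fun_entropy (\<lambda>\<omega>. (?A \<omega>, ?Z \<omega>)) \<le> fun_entropy ?A"
    proof (rule fun_entropy_mono[OF A])
      fix \<omega> \<omega>' assume eq: "?A \<omega> = ?A \<omega>'"
      then have *: "\<forall>k<n + m. Y ((f ^^ k) \<omega>) = Y ((f ^^ k) \<omega>')" by (auto simp: W_def itinerary_eq_iff)
      have "Y ((f ^^ (k + i)) \<omega>) = Y ((f ^^ (k + i)) \<omega>')" if "k < m" for k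
        using * that Suc.prems by auto
      then have "?Z \<omega> = ?Z \<omega>'" by (simp add: itinerary_eq_iff funpow_add)
      with eq show "(?A \<omega>, ?Z \<omega>) = (?A \<omega>', ?Z \<omega>')" by blast
    qed
    also have "fun_entropy (\<lambda>\<omega>. (?X \<omega>, ?Z \<omega>)) = fun_entropy (\<lambda>\<omega>. (X \<omega>, itinerary Y m \<omega>))"
      using fun_entropy_pow[OF simple_function_Pair[OF X Ym], of i] by simp
    also have "fun_entropy ?Z = fun_entropy (itinerary Y m)" by (rule fun_entropy_pow[OF Ym])
    finally show ?case using Suc.IH Suc.prems by (simp add: c_def algebra_simps)
  qed
  from this[of n] have "fun_entropy (\<lambda>\<omega>. (itinerary X n \<omega>, W \<omega>)) \<le> fun_entropy W + n * c" by simp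
  moreover have "fun_entropy (itinerary X n) \<le> fun_entropy (\<lambda>\<omega>. (itinerary X n \<omega>, W \<omega>))"
    by (rule fun_entropy_mono) (use simple_function_itinerary[OF X] W in \<open>auto intro!: simple_function_Pair\<close>)
  ultimately show ?thesis by (simp add: c_def W_def)
qed

subsection \<open>Partitions as functions\<close>

definition atom_of :: "'a set set \<Rightarrow> 'a \<Rightarrow> 'a set" where
  "atom_of \<xi> \<omega> = (THE A. A \<in> \<xi> \<and> \<omega> \<in> A)"

lemma atom_of_eq_iff:
  assumes "partition_on (space M) \<xi>" "\<omega> \<in> space M" "A \<in> \<xi>"
  shows "atom_of \<xi> \<omega> = A \<longleftrightarrow> \<omega> \<in> A"
proof -
  have uniq: "B = B'" if "B \<in> \<xi>" "\<omega> \<in> B" "B' \<in> \<xi>" "\<omega> \<in> B'" for B B'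
    using disjointD[OF partition_onD2[OF assms(1)] that(1,3)] that(2,4) by blast
  obtain B where B: "B \<in> \<xi>" "\<omega> \<in> B" using partition_onD1[OF assms(1)] assms(2) by blast
  have "atom_of \<xi> \<omega> = B"
    unfolding atom_of_def by (rule the_equality) (use B uniq in auto)
  then show ?thesis using uniq[OF B assms(3)] B(2) by auto
qed

lemma atom_of_in:
  assumes "partition_on (space M) \<xi>" "\<omega> \<in> space M"
  shows "atom_of \<xi> \<omega> \<in> \<xi>" "\<omega> \<in> atom_of \<xi> \<omega>"
proof -
  obtain A where "A \<in> \<xi>" "\<omega> \<in> A" using assms by (auto simp: partition_on_def)
  then show "atom_of \<xi> \<omega> \<in> \<xi>" "\<omega> \<in> atom_of \<xi> \<omega>" using atom_of_eq_iff[OF assms] by auto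
qed

lemma vimage_atom_of:
  assumes "partition_on (space M) \<xi>" "A \<in> \<xi>"
  shows "atom_of \<xi> -` {A} \<inter> space M = A"
proof -
  have "A \<subseteq> space M" using partition_onD1[OF assms(1)] assms(2) by blast
  then show ?thesis using atom_of_eq_iff[OF assms(1) _ assms(2)] by auto
qed

lemma simple_function_atom_of:
  assumes "partition_on (space M) \<xi>" "finite \<xi>" "\<xi> \<subseteq> sets M"
  shows "simple_function M (atom_of \<xi>)"
proof -
  have sub: "atom_of \<xi> ` space M \<subseteq> \<xi>" using atom_of_in[OF assms(1)] by blast
  then show ?thesis
    unfolding simple_function_def
  proof (intro conjI)
    show "\<forall>x\<in>atom_of \<xi> ` space M. atom_of \<xi> -` {x} \<inter> space M \<in> sets M"
      using sub vimage_atom_of[OF assms(1)] assms(3) by (metis subsetD)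
  qed (rule finite_subset[OF sub assms(2)])
qed

text \<open>
  An atom of the common refinement chooses one atom for each time \<open>k < n\<close>, and a point of it has the
  chosen atoms as its itinerary. For \<open>n = 0\<close> the refinement of the empty set of partitions is not a
  partition of the space, hence the assumption.
\<close>

lemma iterated_partition_eq_fibres:
  assumes \<xi>: "partition_on (space M) \<xi>" and n: "n > 0"
  shows "iterated_partition M f \<xi> n
    = (\<lambda>\<omega>. {\<omega>' \<in> space M. itinerary (atom_of \<xi>) n \<omega>' = itinerary (atom_of \<xi>) n \<omega>}) ` space M"
    (is "?I = ?F ` space M")
proof -
  define P where "P k = (\<lambda>A. (f ^^ k) -` A \<inter> space M) ` \<xi>" for k
  have I: "?I = common_refinement (P ` {..<n})" by (simp add: iterated_partition_def P_def)
  have union: "\<Union> (P k) = space M" for k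
    using pow_in_space[of _ k] \<xi> by (fastforce simp: P_def partition_on_def)
  have fibre: "A = ?F \<omega>" and in_space: "\<omega> \<in> space M" if A: "A \<in> ?I" and \<omega>: "\<omega> \<in> A" for A \<omega>
  proof -
    obtain g where g: "\<And>k. k < n \<Longrightarrow> g (P k) \<in> P k" "A = \<Inter> (g ` P ` {..<n})"
      using A unfolding I common_refinement by auto
    have \<omega>g: "\<omega> \<in> g (P k)" if "k < n" for k using \<omega> g(2) that by auto
    show *: "\<omega> \<in> space M" using \<omega>g[OF n] g(1)[OF n] by (auto simp: P_def)
    have "g (P k) = {\<omega>' \<in> space M. atom_of \<xi> ((f ^^ k) \<omega>') = atom_of \<xi> ((f ^^ k) \<omega>)}" if k: "k < n" for k
    proof -
      obtain B where B: "B \<in> \<xi>" "g (P k) = (f ^^ k) -` B \<inter> space M" using g(1)[OF k] by (auto simp: P_def)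
      then have "atom_of \<xi> ((f ^^ k) \<omega>) = B"
        using \<omega>g[OF k] atom_of_eq_iff[OF \<xi> pow_in_space[OF *] B(1)] by auto
      then show ?thesis
        using B atom_of_eq_iff[OF \<xi> pow_in_space B(1)] by auto
    qed
    then have "A = (\<Inter>k\<in>{..<n}. {\<omega>' \<in> space M. atom_of \<xi> ((f ^^ k) \<omega>') = atom_of \<xi> ((f ^^ k) \<omega>)})"
      using g(2) by auto
    then show "A = ?F \<omega>" using n by (auto simp: itinerary_eq_iff)
  qed
  have "A \<in> ?F ` space M" if A: "A \<in> ?I" for A
  proof -
    have "A \<noteq> {}" using A unfolding I common_refinement_def by blast
    then obtain \<omega> where "\<omega> \<in> A" by blast
    then show ?thesis using fibre[OF A] in_space[OF A] by blast
  qed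
  moreover have "?F \<omega> \<in> ?I" if \<omega>: "\<omega> \<in> space M" for \<omega>
  proof -
    have "\<Union> ?I = space M" unfolding I Union_common_refinement using union n by auto
    then obtain A where "A \<in> ?I" "\<omega> \<in> A" using \<omega> by blast
    then show ?thesis using fibre by blast
  qed
  ultimately show ?thesis by blast
qed

lemma partition_entropy_iterated_partition:
  assumes \<xi>: "partition_on (space M) \<xi>" and n: "n > 0"
  shows "partition_entropy M (iterated_partition M f \<xi> n) = fun_entropy (itinerary (atom_of \<xi>) n)"
proof -
  let ?X = "itinerary (atom_of \<xi>) n"
  have "iterated_partition M f \<xi> n = (\<lambda>c. ?X -` {c} \<inter> space M) ` ?X ` space M"
    unfolding iterated_partition_eq_fibres[OF assms] by (auto simp: image_iff)
  moreover have "inj_on (\<lambda>c. ?X -` {c} \<inter> space M) (?X ` space M)"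
    by (auto simp: inj_on_def)
  ultimately show ?thesis
    by (simp add: partition_entropy_def fun_entropy_def fibre_prob_def sum.reindex)
qed

lemma lim_partition_entropy:
  assumes \<xi>: "partition_on (space M) \<xi>" "finite \<xi>" "\<xi> \<subseteq> sets M"
    and L: "(\<lambda>n. fun_entropy (itinerary (atom_of \<xi>) n) / n) \<longlonglongrightarrow> L"
  shows "lim (\<lambda>n. partition_entropy M (iterated_partition M f \<xi> n) / real n) = L"
proof (rule limI)
  show "(\<lambda>n. partition_entropy M (iterated_partition M f \<xi> n) / real n) \<longlonglongrightarrow> L"
    by (rule Lim_transform_eventually[OF L])
      (auto simp: partition_entropy_iterated_partition[OF \<xi>(1)] eventually_sequentially intro!: exI[of _ 1])
qed

end

section \<open>Entropy of the shift\<close>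

context path_space
begin

lemma path_shift_vimage_cylinder:
  "path_shift -` cylinder G v \<inter> paths G = (\<Union>e\<in>arcs G. cylinder G (e # v))"
proof -
  have *: "window u 0 (Suc (length v)) = u 0 # window (path_shift u) 0 (length v)" for u
    by (simp add: window_def path_shift_def upt_conv_Cons map_Suc_upt[symmetric] del: upt_Suc)
  show ?thesis
  proof (rule set_eqI)
    fix u
    show "u \<in> path_shift -` cylinder G v \<inter> paths G \<longleftrightarrow> u \<in> (\<Union>e\<in>arcs G. cylinder G (e # v))"
    proof (cases "u \<in> paths G")
      case True
      then have "u 0 \<in> arcs G" by (simp add: paths_def)
      then show ?thesis using True path_shift_in_paths[OF True] by (simp add: cylinder_iff *)
    qed (simp add: cylinder_iff)
  qed
qed

lemma path_shift_measurable:
  assumes \<mu>: "\<mu> \<in> path_measures G" shows "path_shift \<in> measurable \<mu> \<mu>"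
proof (rule measurable_sigma_sets[OF sets_path_measure[OF \<mu>]])
  show "range (cylinder G) \<subseteq> Pow (paths G)" using cylinder_subset_paths by blast
  show "path_shift \<in> space \<mu> \<rightarrow> paths G" using path_shift_in_paths space_path_measure[OF \<mu>] by auto
  show "path_shift -` A \<inter> space \<mu> \<in> sets \<mu>" if "A \<in> range (cylinder G)" for A
    using that cylinder_in_sets[OF \<mu>]
    by (auto simp: space_path_measure[OF \<mu>] path_shift_vimage_cylinder intro!: sets.finite_UN)
qed

lemma measure_shift_cylinder:
  assumes \<mu>: "\<mu> \<in> path_measures G"
  shows "measure \<mu> (path_shift -` cylinder G v \<inter> space \<mu>) = (\<Sum>e\<in>arcs G. mass \<mu> (e # v))"
proof -
  interpret prob_space \<mu> by (rule prob_space_path_measure[OF \<mu>])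
  show ?thesis
    unfolding space_path_measure[OF \<mu>] path_shift_vimage_cylinder
  proof (rule finite_measure_finite_Union)
    have "cylinder G (e # v) \<inter> cylinder G (e' # v) = {}" if "e \<noteq> e'" for e e'
      by (rule cylinder_disjoint) (use that in auto)
    then show "disjoint_family_on (\<lambda>e. cylinder G (e # v)) (arcs G)"
      by (simp add: disjoint_family_on_def)
  qed (use cylinder_in_sets[OF \<mu>] in auto)
qed

text \<open>
  The preimage of a cylinder under the shift is the union of the cylinders with one more arc in front.
\<close>

lemma invariant_path_measures_iff:
  "\<mu> \<in> invariant_path_measures G \<longleftrightarrow>
    \<mu> \<in> path_measures G \<and> (\<forall>v. (\<Sum>e\<in>arcs G. mass \<mu> (e # v)) = mass \<mu> v)"
proof -
  have "distr \<mu> \<mu> path_shift = \<mu> \<longleftrightarrow> (\<forall>v. (\<Sum>e\<in>arcs G. mass \<mu> (e # v)) = mass \<mu> v)"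
    if \<mu>: "\<mu> \<in> path_measures G"
  proof -
    have d: "distr \<mu> \<mu> path_shift \<in> path_measures G"
    proof (rule path_measureI)
      show "prob_space (distr \<mu> \<mu> path_shift)"
        by (rule prob_space.prob_space_distr[OF prob_space_path_measure[OF \<mu>] path_shift_measurable[OF \<mu>]])
    qed (simp_all add: space_path_measure[OF \<mu>] sets_path_measure[OF \<mu>])
    have m: "mass (distr \<mu> \<mu> path_shift) v = (\<Sum>e\<in>arcs G. mass \<mu> (e # v))" for v
      unfolding measure_distr[OF path_shift_measurable[OF \<mu>] cylinder_in_sets[OF \<mu>]]
      by (rule measure_shift_cylinder[OF \<mu>])
    show ?thesis using path_measure_eqI[OF d \<mu>] m by metis
  qed
  then show ?thesis
    using path_shift_measurable
    by (auto simp: invariant_path_measures_def invariant_prob_measures_def path_measures_def)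
qed

lemma invariant_in_path_measures: "\<mu> \<in> invariant_path_measures G \<Longrightarrow> \<mu> \<in> path_measures G"
  by (simp add: invariant_path_measures_iff)

lemma measure_preserving_invariant:
  assumes \<mu>: "\<mu> \<in> invariant_path_measures G" shows "measure_preserving \<mu> path_shift"
proof -
  have "prob_space \<mu>" by (rule prob_space_path_measure[OF invariant_in_path_measures[OF \<mu>]])
  moreover have "path_shift \<in> measurable \<mu> \<mu>" "distr \<mu> \<mu> path_shift = \<mu>"
    using \<mu> by (simp_all add: invariant_path_measures_def invariant_prob_measures_def)
  ultimately show ?thesis
    by (simp add: measure_preserving_def measure_preserving_axioms_def)
qed

definition block_entropy :: "(nat \<Rightarrow> 'e) measure \<Rightarrow> nat \<Rightarrow> real" where
  "block_entropy \<mu> n = - (\<Sum>v\<in>arc_lists G n. mass \<mu> v * ln (mass \<mu> v))"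

lemma determined_in_sets:
  assumes \<mu>: "\<mu> \<in> path_measures G" and A: "determined n A" shows "A \<in> sets \<mu>"
proof -
  have "(\<Union>v\<in>{v \<in> arc_lists G n. cylinder G v \<subseteq> A}. cylinder G v) \<in> sets \<mu>"
    using cylinder_in_sets[OF \<mu>]
    by (intro sets.finite_UN finite_subset[OF _ finite_arc_lists[of n]]) auto
  then show ?thesis using determined_eq_UN[OF A] by simp
qed

text \<open>
  The sets that can be approximated by determined ones form a \<open>\<sigma>\<close>-algebra containing the cylinders.
\<close>

lemma approx_by_determined:
  assumes \<mu>: "\<mu> \<in> path_measures G" and A: "A \<in> sets \<mu>" and \<delta>: "\<delta> > 0"
  shows "\<exists>m B. determined m B \<and> measure \<mu> (A - B) \<le> \<delta> \<and> measure \<mu> (B - A) \<le> \<delta>"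
proof -
  interpret prob_space \<mu> by (rule prob_space_path_measure[OF \<mu>])
  have sets_iff: "A \<in> sets \<mu> \<longleftrightarrow> A \<in> sigma_sets (paths G) (range (cylinder G))" for A
    by (simp add: sets_path_measure[OF \<mu>])
  have "A \<in> sigma_sets (paths G) (range (cylinder G))" using A by (simp add: sets_iff)
  then show ?thesis using \<delta>
  proof (induction arbitrary: \<delta> rule: sigma_sets.induct)
    case (Basic a)
    then obtain v where "a = cylinder G v" by blast
    then show ?case using Basic determined_cylinder[of v] by (intro exI[of _ "length v"] exI[of _ a]) simp
  next
    case Empty
    then show ?case using determined_empty[of 0] by (intro exI[of _ 0] exI[of _ "{}"]) simp
  next
    case (Compl a)
    then obtain m B where B: "determined m B" "measure \<mu> (a - B) \<le> \<delta>" "measure \<mu> (B - a) \<le> \<delta>" by blast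
    have a: "a \<subseteq> paths G" using Compl sets.sets_into_space[of a \<mu>] by (simp add: sets_iff space_path_measure[OF \<mu>])
    have "(paths G - a) - (paths G - B) = B - a" "(paths G - B) - (paths G - a) = a - B"
      using a B(1) by (auto simp: determined_def)
    then show ?case
      using B determined_Diff[OF determined_paths B(1)] by (intro exI[of _ m] exI[of _ "paths G - B"]) simp
  next
    case (Union a)
    then have a: "a i \<in> sets \<mu>" for i by (simp add: sets_iff)
    have "(\<lambda>n. measure \<mu> (\<Union>i<n. a i)) \<longlonglongrightarrow> measure \<mu> (\<Union>n. \<Union>i<n. a i)"
      using a by (intro finite_Lim_measure_incseq) (auto simp: incseq_def intro: less_le_trans)
    moreover have "(\<Union>n. \<Union>i<n. a i) = (\<Union>i. a i)" by auto
    ultimately have "eventually (\<lambda>n. measure \<mu> (\<Union>i<n. a i) > measure \<mu> (\<Union>i. a i) - \<delta> / 2) sequentially"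
      using Union.prems by (intro order_tendstoD(1)) auto
    then obtain N where N: "measure \<mu> (\<Union>i<N. a i) > measure \<mu> (\<Union>i. a i) - \<delta> / 2"
      by (auto simp: eventually_sequentially)
    define \<eta> where "\<eta> = \<delta> / (2 * (real N + 1))"
    have \<eta>: "\<eta> > 0" "real N * \<eta> \<le> \<delta> / 2" using Union.prems by (auto simp: \<eta>_def field_simps)
    have "\<forall>i. \<exists>m B. determined m B \<and> measure \<mu> (a i - B) \<le> \<eta> \<and> measure \<mu> (B - a i) \<le> \<eta>"
      using Union.IH \<eta>(1) by blast
    then obtain m B where B: "\<And>i. determined (m i) (B i)" "\<And>i. measure \<mu> (a i - B i) \<le> \<eta>"
      "\<And>i. measure \<mu> (B i - a i) \<le> \<eta>" by metis
    have sB: "B i \<in> sets \<mu>" for i using determined_in_sets[OF \<mu> B(1)] .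
    have det: "\<exists>k. determined k (\<Union>i<n. B i)" for n
    proof (induction n)
      case 0
      then show ?case using determined_empty by simp
    next
      case (Suc n)
      then obtain k where "determined k (\<Union>i<n. B i)" by blast
      then have "determined (max k (m n)) (\<Union>i<n. B i)" "determined (max k (m n)) (B n)"
        using determined_mono B(1) by (metis max.cobounded1, metis max.cobounded2)
      from determined_Un[OF this] show ?case by (auto simp: lessThan_Suc Un_commute)
    qed
    have "measure \<mu> ((\<Union>i. a i) - (\<Union>i<N. B i)) \<le> measure \<mu> (((\<Union>i. a i) - (\<Union>i<N. a i)) \<union> (\<Union>i<N. a i - B i))"
      using a sB by (intro finite_measure_mono) auto
    also have "\<dots> \<le> measure \<mu> ((\<Union>i. a i) - (\<Union>i<N. a i)) + measure \<mu> (\<Union>i<N. a i - B i)"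
      using a sB by (intro measure_Un_le) auto
    also have "measure \<mu> ((\<Union>i. a i) - (\<Union>i<N. a i)) = measure \<mu> (\<Union>i. a i) - measure \<mu> (\<Union>i<N. a i)"
      using a by (intro finite_measure_Diff) auto
    also have "measure \<mu> (\<Union>i<N. a i - B i) \<le> (\<Sum>i<N. measure \<mu> (a i - B i))"
      using a sB by (intro finite_measure_subadditive_finite) auto
    also have "\<dots> \<le> real N * \<eta>" using sum_mono[of "{..<N}" "\<lambda>i. measure \<mu> (a i - B i)" "\<lambda>_. \<eta>"] B(2) by simp
    finally have 1: "measure \<mu> ((\<Union>i. a i) - (\<Union>i<N. B i)) \<le> \<delta>" using N \<eta>(2) by linarith
    have "measure \<mu> ((\<Union>i<N. B i) - (\<Union>i. a i)) \<le> measure \<mu> (\<Union>i<N. B i - a i)"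
      using a sB by (intro finite_measure_mono) auto
    also have "\<dots> \<le> (\<Sum>i<N. measure \<mu> (B i - a i))"
      using a sB by (intro finite_measure_subadditive_finite) auto
    also have "\<dots> \<le> real N * \<eta>" using sum_mono[of "{..<N}" "\<lambda>i. measure \<mu> (B i - a i)" "\<lambda>_. \<eta>"] B(3) by simp
    finally have 2: "measure \<mu> ((\<Union>i<N. B i) - (\<Union>i. a i)) \<le> \<delta>" using \<eta>(2) Union.prems by linarith
    show ?case using det[of N] 1 2 by blast
  qed
qed

lemma sum_measure_cylinder_Int:
  assumes \<mu>: "\<mu> \<in> path_measures G" and A: "A \<in> sets \<mu>"
  shows "(\<Sum>v\<in>arc_lists G m. measure \<mu> (cylinder G v \<inter> A)) = measure \<mu> A"
proof -
  interpret prob_space \<mu> by (rule prob_space_path_measure[OF \<mu>])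
  have "A \<subseteq> paths G" using sets.sets_into_space[OF A] by (simp add: space_path_measure[OF \<mu>])
  then have "A = (\<Union>v\<in>arc_lists G m. cylinder G v \<inter> A)" using UN_cylinder[of G m] by blast
  then have "measure \<mu> A = measure \<mu> (\<Union>v\<in>arc_lists G m. cylinder G v \<inter> A)" by simp
  also have "\<dots> = (\<Sum>v\<in>arc_lists G m. measure \<mu> (cylinder G v \<inter> A))"
  proof (rule finite_measure_finite_Union[OF finite_arc_lists])
    show "(\<lambda>v. cylinder G v \<inter> A) ` arc_lists G m \<subseteq> sets \<mu>" using A cylinder_in_sets[OF \<mu>] by auto
    show "disjoint_family_on (\<lambda>v. cylinder G v \<inter> A) (arc_lists G m)"
      using disjoint_cylinder[of G m] unfolding disjoint_family_on_def by blast
  qed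
  finally show ?thesis by simp
qed

end

locale invariant_path_measure = path_space G for G :: "('v, 'e) pre_digraph" +
  fixes \<mu> :: "(nat \<Rightarrow> 'e) measure"
  assumes inv: "\<mu> \<in> invariant_path_measures G"

sublocale invariant_path_measure \<subseteq> measure_preserving \<mu> path_shift
  by (rule measure_preserving_invariant[OF inv])

context invariant_path_measure
begin

lemma \<mu>: "\<mu> \<in> path_measures G"
  using inv by (rule invariant_in_path_measures)

lemma simple_function_first: "simple_function \<mu> (\<lambda>u. u 0)"
proof -
  have sub: "(\<lambda>u. u 0) ` space \<mu> \<subseteq> arcs G" by (auto simp: space_path_measure[OF \<mu>] paths_def)
  have "(\<lambda>u. u 0) -` {e} \<inter> space \<mu> = cylinder G [e]" for e
    by (auto simp: space_path_measure[OF \<mu>] cylinder_iff window_def)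
  then show ?thesis
    unfolding simple_function_def using finite_subset[OF sub finite_arcs] cylinder_in_sets[OF \<mu>] by auto
qed

lemma itinerary_first: "itinerary (\<lambda>u. u 0) n = (\<lambda>u. window u 0 n)"
  by (rule ext) (simp add: itinerary_def window_def path_shift_pow)

lemma fun_entropy_window: "fun_entropy (\<lambda>u. window u 0 n) = block_entropy \<mu> n"
proof -
  have sub: "(\<lambda>u. window u 0 n) ` space \<mu> \<subseteq> arc_lists G n"
    unfolding space_path_measure[OF \<mu>] by (intro image_subsetI window_in_arc_lists)
  have "fibre_prob (\<lambda>u. window u 0 n) v = mass \<mu> v" if "v \<in> arc_lists G n" for v
  proof -
    have "(\<lambda>u. window u 0 n) -` {v} \<inter> space \<mu> = cylinder G v"
      using that by (auto simp: space_path_measure[OF \<mu>] cylinder_iff simp del: length_window)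
    then show ?thesis by (simp add: fibre_prob_def)
  qed
  then show ?thesis
    unfolding fun_entropy_superset[OF finite_arc_lists sub] block_entropy_def
    by (intro arg_cong[of _ _ uminus] sum.cong) auto
qed

text \<open>
  Given a long initial word, the atom of a fixed finite partition is almost determined, because each
  atom is almost a union of cylinders. The two kinds of cylinders, inside and outside that union,
  are both treated by the tangent inequality, but at different points.
\<close>

lemma conditional_entropy_small:
  assumes \<xi>: "partition_on (space \<mu>) \<xi>" "finite \<xi>" "\<xi> \<subseteq> sets \<mu>" and \<epsilon>: "\<epsilon> > 0"
  shows "\<exists>m. fun_entropy (\<lambda>u. (atom_of \<xi> u, window u 0 m)) - block_entropy \<mu> m \<le> \<epsilon>"
proof -
  (* Each of the card \<xi> atoms may contribute \<kappa>: half of it is \<eta>, the other half \<delta> + l * \<delta>. *)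
  define \<kappa> where "\<kappa> = \<epsilon> / (real (card \<xi>) + 1)"
  have \<kappa>: "\<kappa> > 0" "card \<xi> * \<kappa> \<le> \<epsilon>" using \<epsilon> by (auto simp: \<kappa>_def field_simps)
  define \<eta> where "\<eta> = min 1 (\<kappa> / 2)"
  have \<eta>: "\<eta> > 0" "\<eta> \<le> 1" "\<eta> \<le> \<kappa> / 2" using \<kappa> by (auto simp: \<eta>_def)
  define l where "l = - ln \<eta>"
  have l: "l \<ge> 0" using \<eta> by (simp add: l_def)
  define \<delta> where "\<delta> = (\<kappa> / 2) / (1 + l)"
  have \<delta>: "\<delta> > 0" "\<delta> + l * \<delta> = \<kappa> / 2"
  proof -
    have "1 + l \<noteq> 0" using l by linarith
    then have "(1 + l) * \<delta> = \<kappa> / 2"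
      unfolding \<delta>_def by (metis nonzero_mult_div_cancel_left times_divide_eq_right)
    then show "\<delta> + l * \<delta> = \<kappa> / 2" by (simp add: distrib_right)
    show "\<delta> > 0" unfolding \<delta>_def using \<kappa>(1) l by (intro divide_pos_pos) auto
  qed
  have "\<forall>A\<in>\<xi>. \<exists>m B. determined m B \<and> measure \<mu> (A - B) \<le> \<delta> \<and> measure \<mu> (B - A) \<le> \<delta>"
    using approx_by_determined[OF \<mu> _ \<delta>(1)] \<xi>(3) by blast
  then obtain m0 B where B0: "\<And>A. A \<in> \<xi> \<Longrightarrow> determined (m0 A) (B A)"
    and B: "\<And>A. A \<in> \<xi> \<Longrightarrow> measure \<mu> (A - B A) \<le> \<delta>" "\<And>A. A \<in> \<xi> \<Longrightarrow> measure \<mu> (B A - A) \<le> \<delta>"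
    by metis
  (* One length for all atoms. *)
  define m where "m = Max (insert 0 (m0 ` \<xi>))"
  have det: "determined m (B A)" if "A \<in> \<xi>" for A
    using B0[OF that] by (rule determined_mono) (use \<xi>(2) that in \<open>simp add: m_def\<close>)
  let ?p = "\<lambda>A v. measure \<mu> (cylinder G v \<inter> A)"
  have sets_B: "B A \<in> sets \<mu>" if "A \<in> \<xi>" for A using determined_in_sets[OF \<mu> det[OF that]] .
  have mass_sum: "mass \<mu> v = (\<Sum>A\<in>\<xi>. ?p A v)" for v
  proof -
    have "cylinder G v \<subseteq> \<Union>\<xi>"
      using cylinder_subset_paths[of G v] partition_onD1[OF \<xi>(1)] by (simp add: space_path_measure[OF \<mu>])
    then have "cylinder G v = (\<Union>A\<in>\<xi>. cylinder G v \<inter> A)"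
      by (simp add: Int_Union[symmetric] Int_absorb2)
    then have "mass \<mu> v = measure \<mu> (\<Union>A\<in>\<xi>. cylinder G v \<inter> A)" by simp
    also have "\<dots> = (\<Sum>A\<in>\<xi>. ?p A v)"
    proof (rule finite_measure_finite_Union[OF \<xi>(2)])
      show "(\<lambda>A. cylinder G v \<inter> A) ` \<xi> \<subseteq> sets \<mu>" using \<xi>(3) cylinder_in_sets[OF \<mu>] by auto
      show "disjoint_family_on (\<lambda>A. cylinder G v \<inter> A) \<xi>"
        using disjointD[OF partition_onD2[OF \<xi>(1)]] unfolding disjoint_family_on_def by blast
    qed
    finally show ?thesis .
  qed
  have "fun_entropy (\<lambda>u. (atom_of \<xi> u, window u 0 m)) = - (\<Sum>(A, v)\<in>\<xi> \<times> arc_lists G m. ?p A v * ln (?p A v))"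
  proof -
    have sub: "(\<lambda>u. (atom_of \<xi> u, window u 0 m)) ` space \<mu> \<subseteq> \<xi> \<times> arc_lists G m"
    proof (rule image_subsetI)
      fix u assume u: "u \<in> space \<mu>"
      then have "u \<in> paths G" by (simp add: space_path_measure[OF \<mu>])
      then show "(atom_of \<xi> u, window u 0 m) \<in> \<xi> \<times> arc_lists G m"
        using atom_of_in(1)[OF \<xi>(1) u] window_in_arc_lists by blast
    qed
    have "fibre_prob (\<lambda>u. (atom_of \<xi> u, window u 0 m)) (A, v) = ?p A v"
      if "A \<in> \<xi>" "v \<in> arc_lists G m" for A v
    proof -
      have "(\<lambda>u. (atom_of \<xi> u, window u 0 m)) -` {(A, v)} \<inter> space \<mu> = cylinder G v \<inter> A"
        using vimage_atom_of[OF \<xi>(1) that(1)] that(2) by (auto simp: cylinder_iff space_path_measure[OF \<mu>])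
      then show ?thesis by (simp add: fibre_prob_def)
    qed
    then show ?thesis
      unfolding fun_entropy_superset[OF finite_cartesian_product[OF \<xi>(2) finite_arc_lists] sub]
      by (intro arg_cong[of _ _ uminus] sum.cong) auto
  qed
  also have "\<dots> = - (\<Sum>A\<in>\<xi>. \<Sum>v\<in>arc_lists G m. ?p A v * ln (?p A v))"
    by (simp add: sum.cartesian_product)
  finally have "fun_entropy (\<lambda>u. (atom_of \<xi> u, window u 0 m)) - block_entropy \<mu> m
    = (\<Sum>v\<in>arc_lists G m. mass \<mu> v * ln (mass \<mu> v)) - (\<Sum>A\<in>\<xi>. \<Sum>v\<in>arc_lists G m. ?p A v * ln (?p A v))"
    by (simp add: block_entropy_def)
  also have "(\<Sum>v\<in>arc_lists G m. mass \<mu> v * ln (mass \<mu> v)) = (\<Sum>A\<in>\<xi>. \<Sum>v\<in>arc_lists G m. ?p A v * ln (mass \<mu> v))"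
  proof -
    have "mass \<mu> v * ln (mass \<mu> v) = (\<Sum>A\<in>\<xi>. ?p A v * ln (mass \<mu> v))" for v
      by (subst (1) mass_sum) (rule sum_distrib_right)
    then show ?thesis by (simp only: sum.swap[of _ "arc_lists G m"])
  qed
  also have "(\<Sum>A\<in>\<xi>. \<Sum>v\<in>arc_lists G m. ?p A v * ln (mass \<mu> v)) - (\<Sum>A\<in>\<xi>. \<Sum>v\<in>arc_lists G m. ?p A v * ln (?p A v))
    = (\<Sum>A\<in>\<xi>. \<Sum>v\<in>arc_lists G m. ?p A v * (ln (mass \<mu> v) - ln (?p A v)))"
    by (simp add: sum_subtractf right_diff_distrib)
  also have "\<dots> \<le> (\<Sum>A\<in>\<xi>. \<kappa>)"
  proof (rule sum_mono)
    fix A assume A: "A \<in> \<xi>"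
    have sA: "A \<in> sets \<mu>" using A \<xi>(3) by blast
    have summand: "?p A v * (ln (mass \<mu> v) - ln (?p A v))
      \<le> ?p (B A - A) v + \<eta> * mass \<mu> v + l * ?p (A - B A) v" if v: "v \<in> arc_lists G m" for v
    proof (cases "?p A v = 0")
      case True
      then show ?thesis using \<eta>(1) l by simp
    next
      case False
      then have q: "?p A v > 0" using measure_nonneg[of \<mu> "cylinder G v \<inter> A"] by linarith
      have qp: "?p A v \<le> mass \<mu> v" using cylinder_in_sets[OF \<mu>] by (intro finite_measure_mono) auto
      then have p: "mass \<mu> v > 0" using q by linarith
      have "determined (length v) (B A)" using det[OF A] v by simp
      then consider "cylinder G v \<subseteq> B A" | "cylinder G v \<inter> B A = {}" using determined_cylinder_cases by blast
      then show ?thesis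
      proof cases
        (* Tangent at the point mass v: the loss is the part of the cylinder outside A. *)
        case 1
        have "?p (B A - A) v = mass \<mu> v - ?p A v"
        proof -
          have "cylinder G v \<inter> (B A - A) = cylinder G v - (cylinder G v \<inter> A)" using 1 by blast
          then show ?thesis
            using cylinder_in_sets[OF \<mu>] sA by (simp add: finite_measure_Diff)
        qed
        moreover have "?p A v * (ln (mass \<mu> v) - ln (?p A v)) \<le> mass \<mu> v - ?p A v"
          using p q by (intro mult_ln_le) auto
        ultimately show ?thesis using \<eta>(1) l by (simp add: add_increasing2)
      next
        (* Tangent at \<eta> * mass v: the mass of such cylinders inside A is at most \<delta> in total, so the
           factor l = - ln \<eta> does no harm. *)
        case 2
        have eq: "?p (A - B A) v = ?p A v"
          using 2 by (intro arg_cong[of _ _ "measure \<mu>"]) blast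
        have "?p A v * (ln (\<eta> * mass \<mu> v) - ln (?p A v)) \<le> \<eta> * mass \<mu> v - ?p A v"
          using p q \<eta>(1) by (intro mult_ln_le) auto
        then have "?p A v * (ln (mass \<mu> v) - ln (?p A v)) \<le> \<eta> * mass \<mu> v - ?p A v + l * ?p A v"
          using p \<eta>(1) by (simp add: ln_mult l_def algebra_simps)
        then show ?thesis
          unfolding eq using q measure_nonneg[of \<mu> "cylinder G v \<inter> (B A - A)"] by linarith
      qed
    qed
    have "(\<Sum>v\<in>arc_lists G m. ?p A v * (ln (mass \<mu> v) - ln (?p A v)))
      \<le> (\<Sum>v\<in>arc_lists G m. ?p (B A - A) v + \<eta> * mass \<mu> v + l * ?p (A - B A) v)"
      using summand by (rule sum_mono)
    also have "\<dots> = measure \<mu> (B A - A) + \<eta> + l * measure \<mu> (A - B A)"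
      using sum_measure_cylinder_Int[OF \<mu>, of "B A - A" m] sum_measure_cylinder_Int[OF \<mu>, of "A - B A" m]
        sum_mass[OF \<mu>, of m] sA sets_B[OF A]
      by (simp add: sum.distrib sum_distrib_left[symmetric] sets.Diff)
    also have "\<dots> \<le> \<delta> + \<eta> + l * \<delta>"
      using B[OF A] l by (intro add_mono mult_left_mono) auto
    also have "\<dots> \<le> \<kappa>" using \<delta>(2) \<eta>(3) by linarith
    finally show "(\<Sum>v\<in>arc_lists G m. ?p A v * (ln (mass \<mu> v) - ln (?p A v))) \<le> \<kappa>" .
  qed
  also have "\<dots> \<le> \<epsilon>" using \<kappa>(2) by simp
  finally show ?thesis by blast
qed

text \<open>The partition into cylinders of length \<open>1\<close> generates, so it carries the whole entropy.\<close>

theorem ks_entropy_eq_block_entropy_rate: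
  "\<exists>L. ks_entropy \<mu> path_shift = ereal L \<and> (\<lambda>n. block_entropy \<mu> n / n) \<longlonglongrightarrow> L \<and> (\<forall>n. n * L \<le> block_entropy \<mu> n)"
proof -
  obtain L where L: "(\<lambda>n. block_entropy \<mu> n / n) \<longlonglongrightarrow> L" "\<forall>n. n * L \<le> block_entropy \<mu> n"
    using itinerary_entropy_limit[OF simple_function_first]
    unfolding itinerary_first fun_entropy_window by blast
  let ?\<Xi> = "{\<xi>. finite \<xi> \<and> \<xi> \<subseteq> sets \<mu> \<and> partition_on (space \<mu>) \<xi>}"
  let ?h = "\<lambda>\<xi>. lim (\<lambda>n. partition_entropy \<mu> (iterated_partition \<mu> path_shift \<xi> n) / real n)"
  have upper: "?h \<xi> \<le> L" if \<xi>: "\<xi> \<in> ?\<Xi>" for \<xi>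
  proof -
    have sf: "simple_function \<mu> (atom_of \<xi>)" using \<xi> by (auto intro: simple_function_atom_of)
    obtain h where h: "(\<lambda>n. fun_entropy (itinerary (atom_of \<xi>) n) / n) \<longlonglongrightarrow> h"
      using itinerary_entropy_limit[OF sf] by blast
    have "h \<le> L + \<epsilon>" if \<epsilon>: "\<epsilon> > 0" for \<epsilon>
    proof -
      obtain m where m: "fun_entropy (\<lambda>u. (atom_of \<xi> u, window u 0 m)) - block_entropy \<mu> m \<le> \<epsilon>"
        using conditional_entropy_small[of \<xi> \<epsilon>] \<xi> \<epsilon> by blast
      have "fun_entropy (itinerary (atom_of \<xi>) n) \<le> block_entropy \<mu> (n + m) + n * \<epsilon>" for n
      proof -
        have "fun_entropy (itinerary (atom_of \<xi>) n) \<le> block_entropy \<mu> (n + m)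
          + n * (fun_entropy (\<lambda>u. (atom_of \<xi> u, window u 0 m)) - block_entropy \<mu> m)"
          using itinerary_entropy_le[OF sf simple_function_first, of n m]
          unfolding itinerary_first fun_entropy_window .
        also have "\<dots> \<le> block_entropy \<mu> (n + m) + n * \<epsilon>"
          using m by (intro add_left_mono mult_left_mono) auto
        finally show ?thesis .
      qed
      note * = this
      have "fun_entropy (itinerary (atom_of \<xi>) n) / n
        \<le> block_entropy \<mu> (n + m) / real (n + m) * (1 + m / n) + \<epsilon>" if "n \<ge> 1" for n
      proof -
        have "1 + m / n = real (n + m) / n" using that by (simp add: field_simps)
        then have "block_entropy \<mu> (n + m) / real (n + m) * (1 + m / n) = block_entropy \<mu> (n + m) / n"
          using that by simp
        moreover have "fun_entropy (itinerary (atom_of \<xi>) n) / n \<le> (block_entropy \<mu> (n + m) + n * \<epsilon>) / n"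
          using *[of n] by (rule divide_right_mono) simp
        ultimately show ?thesis using that by (simp add: add_divide_distrib)
      qed
      moreover have "(\<lambda>n. block_entropy \<mu> (n + m) / real (n + m) * (1 + m / real n) + \<epsilon>) \<longlonglongrightarrow> L * (1 + 0) + \<epsilon>"
        by (intro tendsto_intros LIMSEQ_ignore_initial_segment[OF L(1)] lim_const_over_n)
      ultimately show ?thesis
        using LIMSEQ_le[OF h, of _ "L * (1 + 0) + \<epsilon>"] by auto
    qed
    then have "h \<le> L" by (rule field_le_epsilon)
    then show ?thesis using lim_partition_entropy[OF _ _ _ h] \<xi> by auto
  qed
  define \<xi> where "\<xi> = (\<lambda>e. cylinder G [e]) ` {e \<in> arcs G. cylinder G [e] \<noteq> {}}"
  have part: "partition_on (space \<mu>) \<xi>"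
  proof (rule partition_onI)
    show "\<Union>\<xi> = space \<mu>"
      using cylinder_eq_UN_snoc[of G "[]"] by (auto simp: \<xi>_def space_path_measure[OF \<mu>])
    show "{} \<notin> \<xi>" by (auto simp: \<xi>_def)
    show "disjnt p q" if "p \<in> \<xi>" "q \<in> \<xi>" "p \<noteq> q" for p q
    proof -
      obtain e e' where "p = cylinder G [e]" "q = cylinder G [e']" using \<open>p \<in> \<xi>\<close> \<open>q \<in> \<xi>\<close> by (auto simp: \<xi>_def)
      then show ?thesis
        using cylinder_disjoint[of "[e]" "[e']" G] \<open>p \<noteq> q\<close> by (auto simp: disjnt_def)
    qed
  qed
  have \<xi>: "\<xi> \<in> ?\<Xi>"
    using part finite_arcs cylinder_in_sets[OF \<mu>] by (auto simp: \<xi>_def)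
  have atom: "atom_of \<xi> u = cylinder G [u 0]" if u: "u \<in> space \<mu>" for u
  proof -
    have "u \<in> cylinder G [u 0]" "u 0 \<in> arcs G"
      using u by (auto simp: cylinder_iff window_def space_path_measure[OF \<mu>] paths_def)
    then show ?thesis using atom_of_eq_iff[OF part u, of "cylinder G [u 0]"] by (auto simp: \<xi>_def)
  qed
  have same: "atom_of \<xi> u = atom_of \<xi> u' \<longleftrightarrow> u 0 = u' 0" if "u \<in> space \<mu>" "u' \<in> space \<mu>" for u u'
  proof -
    have "u \<in> cylinder G [u 0]" using that by (auto simp: cylinder_iff window_def space_path_measure[OF \<mu>])
    then show ?thesis
      using cylinder_disjoint[of "[u 0]" "[u' 0]" G] by (auto simp: atom that)
  qed
  have "fun_entropy (itinerary (atom_of \<xi>) n) = block_entropy \<mu> n" for n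
    unfolding fun_entropy_window[symmetric] itinerary_first[symmetric]
  proof (rule antisym; rule fun_entropy_mono)
    show "simple_function \<mu> (itinerary (\<lambda>u. u 0) n)" "simple_function \<mu> (itinerary (atom_of \<xi>) n)"
      using simple_function_first simple_function_atom_of \<xi> by (auto intro: simple_function_itinerary)
  qed (use same pow_in_space in \<open>auto simp: itinerary_eq_iff\<close>)
  then have "?h \<xi> = L" using lim_partition_entropy[OF part _ _] \<xi> L(1) by auto
  then have "ks_entropy \<mu> path_shift = ereal L"
    unfolding ks_entropy_def using upper \<xi>
    by (intro antisym SUP_least SUP_upper2[of \<xi>]) auto
  then show ?thesis using L by blast
qed

end

section \<open>Empirical measures and mixtures\<close>

context path_space
begin

lemma
  assumes u: "u \<in> paths G" and n: "n > 0"
  shows empirical_in_path_measures: "empirical_measure G n u \<in> path_measures G"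
    and mass_empirical: "mass (empirical_measure G n u) v = (\<Sum>i<n. of_bool (window u i (length v) = v)) / n"
    and integral_empirical: "continuous_map (path_topology G) euclideanreal g \<Longrightarrow>
      integral\<^sup>L (empirical_measure G n u) g = (\<Sum>i<n. g ((path_shift ^^ i) u)) / n"
proof -
  let ?B = "borel_algebra (path_topology G)" and ?E = "empirical_measure G n u"
  have space_B: "space ?B = paths G" by (simp add: borel_algebra_def space_measure_of_conv topspace_path_topology)
  have sets_E: "sets ?E = sets ?B"
    by (simp add: empirical_measure_def Let_def)
  have space_E: "space ?E = paths G"
    by (simp add: empirical_measure_def Let_def space_measure_of_conv space_B)
  have em: "emeasure ?E A = ennreal ((\<Sum>i<n. indicator A ((path_shift ^^ i) u)) / n)" if "A \<in> sets ?B" for A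
  proof -
    have "(\<Sum>i<n. indicator A ((path_shift ^^ i) u)) = ennreal (\<Sum>i<n. indicator A ((path_shift ^^ i) u))"
      by (simp add: ennreal_indicator flip: sum_ennreal)
    then show ?thesis
      using n unfolding emeasure_empirical_measure[OF that]
      by (simp add: ennreal_of_nat_eq_real_of_nat divide_ennreal sum_nonneg)
  qed
  have paths_B: "paths G \<in> sets ?B" using sets.top[of ?B] by (simp add: space_B)
  show E: "?E \<in> path_measures G"
  proof (rule path_measureI)
    have "emeasure ?E (paths G) = 1"
      using path_shift_pow_in_paths[OF u] n by (simp add: em[OF paths_B])
    then show "prob_space ?E" by (intro prob_spaceI) (simp add: space_E)
  qed (simp_all add: space_E sets_E sets_borel_algebra_paths)
  have cyl_B: "cylinder G v \<in> sets ?B" for v using cylinder_in_sets[OF E] by (simp add: sets_E)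
  have ind: "indicator (cylinder G v) ((path_shift ^^ i) u) = (of_bool (window u i (length v) = v) :: real)" for v i
    using path_shift_pow_in_paths[OF u, of i] by (simp add: cylinder_iff indicator_def)
  show mass_E: "mass ?E v = (\<Sum>i<n. of_bool (window u i (length v) = v)) / n" for v
    unfolding measure_def em[OF cyl_B] ind by (simp add: sum_nonneg)
  assume g: "continuous_map (path_topology G) euclideanreal g"
  have ret: "return ?B ((path_shift ^^ i) u) \<in> path_measures G" for i
    using path_shift_pow_in_paths[OF u, of i]
    by (intro path_measureI prob_space_return) (auto simp: space_B sets_borel_algebra_paths)
  have "integral\<^sup>L ?E g = (\<Sum>i<n. 1 / n * integral\<^sup>L (return ?B ((path_shift ^^ i) u)) g)"
  proof (rule integral_mixture[OF g E ret])
    show "mass ?E v = (\<Sum>i<n. 1 / n * mass (return ?B ((path_shift ^^ i) u)) v)" for v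
      unfolding mass_E measure_return[OF cyl_B] ind by (simp add: sum_divide_distrib del: sum_of_bool_eq)
  qed (use n in auto)
  also have "\<dots> = (\<Sum>i<n. g ((path_shift ^^ i) u)) / n"
  proof -
    have "g \<in> borel_measurable ?B"
      using borel_measurable_continuous[OF g E] sets_E measurable_cong_sets[OF sets_E refl] by blast
    then have "integral\<^sup>L (return ?B ((path_shift ^^ i) u)) g = g ((path_shift ^^ i) u)" for i
      using path_shift_pow_in_paths[OF u, of i] by (simp add: integral_return space_B)
    then show ?thesis by (simp add: sum_divide_distrib)
  qed
  finally show "integral\<^sup>L ?E g = (\<Sum>i<n. g ((path_shift ^^ i) u)) / n" .
qed

lemma
  assumes \<mu>: "\<mu> \<in> path_measures G" and \<nu>: "\<nu> \<in> path_measures G" and t: "t \<in> {0..1}"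
  shows mix_in_path_measures: "mix_measure t \<mu> \<nu> \<in> path_measures G"
    and mass_mix: "mass (mix_measure t \<mu> \<nu>) v = t * mass \<mu> v + (1 - t) * mass \<nu> v"
proof -
  interpret \<mu>: prob_space \<mu> by (rule prob_space_path_measure[OF \<mu>])
  interpret \<nu>: prob_space \<nu> by (rule prob_space_path_measure[OF \<nu>])
  have sets: "sets \<nu> = sets \<mu>" using sets_path_measure \<mu> \<nu> by simp
  have em: "emeasure (mix_measure t \<mu> \<nu>) A = ennreal (t * measure \<mu> A + (1 - t) * measure \<nu> A)" if "A \<in> sets \<mu>" for A
    using t unfolding emeasure_mix_measure[OF sets that] \<mu>.emeasure_eq_measure \<nu>.emeasure_eq_measure
    by (simp add: ennreal_mult' ennreal_plus)
  have sp: "space (mix_measure t \<mu> \<nu>) = paths G"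
    by (simp add: mix_measure_def space_measure_of_conv space_path_measure[OF \<mu>])
  have top: "paths G \<in> sets \<mu>" using sets.top[of \<mu>] by (simp add: space_path_measure[OF \<mu>])
  show "mix_measure t \<mu> \<nu> \<in> path_measures G"
  proof (rule path_measureI[OF sp])
    show "sets (mix_measure t \<mu> \<nu>) = sigma_sets (paths G) (range (cylinder G))"
      unfolding sets_path_measure[OF \<mu>, symmetric] by (simp add: mix_measure_def)
    have "emeasure (mix_measure t \<mu> \<nu>) (paths G) = 1"
      using mass_Nil[OF \<mu>] mass_Nil[OF \<nu>] by (simp add: em[OF top])
    then show "prob_space (mix_measure t \<mu> \<nu>)" by (intro prob_spaceI) (simp add: sp)
  qed
  show "mass (mix_measure t \<mu> \<nu>) v = t * mass \<mu> v + (1 - t) * mass \<nu> v"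
    unfolding measure_def[of "mix_measure t \<mu> \<nu>"] em[OF cylinder_in_sets[OF \<mu>]]
    by (rule enn2real_ennreal) (use t in simp)
qed

lemma mix_invariant:
  assumes \<mu>: "\<mu> \<in> invariant_path_measures G" and \<nu>: "\<nu> \<in> invariant_path_measures G" and t: "t \<in> {0..1}"
  shows "mix_measure t \<mu> \<nu> \<in> invariant_path_measures G"
  using assms mix_in_path_measures[of \<mu> \<nu> t] mass_mix[of \<mu> \<nu> t]
  by (auto simp: invariant_path_measures_iff sum.distrib simp flip: sum_distrib_left)

text \<open>
  Split off one component and renormalise the others, so that binary mixtures suffice.
\<close>

lemma finite_mixture:
  assumes Q: "Q \<subseteq> path_measures G" and mix: "\<And>t \<mu> \<nu>. t \<in> {0..1} \<Longrightarrow> \<mu> \<in> Q \<Longrightarrow> \<nu> \<in> Q \<Longrightarrow> mix_measure t \<mu> \<nu> \<in> Q"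
    and "finite I" and "\<And>i. i \<in> I \<Longrightarrow> \<mu> i \<in> Q" and "\<And>i. i \<in> I \<Longrightarrow> c i \<ge> 0" and "(\<Sum>i\<in>I. c i) = 1"
  shows "\<exists>\<nu>\<in>Q. \<forall>v. mass \<nu> v = (\<Sum>i\<in>I. c i * mass (\<mu> i) v)"
  using assms(3-)
proof (induction I arbitrary: c rule: finite_induct)
  case (insert i I)
  have ci: "c i \<ge> 0" and nonneg: "\<And>j. j \<in> I \<Longrightarrow> c j \<ge> 0" using insert.prems by auto
  have sum: "(\<Sum>j\<in>I. c j) = 1 - c i" using insert by simp
  show ?case
  proof (cases "c i = 1")
    case True
    then have "\<forall>j\<in>I. c j = 0" using sum insert.hyps(1) nonneg by (simp add: sum_nonneg_eq_0_iff)
    then show ?thesis using True insert by (intro bexI[of _ "\<mu> i"]) auto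
  next
    case False
    have "(\<Sum>j\<in>I. c j) \<ge> 0" using nonneg by (rule sum_nonneg)
    then have lt: "c i < 1" using False sum by linarith
    have "\<exists>\<nu>\<in>Q. \<forall>v. mass \<nu> v = (\<Sum>j\<in>I. c j / (1 - c i) * mass (\<mu> j) v)"
      using insert.prems nonneg lt sum
      by (intro insert.IH) (auto simp: sum_divide_distrib[symmetric])
    then obtain \<nu> where \<nu>: "\<nu> \<in> Q" "\<And>v. mass \<nu> v = (\<Sum>j\<in>I. c j / (1 - c i) * mass (\<mu> j) v)" by blast
    have t: "c i \<in> {0..1}" using ci lt by simp
    have \<mu>i: "\<mu> i \<in> Q" using insert.prems by simp
    have "mass (mix_measure (c i) (\<mu> i) \<nu>) v = (\<Sum>j\<in>insert i I. c j * mass (\<mu> j) v)" for v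
    proof -
      have "(1 - c i) * mass \<nu> v = (\<Sum>j\<in>I. c j * mass (\<mu> j) v)"
        unfolding \<nu>(2) sum_distrib_left using lt by (intro sum.cong) auto
      then show ?thesis
        using mass_mix[of "\<mu> i" \<nu> "c i" v] \<mu>i \<nu>(1) Q t insert.hyps by auto
    qed
    then show ?thesis using mix[OF t \<mu>i \<nu>(1)] by blast
  qed
qed simp

section \<open>Entropy of Gibbs mixtures of empirical measures\<close>

text \<open>
  Think of \<open>\<tau>\<close> as transition weights of a Markov chain of order \<open>j\<close>. Summing over the last arc shortens
  the trajectories by one step, until only the initial words of length \<open>j\<close> remain, each with weight \<open>1\<close>.
\<close>

lemma sum_markov_weights_le:
  fixes \<tau> :: "'e list \<Rightarrow> real"
  assumes nonneg: "\<And>x. \<tau> x \<ge> 0" and sub: "\<And>x. x \<in> arc_lists G j \<Longrightarrow> (\<Sum>e\<in>arcs G. \<tau> (x @ [e])) \<le> 1"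
  shows "(\<Sum>y\<in>arc_lists G (j + n). \<Prod>i<n. \<tau> (take (Suc j) (drop i y))) \<le> real (card (arcs G)) ^ j"
proof (induction n)
  case 0
  then show ?case using card_lists_length_eq[OF finite_arcs, of j] by simp
next
  case (Suc n)
  have "(\<Sum>y\<in>arc_lists G (Suc (j + n)). \<Prod>i<Suc n. \<tau> (take (Suc j) (drop i y)))
    = (\<Sum>y\<in>arc_lists G (j + n). \<Sum>e\<in>arcs G. (\<Prod>i<n. \<tau> (take (Suc j) (drop i y))) * \<tau> (drop n y @ [e]))"
    unfolding sum_arc_lists_Suc
  proof (intro sum.cong refl)
    fix y e assume "y \<in> arc_lists G (j + n)"
    then have len: "length y = j + n" by simp
    have 1: "take (Suc j) (drop i (y @ [e])) = take (Suc j) (drop i y)" if "i < n" for i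
      using that len by simp
    have 2: "take (Suc j) (drop n (y @ [e])) = drop n y @ [e]" using len by simp
    have "(\<Prod>i<n. \<tau> (take (Suc j) (drop i (y @ [e])))) = (\<Prod>i<n. \<tau> (take (Suc j) (drop i y)))"
      by (rule prod.cong[OF refl], rule arg_cong[of _ _ \<tau>], rule 1) simp
    then show "(\<Prod>i<Suc n. \<tau> (take (Suc j) (drop i (y @ [e]))))
      = (\<Prod>i<n. \<tau> (take (Suc j) (drop i y))) * \<tau> (drop n y @ [e])"
      unfolding prod.lessThan_Suc 2 by (rule arg_cong)
  qed
  also have "\<dots> \<le> (\<Sum>y\<in>arc_lists G (j + n). (\<Prod>i<n. \<tau> (take (Suc j) (drop i y))) * 1)"
    unfolding sum_distrib_left[symmetric]
  proof (intro sum_mono mult_left_mono prod_nonneg)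
    fix y assume y: "y \<in> arc_lists G (j + n)"
    then have "set (drop n y) \<subseteq> arcs G" using set_drop_subset[of n y] by auto
    then show "(\<Sum>e\<in>arcs G. \<tau> (drop n y @ [e])) \<le> 1" using y by (intro sub) simp
  qed (simp add: nonneg)
  finally show ?case using Suc.IH by simp
qed

lemma sum_over_windows:
  assumes u: "u \<in> paths G" and n: "n > 0"
  shows "(\<Sum>i<n. F (window u i k)) = n * (\<Sum>x\<in>arc_lists G k. mass (empirical_measure G n u) x * F x)"
proof -
  have "(\<Sum>i<n. F (window u i k)) = (\<Sum>i<n. \<Sum>x\<in>arc_lists G k. of_bool (window u i k = x) * F x)"
  proof (intro sum.cong refl)
    fix i
    have "window u i k \<in> arc_lists G k" using u by (rule window_in_arc_lists)
    then have "(\<Sum>x\<in>arc_lists G k. if x = window u i k then F x else 0) = F (window u i k)"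
      by (subst sum.delta[OF finite_arc_lists]) simp
    then show "F (window u i k) = (\<Sum>x\<in>arc_lists G k. of_bool (window u i k = x) * F x)"
      by (simp add: of_bool_def if_distrib[of "\<lambda>x. x * _"] eq_commute[of "window u i k"] cong: if_cong)
  qed
  also have "\<dots> = (\<Sum>x\<in>arc_lists G k. n * (mass (empirical_measure G n u) x * F x))"
    unfolding sum.swap[of _ _ "{..<n}"]
    using n by (intro sum.cong refl) (auto simp: mass_empirical[OF u n] sum_distrib_right)
  finally show ?thesis by (simp add: sum_distrib_left)
qed

text \<open>
  Shifting the window by one place changes the occurrences only at the two ends.
\<close>

lemma empirical_almost_invariant:
  assumes u: "u \<in> paths G" and n: "n > 0"
  shows "\<bar>(\<Sum>e\<in>arcs G. mass (empirical_measure G n u) (e # v)) - mass (empirical_measure G n u) v\<bar> \<le> 1 / n"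
proof -
  define b where "b i = (of_bool (window u i (length v) = v) :: real)" for i
  have *: "(\<Sum>e\<in>arcs G. of_bool (window u i (length (e # v)) = e # v)) = b (Suc i)" for i
  proof -
    have w: "window u i (Suc (length v)) = u i # window u (Suc i) (length v)"
      by (simp add: window_def upt_conv_Cons del: upt_Suc)
    have "u i \<in> arcs G" using u by (simp add: paths_def)
    then have "(\<Sum>e\<in>arcs G. if e = u i then b (Suc i) else 0) = b (Suc i)"
      by (subst sum.delta[OF finite_arcs]) simp
    moreover have "of_bool (window u i (length (e # v)) = e # v) = (if e = u i then b (Suc i) else 0)" for e
      by (auto simp: w b_def)
    ultimately show ?thesis by simp
  qed
  have "(\<Sum>e\<in>arcs G. mass (empirical_measure G n u) (e # v)) = (\<Sum>i<n. b (Suc i)) / n"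
    unfolding mass_empirical[OF u n] sum_divide_distrib[symmetric] sum.swap[of _ _ "arcs G"] * ..
  moreover have "mass (empirical_measure G n u) v = (\<Sum>i<n. b i) / n"
    unfolding mass_empirical[OF u n] b_def ..
  ultimately have "(\<Sum>e\<in>arcs G. mass (empirical_measure G n u) (e # v)) - mass (empirical_measure G n u) v
    = (b n - b 0) / n"
    using sum_lessThan_telescope[of b n] by (simp add: sum_subtractf diff_divide_distrib[symmetric])
  moreover have "\<bar>b n - b 0\<bar> \<le> 1" by (simp add: b_def)
  ultimately show ?thesis by (simp add: divide_right_mono)
qed

text \<open>
  The expected logarithm of the conditional probability of the last arc given the \<open>j\<close> arcs before it.
\<close>

lemma sum_mass_ln_conditional:
  assumes \<nu>: "\<nu> \<in> path_measures G"
  shows "(\<Sum>x\<in>arc_lists G (Suc j). mass \<nu> x * ln (mass \<nu> x / mass \<nu> (butlast x)))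
    = block_entropy \<nu> j - block_entropy \<nu> (Suc j)"
proof -
  have "mass \<nu> (y @ [e]) * ln (mass \<nu> (y @ [e]) / mass \<nu> y)
    = mass \<nu> (y @ [e]) * ln (mass \<nu> (y @ [e])) - mass \<nu> (y @ [e]) * ln (mass \<nu> y)" if "e \<in> arcs G" for y e
  proof (cases "mass \<nu> (y @ [e]) = 0")
    case False
    then have pos: "mass \<nu> (y @ [e]) > 0" by (simp add: zero_less_measure_iff)
    have "mass \<nu> (y @ [e]) \<le> mass \<nu> y"
      unfolding mass_snoc[OF \<nu>, of y] using that by (intro member_le_sum) auto
    then show ?thesis using pos by (simp add: ln_div algebra_simps)
  qed simp
  then have "(\<Sum>x\<in>arc_lists G (Suc j). mass \<nu> x * ln (mass \<nu> x / mass \<nu> (butlast x)))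
    = (\<Sum>y\<in>arc_lists G j. \<Sum>e\<in>arcs G. mass \<nu> (y @ [e]) * ln (mass \<nu> (y @ [e])))
      - (\<Sum>y\<in>arc_lists G j. \<Sum>e\<in>arcs G. mass \<nu> (y @ [e]) * ln (mass \<nu> y))"
    unfolding sum_arc_lists_Suc by (simp add: sum_subtractf)
  also have "(\<Sum>y\<in>arc_lists G j. \<Sum>e\<in>arcs G. mass \<nu> (y @ [e]) * ln (mass \<nu> y)) = (\<Sum>y\<in>arc_lists G j. mass \<nu> y * ln (mass \<nu> y))"
    unfolding sum_distrib_right[symmetric] mass_snoc[OF \<nu>, symmetric] ..
  also have "(\<Sum>y\<in>arc_lists G j. \<Sum>e\<in>arcs G. mass \<nu> (y @ [e]) * ln (mass \<nu> (y @ [e])))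
    = (\<Sum>x\<in>arc_lists G (Suc j). mass \<nu> x * ln (mass \<nu> x))"
    unfolding sum_arc_lists_Suc ..
  finally show ?thesis by (simp add: block_entropy_def)
qed

text \<open>
  The Gibbs measure on the words that contribute to the partition sum induces a mixture of empirical
  measures. Its entropy is bounded by comparison with the Markov chain of order \<open>j\<close> whose transition
  probabilities are the conditional probabilities of that mixture.
\<close>

lemma partition_function_le:
  fixes u :: "'i \<Rightarrow> nat \<Rightarrow> 'e"
  assumes W: "finite W" and u: "\<And>w. w \<in> W \<Longrightarrow> u w \<in> paths G" and n: "n > 0"
    and inj: "inj_on (\<lambda>w. window (u w) 0 n) W"
    and c: "\<And>w. w \<in> W \<Longrightarrow> c w > 0" "(\<Sum>w\<in>W. c w) = 1"
    and \<nu>: "\<nu> \<in> path_measures G"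
    and mix: "\<And>v. mass \<nu> v = (\<Sum>w\<in>W. c w * mass (empirical_measure G n (u w)) v)"
  shows "- (\<Sum>w\<in>W. c w * ln (c w))
    \<le> j * ln (card (arcs G)) + n * (block_entropy \<nu> (Suc j) - block_entropy \<nu> j)"
proof -
  (* Conditional probabilities of the mixture, and the resulting Markov weight of the trajectory of u w.
     The trajectory has length j + n: a transition starts from each of the first n windows of length j.
     The mixture charges every window that occurs, so none of these quotients vanishes. *)
  define \<tau> where "\<tau> x = mass \<nu> x / mass \<nu> (butlast x)" for x
  define q where "q w = (\<Prod>i<n. \<tau> (window (u w) i (Suc j)))" for w
  define K where "K = real (card (arcs G)) ^ j"
  have K: "K > 0" using arcs_nonempty finite_arcs by (simp add: K_def card_gt_0_iff)
  have c_nonneg: "c w \<ge> 0" if "w \<in> W" for w using c(1)[OF that] by simp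
  have mass_pos: "mass \<nu> (window (u w) i k) > 0" if w: "w \<in> W" and i: "i < n" for w i k
  proof -
    have "0 < c w * mass (empirical_measure G n (u w)) (window (u w) i k)"
    proof (rule mult_pos_pos[OF c(1)[OF w]])
      have "(1::real) \<le> (\<Sum>l<n. of_bool (window (u w) l k = window (u w) i k))"
        using i member_le_sum[of i "{..<n}" "\<lambda>l. of_bool (window (u w) l k = window (u w) i k) :: real"] by simp
      then show "0 < mass (empirical_measure G n (u w)) (window (u w) i k)"
        using n unfolding mass_empirical[OF u[OF w] n] by (simp del: sum_of_bool_eq)
    qed
    also have "\<dots> \<le> mass \<nu> (window (u w) i k)"
      unfolding mix using w W c_nonneg by (intro member_le_sum) (auto intro!: mult_nonneg_nonneg)
    finally show ?thesis .
  qed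
  have butlast: "butlast (window (u w) i (Suc j)) = window (u w) i j" for w i
    by (simp add: window_Suc)
  have \<tau>_pos: "\<tau> (window (u w) i (Suc j)) > 0" if "w \<in> W" "i < n" for w i
    unfolding \<tau>_def butlast using mass_pos[OF that] by simp
  have q_pos: "q w > 0" if "w \<in> W" for w unfolding q_def using \<tau>_pos[OF that] by (intro prod_pos) auto
  have sum_q: "(\<Sum>w\<in>W. q w) \<le> K"
  proof -
    have \<tau>_nonneg: "\<tau> x \<ge> 0" for x by (simp add: \<tau>_def)
    have "q w = (\<Prod>i<n. \<tau> (take (Suc j) (drop i (window (u w) 0 (j + n)))))" for w
      unfolding q_def by (intro prod.cong refl arg_cong[of _ _ \<tau>] window_take_drop) simp
    then have "(\<Sum>w\<in>W. q w) = (\<Sum>y\<in>(\<lambda>w. window (u w) 0 (j + n)) ` W. \<Prod>i<n. \<tau> (take (Suc j) (drop i y)))"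
    proof (subst sum.reindex)
      show "inj_on (\<lambda>w. window (u w) 0 (j + n)) W"
        using inj by (auto simp: inj_on_def window_eq_iff)
    qed simp
    also have "\<dots> \<le> (\<Sum>y\<in>arc_lists G (j + n). \<Prod>i<n. \<tau> (take (Suc j) (drop i y)))"
    proof (rule sum_mono2[OF finite_arc_lists])
      show "(\<lambda>w. window (u w) 0 (j + n)) ` W \<subseteq> arc_lists G (j + n)"
        by (intro image_subsetI window_in_arc_lists u)
    qed (auto intro: prod_nonneg \<tau>_nonneg)
    also have "\<dots> \<le> K"
      unfolding K_def
    proof (rule sum_markov_weights_le[OF \<tau>_nonneg])
      show "(\<Sum>e\<in>arcs G. \<tau> (x @ [e])) \<le> 1" for x
        unfolding \<tau>_def by (simp add: sum_divide_distrib[symmetric] mass_snoc[OF \<nu>, symmetric])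
    qed
    finally show ?thesis .
  qed
  (* The Gibbs inequality: the relative entropy of c with respect to q / K is nonnegative. *)
  have "(\<Sum>w\<in>W. c w * (ln (q w / K) - ln (c w))) \<le> (\<Sum>w\<in>W. q w / K - c w)"
    using q_pos K c(1) by (intro sum_mono mult_ln_le) (auto intro: less_imp_le divide_pos_pos)
  also have "\<dots> = (\<Sum>w\<in>W. q w) / K - 1" by (simp add: sum_subtractf sum_divide_distrib c(2))
  also have "\<dots> \<le> 0" using sum_q K by simp
  finally have "(\<Sum>w\<in>W. c w * ln (q w / K)) \<le> (\<Sum>w\<in>W. c w * ln (c w))"
    by (simp add: right_diff_distrib sum_subtractf)
  moreover have "(\<Sum>w\<in>W. c w * ln (q w / K)) = (\<Sum>w\<in>W. c w * ln (q w)) - ln K"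
  proof -
    have "(\<Sum>w\<in>W. c w * ln (q w / K)) = (\<Sum>w\<in>W. c w * ln (q w) - c w * ln K)"
    proof (intro sum.cong refl)
      fix w assume "w \<in> W"
      then have "ln (q w / K) = ln (q w) - ln K" using q_pos[of w] K by (simp add: ln_div)
      then show "c w * ln (q w / K) = c w * ln (q w) - c w * ln K" by (simp only: right_diff_distrib)
    qed
    then show ?thesis by (simp add: sum_subtractf c(2) flip: sum_distrib_right)
  qed
  moreover have "ln K = j * ln (card (arcs G))"
    using arcs_nonempty finite_arcs by (simp add: K_def ln_realpow card_gt_0_iff)
  moreover have "(\<Sum>w\<in>W. c w * ln (q w)) = n * (block_entropy \<nu> j - block_entropy \<nu> (Suc j))"
  proof -
    have "ln (q w) = n * (\<Sum>x\<in>arc_lists G (Suc j). mass (empirical_measure G n (u w)) x * ln (\<tau> x))" if w: "w \<in> W" for w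
    proof -
      have "ln (q w) = (\<Sum>i<n. ln (\<tau> (window (u w) i (Suc j))))"
        unfolding q_def by (rule ln_prod) (use \<tau>_pos[OF w] in \<open>force+\<close>)
      then show ?thesis using sum_over_windows[OF u[OF w] n, of "\<lambda>x. ln (\<tau> x)"] by simp
    qed
    then have "(\<Sum>w\<in>W. c w * ln (q w))
      = (\<Sum>w\<in>W. \<Sum>x\<in>arc_lists G (Suc j). n * (c w * mass (empirical_measure G n (u w)) x * ln (\<tau> x)))"
      by (intro sum.cong refl) (simp add: sum_distrib_left mult_ac)
    also have "\<dots> = n * (\<Sum>x\<in>arc_lists G (Suc j). mass \<nu> x * ln (\<tau> x))"
      unfolding mix sum_distrib_left sum_distrib_right
      by (subst sum.swap) (rule refl)
    finally show ?thesis unfolding \<tau>_def sum_mass_ln_conditional[OF \<nu>] .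
  qed
  ultimately show ?thesis by (simp add: algebra_simps)
qed

end

text \<open>
  Only the limit \<open>0\<close> needs an argument: \<open>x ln x\<close> is of order \<open>sqrt x\<close>, by the tangent inequality for
  \<open>ln (1 / sqrt x)\<close>.
\<close>

lemma tendsto_mult_ln_nonneg:
  fixes f :: "nat \<Rightarrow> real"
  assumes f: "f \<longlonglongrightarrow> l" and bounds: "\<And>n. 0 \<le> f n" "\<And>n. f n \<le> 1"
  shows "(\<lambda>n. f n * ln (f n)) \<longlonglongrightarrow> l * ln l"
proof (cases "l = 0")
  case False
  moreover have "l \<ge> 0" using LIMSEQ_le_const[OF f, of 0] bounds by auto
  ultimately show ?thesis using f by (intro tendsto_mult tendsto_ln) auto
next
  case True
  have "\<bar>x * ln x\<bar> \<le> 2 * sqrt x" if x: "0 \<le> x" "x \<le> 1" for x :: real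
  proof (cases "x = 0")
    case False
    then have pos: "x > 0" using x by simp
    have "ln (1 / sqrt x) \<le> 1 / sqrt x - 1" using pos by (intro ln_le_minus_one) simp
    also have "ln (1 / sqrt x) = - (ln x / 2)" using pos by (simp add: ln_div ln_sqrt)
    finally have "- ln x \<le> 2 / sqrt x" by simp
    then have "x * (- ln x) \<le> x * (2 / sqrt x)" using pos by (intro mult_left_mono) auto
    also have "\<dots> = 2 * (x / sqrt x)" by simp
    also have "\<dots> = 2 * sqrt x" using x(1) by (simp only: real_div_sqrt)
    finally show ?thesis using x pos by (simp add: abs_mult)
  qed simp
  then have "\<And>n. norm (f n * ln (f n)) \<le> 2 * sqrt (f n)" using bounds by simp
  moreover have "(\<lambda>n. 2 * sqrt (f n)) \<longlonglongrightarrow> 0"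
    using tendsto_mult[OF tendsto_const[of 2] tendsto_real_sqrt[OF f]] True by simp
  ultimately have "(\<lambda>n. f n * ln (f n)) \<longlonglongrightarrow> 0"
    by (rule Lim_null_comparison[OF always_eventually[OF allI]])
  then show ?thesis using True by simp
qed

context path_space
begin

lemma tendsto_block_entropy:
  assumes "\<And>n. X n \<in> path_measures G" and "\<And>v. (\<lambda>n. mass (X n) v) \<longlonglongrightarrow> mass \<mu> v"
  shows "(\<lambda>n. block_entropy (X n) k) \<longlonglongrightarrow> block_entropy \<mu> k"
  unfolding block_entropy_def
  by (intro tendsto_minus tendsto_sum tendsto_mult_ln_nonneg assms) (use mass_le_1[OF assms(1)] in auto)

lemma block_entropy_0: assumes "\<mu> \<in> path_measures G" shows "block_entropy \<mu> 0 = 0"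
proof -
  have "{v. set v \<subseteq> arcs G \<and> length v = 0} = {[]}" by auto
  then show ?thesis using mass_Nil[OF assms] by (simp add: block_entropy_def)
qed

abbreviation birkhoff_sum :: "((nat \<Rightarrow> 'e) \<Rightarrow> real) \<Rightarrow> nat \<Rightarrow> (nat \<Rightarrow> 'e) \<Rightarrow> real" where
  "birkhoff_sum \<phi> n u \<equiv> \<Sum>k<n. \<phi> ((path_shift ^^ k) u)"

lemma bdd_above_exp_birkhoff_sum:
  assumes \<phi>: "continuous_map (path_topology G) euclideanreal \<phi>"
  shows "bdd_above ((\<lambda>u. exp (birkhoff_sum \<phi> n u)) ` cylinder G w)"
proof -
  obtain M where M: "\<And>u. u \<in> paths G \<Longrightarrow> \<bar>\<phi> u\<bar> \<le> M" using continuous_bounded[OF \<phi>] by metis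
  have "birkhoff_sum \<phi> n u \<le> n * M" if "u \<in> cylinder G w" for u
  proof -
    have "\<phi> ((path_shift ^^ k) u) \<le> M" for k
      using M[OF path_shift_pow_in_paths, of u k] that cylinder_subset_paths by fastforce
    then show ?thesis using sum_mono[of "{..<n}" "\<lambda>k. \<phi> ((path_shift ^^ k) u)" "\<lambda>_. M"] by simp
  qed
  then show ?thesis by (intro bdd_aboveI2[of _ _ "exp (n * M)"]) simp
qed

lemma SUP_exp_pos:
  assumes \<phi>: "continuous_map (path_topology G) euclideanreal \<phi>" and w: "w \<in> words G n"
  shows "(SUP u\<in>cylinder G w. exp (birkhoff_sum \<phi> n u)) > 0"
proof -
  obtain u where "u \<in> cylinder G w" using cylinder_word_nonempty[OF w] by blast
  then have "exp (birkhoff_sum \<phi> n u) \<le> (SUP u\<in>cylinder G w. exp (birkhoff_sum \<phi> n u))"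
    by (intro cSUP_upper bdd_above_exp_birkhoff_sum[OF \<phi>])
  then show ?thesis using exp_gt_zero less_le_trans by blast
qed

text \<open>
  The partition sum with the constraint expressed as a set of measures instead of a map and its values.
\<close>

definition restricted_sum ::
    "(nat \<Rightarrow> 'e) measure set \<Rightarrow> ((nat \<Rightarrow> 'e) \<Rightarrow> real) \<Rightarrow> nat \<Rightarrow> real" where
  "restricted_sum Q \<phi> n = (\<Sum>w\<in>{w \<in> words G n. \<forall>u\<in>cylinder G w. empirical_measure G n u \<in> Q}.
     SUP u\<in>cylinder G w. exp (birkhoff_sum \<phi> n u))"

text \<open>
  Choose in each contributing cylinder a path that realises the supremum up to the factor \<open>2\<close>, whence the
  summand \<open>ln 2\<close>. For the normalised weights, entropy plus energy is the logarithm of their sum.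
\<close>

lemma exists_gibbs_mixture:
  assumes \<phi>: "continuous_map (path_topology G) euclideanreal \<phi>"
    and Q: "Q \<subseteq> path_measures G" and mix: "\<And>t \<mu> \<nu>. t \<in> {0..1} \<Longrightarrow> \<mu> \<in> Q \<Longrightarrow> \<nu> \<in> Q \<Longrightarrow> mix_measure t \<mu> \<nu> \<in> Q"
    and n: "n > 0" and pos: "restricted_sum Q \<phi> n > 0"
  shows "\<exists>\<nu>\<in>Q. (\<forall>j. ln (restricted_sum Q \<phi> n) \<le> ln 2 + n * integral\<^sup>L \<nu> \<phi>
      + j * ln (card (arcs G)) + n * (block_entropy \<nu> (Suc j) - block_entropy \<nu> j))
    \<and> (\<forall>v. \<bar>(\<Sum>e\<in>arcs G. mass \<nu> (e # v)) - mass \<nu> v\<bar> \<le> 1 / n)"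
proof -
  define W where "W = {w \<in> words G n. \<forall>u\<in>cylinder G w. empirical_measure G n u \<in> Q}"
  define s where "s w = (SUP u\<in>cylinder G w. exp (birkhoff_sum \<phi> n u))" for w
  have fin: "finite W" by (rule finite_subset[OF _ finite_words[of n]]) (auto simp: W_def)
  have "\<exists>u\<in>cylinder G w. exp (birkhoff_sum \<phi> n u) > s w / 2" if w: "w \<in> W" for w
  proof -
    have wn: "w \<in> words G n" using w by (simp add: W_def)
    have "s w / 2 < s w" using SUP_exp_pos[OF \<phi> wn] by (simp add: s_def)
    then show ?thesis
      unfolding s_def using less_cSUP_iff[OF cylinder_word_nonempty[OF wn] bdd_above_exp_birkhoff_sum[OF \<phi>]] by blast
  qed
  then obtain u where u_cyl: "\<And>w. w \<in> W \<Longrightarrow> u w \<in> cylinder G w"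
    and u_large: "\<And>w. w \<in> W \<Longrightarrow> exp (birkhoff_sum \<phi> n (u w)) > s w / 2" by metis
  have u: "u w \<in> paths G" if "w \<in> W" for w using u_cyl[OF that] by (simp add: cylinder_iff)
  define E where "E w = exp (birkhoff_sum \<phi> n (u w))" for w
  define Z where "Z = (\<Sum>w\<in>W. E w)"
  have "restricted_sum Q \<phi> n = (\<Sum>w\<in>W. s w)" by (simp add: restricted_sum_def W_def s_def)
  also have "\<dots> \<le> (\<Sum>w\<in>W. 2 * E w)" using u_large by (intro sum_mono) (force simp: E_def)
  finally have le_Z: "restricted_sum Q \<phi> n \<le> 2 * Z" by (simp add: Z_def sum_distrib_left)
  then have Z: "Z > 0" using pos by linarith
  define c where "c w = E w / Z" for w
  have c: "c w > 0" for w using Z by (simp add: c_def E_def)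
  have c_sum: "(\<Sum>w\<in>W. c w) = 1" using Z by (simp add: c_def Z_def flip: sum_divide_distrib)
  have emp: "empirical_measure G n (u w) \<in> Q" if "w \<in> W" for w
    using u_cyl[OF that] that by (auto simp: W_def)
  have "\<exists>\<nu>\<in>Q. \<forall>v. mass \<nu> v = (\<Sum>w\<in>W. c w * mass (empirical_measure G n (u w)) v)"
    using c_sum by (intro finite_mixture[OF Q mix fin] emp) (auto intro: less_imp_le[OF c])
  then obtain \<nu> where \<nu>: "\<nu> \<in> Q" and \<nu>_mass: "\<And>v. mass \<nu> v = (\<Sum>w\<in>W. c w * mass (empirical_measure G n (u w)) v)"
    by blast
  have \<nu>_path: "\<nu> \<in> path_measures G" using \<nu> Q by blast
  have inj: "inj_on (\<lambda>w. window (u w) 0 n) W"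
  proof (rule inj_onI)
    have "window (u w) 0 n = w" if "w \<in> W" for w
      using u_cyl[OF that] that by (auto simp: cylinder_iff W_def words_def)
    then show "w = w'" if "w \<in> W" "w' \<in> W" "window (u w) 0 n = window (u w') 0 n" for w w'
      using that by metis
  qed
  have entropy: "- (\<Sum>w\<in>W. c w * ln (c w)) = ln Z - n * integral\<^sup>L \<nu> \<phi>"
  proof -
    have "integral\<^sup>L \<nu> \<phi> = (\<Sum>w\<in>W. c w * integral\<^sup>L (empirical_measure G n (u w)) \<phi>)"
      using \<nu>_mass emp Q c c_sum by (intro integral_mixture[OF \<phi> \<nu>_path]) (auto intro: less_imp_le)
    also have "\<dots> = (\<Sum>w\<in>W. c w * (birkhoff_sum \<phi> n (u w) / n))"
      using integral_empirical[OF u n \<phi>] by (intro sum.cong) auto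
    also have "\<dots> = (\<Sum>w\<in>W. c w * birkhoff_sum \<phi> n (u w)) / n"
      unfolding times_divide_eq_right by (rule sum_divide_distrib[symmetric])
    finally have "n * integral\<^sup>L \<nu> \<phi> = (\<Sum>w\<in>W. c w * birkhoff_sum \<phi> n (u w))"
      using n by simp
    moreover have "c w * ln (c w) = c w * birkhoff_sum \<phi> n (u w) - c w * ln Z" for w
    proof -
      have "ln (c w) = birkhoff_sum \<phi> n (u w) - ln Z"
        unfolding c_def E_def using Z by (simp add: ln_div)
      then show ?thesis by (simp only: right_diff_distrib)
    qed
    ultimately show ?thesis by (simp add: sum_subtractf c_sum flip: sum_distrib_right)
  qed
  have "ln (restricted_sum Q \<phi> n) \<le> ln (2 * Z)" using le_Z pos by simp
  then have ln_le: "ln (restricted_sum Q \<phi> n) \<le> ln 2 + ln Z" using Z by (simp add: ln_mult)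
  have "\<bar>(\<Sum>e\<in>arcs G. mass \<nu> (e # v)) - mass \<nu> v\<bar> \<le> 1 / n" for v
  proof -
    let ?d = "\<lambda>w. (\<Sum>e\<in>arcs G. mass (empirical_measure G n (u w)) (e # v)) - mass (empirical_measure G n (u w)) v"
    have "(\<Sum>e\<in>arcs G. mass \<nu> (e # v)) = (\<Sum>w\<in>W. c w * (\<Sum>e\<in>arcs G. mass (empirical_measure G n (u w)) (e # v)))"
      unfolding \<nu>_mass sum_distrib_left by (rule sum.swap)
    then have "(\<Sum>e\<in>arcs G. mass \<nu> (e # v)) - mass \<nu> v = (\<Sum>w\<in>W. c w * ?d w)"
      unfolding \<nu>_mass[of v] by (simp only: sum_subtractf right_diff_distrib)
    also have "\<bar>\<dots>\<bar> \<le> (\<Sum>w\<in>W. c w * (1 / n))"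
    proof (rule order_trans[OF sum_abs sum_mono])
      fix w assume w: "w \<in> W"
      have "\<bar>c w * ?d w\<bar> = c w * \<bar>?d w\<bar>" using c[of w] by (simp add: abs_mult)
      also have "\<dots> \<le> c w * (1 / n)"
        by (rule mult_left_mono[OF empirical_almost_invariant[OF u[OF w] n] less_imp_le[OF c]])
      finally show "\<bar>c w * ?d w\<bar> \<le> c w * (1 / n)" .
    qed
    also have "\<dots> = 1 / n" using c_sum by (simp flip: sum_divide_distrib)
    finally show ?thesis .
  qed
  moreover have "ln (restricted_sum Q \<phi> n) \<le> ln 2 + n * integral\<^sup>L \<nu> \<phi>
      + j * ln (card (arcs G)) + n * (block_entropy \<nu> (Suc j) - block_entropy \<nu> j)" for j
    using partition_function_le[OF fin u n inj c c_sum \<nu>_path \<nu>_mass, of j] entropy ln_le by simp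
  ultimately show ?thesis using \<nu> by blast
qed

text \<open>
  A limit of the mixtures belonging to larger and larger \<open>n\<close> is invariant. The bound for each order
  \<open>j\<close> survives in the limit, and the bounds for the first orders add up to one for block entropies.
\<close>

lemma exists_invariant_limit:
  assumes \<phi>: "continuous_map (path_topology G) euclideanreal \<phi>"
    and Q: "Q \<subseteq> path_measures G" and mix: "\<And>t \<mu> \<nu>. t \<in> {0..1} \<Longrightarrow> \<mu> \<in> Q \<Longrightarrow> \<nu> \<in> Q \<Longrightarrow> mix_measure t \<mu> \<nu> \<in> Q"
    and closed: "\<And>X \<mu>. (\<And>n::nat. X n \<in> Q) \<Longrightarrow> \<mu> \<in> path_measures G \<Longrightarrow> (\<And>v. (\<lambda>n. mass (X n) v) \<longlonglongrightarrow> mass \<mu> v) \<Longrightarrow> \<mu> \<in> Q"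
    and large: "\<And>N. \<exists>n>N. restricted_sum Q \<phi> n > 0 \<and> ln (restricted_sum Q \<phi> n) \<ge> n * a"
  shows "\<exists>\<mu>\<in>Q. \<mu> \<in> invariant_path_measures G \<and> (\<forall>k. k * (a - integral\<^sup>L \<mu> \<phi>) \<le> block_entropy \<mu> k)"
proof -
  obtain m where m: "\<And>k. m k > k" "\<And>k. restricted_sum Q \<phi> (m k) > 0"
    "\<And>k. ln (restricted_sum Q \<phi> (m k)) \<ge> m k * a" using large by metis
  have m_pos: "m k > 0" for k using m(1)[of k] by simp
  have "\<forall>k. \<exists>\<nu>. \<nu> \<in> Q \<and> (\<forall>j. ln (restricted_sum Q \<phi> (m k)) \<le> ln 2 + m k * integral\<^sup>L \<nu> \<phi>
      + j * ln (card (arcs G)) + m k * (block_entropy \<nu> (Suc j) - block_entropy \<nu> j))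
    \<and> (\<forall>v. \<bar>(\<Sum>e\<in>arcs G. mass \<nu> (e # v)) - mass \<nu> v\<bar> \<le> 1 / m k)"
    using exists_gibbs_mixture[OF \<phi> Q mix m_pos m(2)] by blast
  then obtain \<nu> where \<nu>: "\<And>k. \<nu> k \<in> Q"
    and bound: "\<And>k j. ln (restricted_sum Q \<phi> (m k)) \<le> ln 2 + m k * integral\<^sup>L (\<nu> k) \<phi>
      + j * ln (card (arcs G)) + m k * (block_entropy (\<nu> k) (Suc j) - block_entropy (\<nu> k) j)"
    and almost_inv: "\<And>k v. \<bar>(\<Sum>e\<in>arcs G. mass (\<nu> k) (e # v)) - mass (\<nu> k) v\<bar> \<le> 1 / m k"
    by metis
  have \<nu>_path: "\<nu> k \<in> path_measures G" for k using \<nu> Q by blast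
  obtain r \<mu> where r: "strict_mono (r :: nat \<Rightarrow> nat)" and \<mu>: "\<mu> \<in> path_measures G"
    and conv: "\<And>v. (\<lambda>k. mass (\<nu> (r k)) v) \<longlonglongrightarrow> mass \<mu> v"
    using path_measures_seq_compact[of \<nu>, OF \<nu>_path] by blast
  have inverse_le: "1 / real (m (r k)) \<le> inverse (real (Suc k))" for k
  proof -
    have "Suc k \<le> m (r k)" using m(1)[of "r k"] seq_suble[OF r, of k] by linarith
    then show ?thesis by (simp add: inverse_eq_divide frac_le)
  qed
  have lim0: "(\<lambda>k. 1 / real (m (r k))) \<longlonglongrightarrow> 0"
    by (rule tendsto_sandwich[OF _ _ tendsto_const LIMSEQ_inverse_real_of_nat])
      (use inverse_le in auto)
  have "\<mu> \<in> Q" by (rule closed[of "\<lambda>k. \<nu> (r k)"]) (use \<nu> \<mu> conv in auto)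
  moreover have "\<mu> \<in> invariant_path_measures G"
    unfolding invariant_path_measures_iff
  proof (intro conjI \<mu> allI)
    fix v
    have "(\<lambda>k. \<bar>(\<Sum>e\<in>arcs G. mass (\<nu> (r k)) (e # v)) - mass (\<nu> (r k)) v\<bar>)
      \<longlonglongrightarrow> \<bar>(\<Sum>e\<in>arcs G. mass \<mu> (e # v)) - mass \<mu> v\<bar>"
      by (intro tendsto_intros conv)
    from LIMSEQ_le[OF this lim0] almost_inv
    show "(\<Sum>e\<in>arcs G. mass \<mu> (e # v)) = mass \<mu> v" by auto
  qed
  moreover have "k * (a - integral\<^sup>L \<mu> \<phi>) \<le> block_entropy \<mu> k" for k
  proof -
    have step: "a - integral\<^sup>L \<mu> \<phi> \<le> block_entropy \<mu> (Suc j) - block_entropy \<mu> j" for j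
    proof -
      have "a \<le> (ln 2 + j * ln (card (arcs G))) * (1 / m k) + integral\<^sup>L (\<nu> k) \<phi>
        + (block_entropy (\<nu> k) (Suc j) - block_entropy (\<nu> k) j)" for k
      proof -
        have "m k * a \<le> ln 2 + m k * integral\<^sup>L (\<nu> k) \<phi> + j * ln (card (arcs G))
          + m k * (block_entropy (\<nu> k) (Suc j) - block_entropy (\<nu> k) j)"
          using bound[of k j] m(3)[of k] by linarith
        also have "\<dots> = m k * ((ln 2 + j * ln (card (arcs G))) * (1 / m k) + integral\<^sup>L (\<nu> k) \<phi>
          + (block_entropy (\<nu> k) (Suc j) - block_entropy (\<nu> k) j))"
          using m_pos[of k] by (simp add: algebra_simps)
        finally show ?thesis using m_pos[of k] by simp
      qed
      moreover have "(\<lambda>k. (ln 2 + j * ln (card (arcs G))) * (1 / real (m (r k))) + integral\<^sup>L (\<nu> (r k)) \<phi>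
        + (block_entropy (\<nu> (r k)) (Suc j) - block_entropy (\<nu> (r k)) j))
        \<longlonglongrightarrow> (ln 2 + j * ln (card (arcs G))) * 0 + integral\<^sup>L \<mu> \<phi> + (block_entropy \<mu> (Suc j) - block_entropy \<mu> j)"
        by (intro tendsto_intros lim0 tendsto_block_entropy tendsto_integral_if_masses_tendsto[OF \<phi>] \<nu>_path \<mu> conv)
      ultimately have "a \<le> (ln 2 + j * ln (card (arcs G))) * 0 + integral\<^sup>L \<mu> \<phi> + (block_entropy \<mu> (Suc j) - block_entropy \<mu> j)"
        by (intro LIMSEQ_le_const) auto
      then show ?thesis by simp
    qed
    show ?thesis
    proof (induction k)
      case (Suc k)
      then show ?case using step[of k] by (simp add: algebra_simps)
    qed (simp add: block_entropy_0[OF \<mu>])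
  qed
  ultimately show ?thesis by blast
qed

end

section \<open>Typical sequences\<close>

abbreviation lists_of :: "'w set \<Rightarrow> nat \<Rightarrow> 'w list set" where
  "lists_of W n \<equiv> {ws. set ws \<subseteq> W \<and> length ws = n}"

lemma sum_lists_of_Suc:
  "(\<Sum>ws\<in>lists_of W (Suc n). F ws) = (\<Sum>w\<in>W. \<Sum>ws\<in>lists_of W n. F (w # ws))"
proof -
  have "(\<Sum>ws\<in>lists_of W (Suc n). F ws) = (\<Sum>x\<in>lists_of W n \<times> W. F (snd x # fst x))"
    unfolding lists_length_Suc_eq by (subst sum.reindex) (auto simp: inj_on_def split_def)
  also have "\<dots> = (\<Sum>ws\<in>lists_of W n. \<Sum>w\<in>W. F (w # ws))"
    by (simp add: sum.cartesian_product split_def)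
  also have "\<dots> = (\<Sum>w\<in>W. \<Sum>ws\<in>lists_of W n. F (w # ws))" by (rule sum.swap)
  finally show ?thesis .
qed

lemma sum_UNION_le:
  fixes F :: "'b \<Rightarrow> real"
  assumes "finite J" and "\<And>j. finite (B j)" and "\<And>x j. x \<in> B j \<Longrightarrow> F x \<ge> 0"
  shows "(\<Sum>x\<in>(\<Union>j\<in>J. B j). F x) \<le> (\<Sum>j\<in>J. \<Sum>x\<in>B j. F x)"
  using assms(1)
proof (induction J)
  case (insert j J)
  have "(\<Sum>x\<in>(\<Union>i\<in>insert j J. B i). F x)
    = (\<Sum>x\<in>B j. F x) + (\<Sum>x\<in>(\<Union>i\<in>J. B i). F x) - (\<Sum>x\<in>B j \<inter> (\<Union>i\<in>J. B i). F x)"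
    unfolding UN_insert using insert.hyps(1) assms(2) by (intro sum_Un) auto
  also have "\<dots> \<le> (\<Sum>x\<in>B j. F x) + (\<Sum>x\<in>(\<Union>i\<in>J. B i). F x)"
    using sum_nonneg[of "B j \<inter> (\<Union>i\<in>J. B i)" F] assms(3) by auto
  finally show ?case using insert by simp
qed simp

lemma sum_lists_of_0: "(\<Sum>ws\<in>lists_of W 0. F ws) = F []"
proof -
  have "lists_of W 0 = {[]}" by auto
  then show ?thesis by simp
qed

context
  fixes W :: "'w set" and p :: "'w \<Rightarrow> real"
  assumes finite_W: "finite W" and p_pos: "\<And>w. w \<in> W \<Longrightarrow> p w > 0" and p_sum: "(\<Sum>w\<in>W. p w) = 1"
begin

private abbreviation "weight ws \<equiv> prod_list (map p ws)"

lemma finite_lists_of: "finite (lists_of W n)"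
  using finite_lists_length_eq[OF finite_W] by simp

lemma weight_pos: "ws \<in> lists_of W n \<Longrightarrow> weight ws > 0"
  by (induction ws arbitrary: n) (auto simp: p_pos)

lemma sum_weight: "(\<Sum>ws\<in>lists_of W n. weight ws) = 1"
proof (induction n)
  case (Suc n)
  have "(\<Sum>ws\<in>lists_of W (Suc n). weight ws) = (\<Sum>w\<in>W. p w * (\<Sum>ws\<in>lists_of W n. weight ws))"
    unfolding sum_lists_of_Suc by (simp add: sum_distrib_left)
  then show ?case unfolding Suc by (simp add: p_sum)
qed (unfold sum_lists_of_0, simp)

text \<open>
  The variance of a sum of independent variables is the sum of the variances; the mixed term vanishes
  with the mean.
\<close>

lemma second_moment:
  assumes mean: "(\<Sum>w\<in>W. p w * f w) = 0"
  shows "(\<Sum>ws\<in>lists_of W n. weight ws * (sum_list (map f ws))\<^sup>2) = n * (\<Sum>w\<in>W. p w * (f w)\<^sup>2)"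
proof (induction n)
  case (Suc n)
  let ?s = "\<lambda>ws. sum_list (map f ws)" and ?L = "lists_of W n"
  define A where "A = (\<Sum>ws\<in>?L. weight ws * ?s ws)"
  define B where "B = (\<Sum>ws\<in>?L. weight ws * (?s ws)\<^sup>2)"
  have inner: "(\<Sum>ws\<in>?L. weight (w # ws) * (?s (w # ws))\<^sup>2) = p w * (f w)\<^sup>2 + 2 * A * (p w * f w) + B * p w" for w
  proof -
    have "(\<Sum>ws\<in>?L. weight (w # ws) * (?s (w # ws))\<^sup>2)
      = (\<Sum>ws\<in>?L. (p w * (f w)\<^sup>2) * weight ws + (2 * (p w * f w)) * (weight ws * ?s ws) + p w * (weight ws * (?s ws)\<^sup>2))"
      by (intro sum.cong refl) (simp add: power2_eq_square algebra_simps)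
    also have "\<dots> = (p w * (f w)\<^sup>2) * (\<Sum>ws\<in>?L. weight ws) + (2 * (p w * f w)) * A + p w * B"
      unfolding A_def B_def sum.distrib sum_distrib_left ..
    finally show ?thesis by (simp add: sum_weight)
  qed
  have "(\<Sum>ws\<in>lists_of W (Suc n). weight ws * (?s ws)\<^sup>2)
    = (\<Sum>w\<in>W. p w * (f w)\<^sup>2) + 2 * A * (\<Sum>w\<in>W. p w * f w) + B * (\<Sum>w\<in>W. p w)"
    unfolding sum_lists_of_Suc inner sum.distrib sum_distrib_left ..
  then show ?case unfolding mean p_sum using Suc by (simp add: B_def algebra_simps)
qed (unfold sum_lists_of_0, simp)

text \<open>
  Chebyshev's inequality for the lower tail under the product measure.
\<close>

lemma chebyshev:
  assumes \<delta>: "\<delta> > 0" and n: "n > 0"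
  shows "(\<Sum>ws\<in>{ws \<in> lists_of W n. sum_list (map f ws) < n * ((\<Sum>w\<in>W. p w * f w) - \<delta>)}. weight ws)
    \<le> (\<Sum>w\<in>W. p w * (f w - (\<Sum>w\<in>W. p w * f w))\<^sup>2) / (\<delta>\<^sup>2 * n)"
proof -
  define a where "a = (\<Sum>w\<in>W. p w * f w)"
  define V where "V = (\<Sum>w\<in>W. p w * (f w - a)\<^sup>2)"
  define B where "B = {ws \<in> lists_of W n. sum_list (map f ws) < n * (a - \<delta>)}"
  let ?g = "\<lambda>w. f w - a"
  have mean: "(\<Sum>w\<in>W. p w * ?g w) = 0"
    by (simp add: right_diff_distrib sum_subtractf p_sum a_def flip: sum_distrib_right)
  have shift: "sum_list (map ?g ws) = sum_list (map f ws) - n * a" if "length ws = n" for ws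
    using that by (simp add: sum_list_subtractf sum_list_triv)
  have "(n * \<delta>)\<^sup>2 * (\<Sum>ws\<in>B. weight ws) = (\<Sum>ws\<in>B. weight ws * (n * \<delta>)\<^sup>2)"
    unfolding sum_distrib_left by (simp only: mult.commute)
  also have "\<dots> \<le> (\<Sum>ws\<in>B. weight ws * (sum_list (map ?g ws))\<^sup>2)"
  proof (intro sum_mono mult_left_mono)
    fix ws assume ws: "ws \<in> B"
    then have "n * \<delta> \<le> - sum_list (map ?g ws)" using shift[of ws] by (simp add: B_def algebra_simps)
    then have "(n * \<delta>)\<^sup>2 \<le> (- sum_list (map ?g ws))\<^sup>2" using \<delta> by (intro power_mono) auto
    then show "(n * \<delta>)\<^sup>2 \<le> (sum_list (map ?g ws))\<^sup>2" by simp
    show "0 \<le> weight ws" using weight_pos[of ws n] ws by (simp add: B_def)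
  qed
  also have "\<dots> \<le> (\<Sum>ws\<in>lists_of W n. weight ws * (sum_list (map ?g ws))\<^sup>2)"
  proof (rule sum_mono2[OF finite_lists_of])
    show "B \<subseteq> lists_of W n" unfolding B_def by blast
    show "0 \<le> weight ws * (sum_list (map ?g ws))\<^sup>2" if "ws \<in> lists_of W n - B" for ws
      using weight_pos[of ws n] that by simp
  qed
  also have "\<dots> = n * V" unfolding V_def by (rule second_moment[OF mean])
  finally have "(n * \<delta>)\<^sup>2 * (\<Sum>ws\<in>B. weight ws) \<le> n * V" .
  then have "n * ((\<delta>\<^sup>2 * n) * (\<Sum>ws\<in>B. weight ws)) \<le> n * V" by (simp add: power2_eq_square mult_ac)
  then have "(\<delta>\<^sup>2 * n) * (\<Sum>ws\<in>B. weight ws) \<le> V" using n by simp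
  then show ?thesis
    using \<delta> n by (simp add: pos_le_divide_eq mult.commute B_def V_def a_def)
qed

text \<open>
  By the law of large numbers at least half of the mass of the product measure sits on sequences that
  are typical for finitely many functions. If one of these is the information \<open>- ln p\<close>, each typical
  sequence has small weight, so there must be many of them.
\<close>

lemma many_typical_sequences:
  fixes f :: "'i \<Rightarrow> 'w \<Rightarrow> real"
  assumes I: "finite I" and \<delta>: "\<delta> > 0"
  shows "\<exists>N. \<forall>n\<ge>N. exp (n * (- (\<Sum>w\<in>W. p w * ln (p w)) - \<delta>)) / 2
    \<le> card {ws \<in> lists_of W n. \<forall>i\<in>I. sum_list (map (f i) ws) \<ge> n * ((\<Sum>w\<in>W. p w * f i w) - \<delta>)}"
proof -
  (* The index None stands for the information function. *)
  define g where "g j = (case j of None \<Rightarrow> \<lambda>w. - ln (p w) | Some i \<Rightarrow> f i)" for j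
  define J where "J = insert None (Some ` I)"
  define a where "a j = (\<Sum>w\<in>W. p w * g j w)" for j
  define V where "V j = (\<Sum>w\<in>W. p w * (g j w - a j)\<^sup>2)" for j
  define C where "C = (\<Sum>j\<in>J. V j)"
  have J: "finite J" using I by (simp add: J_def)
  obtain N :: nat where N: "real N > 2 * C / \<delta>\<^sup>2" using reals_Archimedean2 by blast
  have "exp (n * (a None - \<delta>)) / 2 \<le> card {ws \<in> lists_of W n. \<forall>i\<in>I. sum_list (map (f i) ws) \<ge> n * (a (Some i) - \<delta>)}"
    (is "_ \<le> real (card ?T')") if n: "n \<ge> Suc N" for n
  proof -
    define T where "T = {ws \<in> lists_of W n. \<forall>j\<in>J. sum_list (map (g j) ws) \<ge> n * (a j - \<delta>)}"
    define B where "B j = {ws \<in> lists_of W n. sum_list (map (g j) ws) < n * (a j - \<delta>)}" for j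
    have T_sub: "T \<subseteq> lists_of W n" unfolding T_def by blast
    have B_sub: "B j \<subseteq> lists_of W n" for j unfolding B_def by blast
    have fin: "finite T" "finite (B j)" for j
      using finite_subset[OF T_sub finite_lists_of] finite_subset[OF B_sub finite_lists_of] by auto
    have nonneg: "weight ws \<ge> 0" if "ws \<in> lists_of W n" for ws using weight_pos[OF that] by simp
    have "lists_of W n \<subseteq> T \<union> (\<Union>j\<in>J. B j)" by (auto simp: T_def B_def not_le)
    then have "1 \<le> (\<Sum>ws\<in>T \<union> (\<Union>j\<in>J. B j). weight ws)"
      unfolding sum_weight[of n, symmetric] using fin J
      by (intro sum_mono2) (auto simp: T_def B_def intro!: less_imp_le[OF weight_pos[of _ n]])
    also have "\<dots> \<le> (\<Sum>ws\<in>T. weight ws) + (\<Sum>ws\<in>(\<Union>j\<in>J. B j). weight ws)"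
    proof -
      have "0 \<le> (\<Sum>ws\<in>T \<inter> (\<Union>j\<in>J. B j). weight ws)"
        using T_sub by (intro sum_nonneg nonneg) blast
      then show ?thesis using fin J by (subst sum_Un) auto
    qed
    also have "(\<Sum>ws\<in>(\<Union>j\<in>J. B j). weight ws) \<le> (\<Sum>j\<in>J. \<Sum>ws\<in>B j. weight ws)"
      using nonneg B_sub by (intro sum_UNION_le[OF J fin(2)]) blast
    also have "\<dots> \<le> (\<Sum>j\<in>J. V j / (\<delta>\<^sup>2 * n))"
      unfolding V_def a_def B_def using chebyshev[OF \<delta>, of n] n by (intro sum_mono) auto
    also have "\<dots> = C / (\<delta>\<^sup>2 * n)" by (simp add: C_def sum_divide_distrib)
    also have "\<dots> \<le> 1 / 2"
    proof -
      have "2 * C / \<delta>\<^sup>2 \<le> n" using N n by linarith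
      then have "2 * C \<le> \<delta>\<^sup>2 * n" using \<delta> by (simp add: pos_divide_le_eq mult.commute)
      then show ?thesis using \<delta> n by (simp add: pos_divide_le_eq)
    qed
    finally have half: "1 / 2 \<le> (\<Sum>ws\<in>T. weight ws)" by linarith
    also have "\<dots> \<le> (\<Sum>ws\<in>T. exp (- (n * (a None - \<delta>))))"
    proof (rule sum_mono)
      fix ws assume ws: "ws \<in> T"
      have "weight ws = exp (- sum_list (map (g None) ws))" if "set ws \<subseteq> W" for ws
        using that by (induction ws) (simp_all add: g_def p_pos exp_diff exp_minus divide_inverse)
      then have "weight ws = exp (- sum_list (map (g None) ws))" using ws by (simp add: T_def)
      also have "\<dots> \<le> exp (- (n * (a None - \<delta>)))" using ws by (simp add: T_def J_def)
      finally show "weight ws \<le> exp (- (n * (a None - \<delta>)))" .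
    qed
    also have "\<dots> = card T * exp (- (n * (a None - \<delta>)))" by simp
    finally have *: "1 / 2 \<le> card T * exp (- (n * (a None - \<delta>)))" .
    have "exp (n * (a None - \<delta>)) / 2 \<le> card T"
    proof -
      define x where "x = n * (a None - \<delta>)"
      have "exp x * (1 / 2) \<le> exp x * (card T * exp (- x))"
        using * unfolding x_def by (rule mult_left_mono) simp
      also have "\<dots> = card T" by (simp add: exp_minus)
      finally show ?thesis by (simp add: x_def)
    qed
    also have "card T \<le> card ?T'"
      by (intro card_mono finite_subset[OF _ finite_lists_of[of n]]) (auto simp: T_def J_def g_def)
    finally show ?thesis by simp
  qed
  moreover have "a None = - (\<Sum>w\<in>W. p w * ln (p w))" by (simp add: a_def g_def sum_negf)
  moreover have "a (Some i) = (\<Sum>w\<in>W. p w * f i w)" for i by (simp add: a_def g_def)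
  ultimately show ?thesis by (intro exI[of _ "Suc N"]) simp
qed

end

section \<open>Occurrences of a word\<close>

definition occurrences :: "'e list \<Rightarrow> 'e list \<Rightarrow> nat" where
  "occurrences v x = card {i. i + length v \<le> length x \<and> take (length v) (drop i x) = v}"

lemma finite_occurrences: "finite {i. i + length v \<le> length x \<and> take (length v) (drop i x) = v}"
  by (rule finite_subset[of _ "{..length x}"]) auto

text \<open>
  Occurrences across the seam are lost, hence only an inequality; for nonempty \<open>v\<close> the two groups of
  positions are disjoint.
\<close>

lemma occurrences_append:
  assumes "v \<noteq> []" shows "occurrences v x + occurrences v y \<le> occurrences v (x @ y)"
proof -
  let ?O = "\<lambda>x. {i. i + length v \<le> length x \<and> take (length v) (drop i x) = v}"
  have k: "length v > 0" using assms by simp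
  have "occurrences v x + occurrences v y = card (?O x) + card ((\<lambda>i. i + length x) ` ?O y)"
    by (simp add: occurrences_def card_image inj_on_def)
  also have "\<dots> = card (?O x \<union> (\<lambda>i. i + length x) ` ?O y)"
    using k finite_occurrences[of v] by (intro card_Un_disjoint[symmetric]) auto
  also have "\<dots> \<le> card (?O (x @ y))"
    by (intro card_mono finite_occurrences) auto
  finally show ?thesis by (simp add: occurrences_def)
qed

lemma occurrences_concat:
  assumes "v \<noteq> []" shows "sum_list (map (occurrences v) xs) \<le> occurrences v (concat xs)"
proof (induction xs)
  case (Cons x xs)
  then show ?case using occurrences_append[OF assms, of x "concat xs"] by simp
qed simp

lemma occurrences_infix:
  assumes "v \<noteq> []" shows "occurrences v x \<le> occurrences v (a @ x @ b)"
  using occurrences_append[OF assms, of a "x @ b"] occurrences_append[OF assms, of x b] by simp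

context path_space
begin

text \<open>
  A path in the cylinder may have further occurrences that start in \<open>y\<close> and end after it.
\<close>

lemma occurrences_le_mass_empirical:
  assumes u: "u \<in> cylinder G y" and n: "length y = n" "n > 0" and v: "v \<noteq> []"
  shows "occurrences v y / n \<le> mass (empirical_measure G n u) v"
proof -
  have up: "u \<in> paths G" and w: "window u 0 n = y" using u n by (auto simp: cylinder_iff)
  have k: "length v > 0" using v by simp
  have "{i. i + length v \<le> length y \<and> take (length v) (drop i y) = v} \<subseteq> {..<n} \<inter> {i. window u i (length v) = v}"
  proof
    fix i assume "i \<in> {i. i + length v \<le> length y \<and> take (length v) (drop i y) = v}"
    then have "i + length v \<le> n" "take (length v) (drop i y) = v" using n by auto
    then have "i < n" "window u i (length v) = v"
      using k window_take_drop[of i "length v" n u] unfolding w by (linarith, simp)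
    then show "i \<in> {..<n} \<inter> {i. window u i (length v) = v}" by simp
  qed
  then have "occurrences v y \<le> card ({..<n} \<inter> {i. window u i (length v) = v})"
    unfolding occurrences_def by (intro card_mono) auto
  then show ?thesis
    unfolding mass_empirical[OF up n(2)] by (simp add: divide_right_mono)
qed

end

context invariant_path_measure
begin

text \<open>
  By invariance each of the \<open>m - k + 1\<close> possible positions contributes the mass of \<open>v\<close>.
\<close>

lemma sum_mass_occurrences:
  assumes "length v = k" "k \<le> m"
  shows "(\<Sum>w\<in>arc_lists G m. mass \<mu> w * occurrences v w) = real (m - k + 1) * mass \<mu> v"
proof -
  have occ: "real (occurrences v w) = (\<Sum>i<m - k + 1. of_bool (take k (drop i w) = v))" if "w \<in> arc_lists G m" for w
  proof -
    have "{i. i + length v \<le> length w \<and> take (length v) (drop i w) = v} = {..<m - k + 1} \<inter> {i. take k (drop i w) = v}"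
      using that assms by auto
    then show ?thesis by (simp add: occurrences_def del: sum.lessThan_Suc)
  qed
  have "(\<Sum>w\<in>arc_lists G m. mass \<mu> w * of_bool (take k (drop i w) = v)) = mass \<mu> v" if i: "i < m - k + 1" for i
  proof -
    define A where "A = (path_shift ^^ i) -` cylinder G v \<inter> space \<mu>"
    have A: "A \<in> sets \<mu>" unfolding A_def by (rule measurable_sets[OF measurable_pow cylinder_in_sets[OF \<mu>]])
    have "mass \<mu> w * of_bool (take k (drop i w) = v) = measure \<mu> (cylinder G w \<inter> A)" if w: "w \<in> arc_lists G m" for w
    proof -
      have "u \<in> A \<longleftrightarrow> take k (drop i w) = v" if u: "u \<in> cylinder G w" for u
      proof -
        have "u \<in> paths G" "window u 0 m = w" using u w by (auto simp: cylinder_iff)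
        then show ?thesis
          using i assms path_shift_pow_in_paths[of u G i] window_take_drop[of i k m u]
          by (simp add: A_def cylinder_iff space_path_measure[OF \<mu>])
      qed
      then have "cylinder G w \<inter> A = (if take k (drop i w) = v then cylinder G w else {})" by auto
      then show ?thesis by simp
    qed
    then have "(\<Sum>w\<in>arc_lists G m. mass \<mu> w * of_bool (take k (drop i w) = v)) = measure \<mu> A"
      using sum_measure_cylinder_Int[OF \<mu> A, of m] by simp
    also have "\<dots> = mass \<mu> v" unfolding A_def by (rule prob_pow_vimage[OF cylinder_in_sets[OF \<mu>]])
    finally show ?thesis .
  qed
  then have "(\<Sum>i<m - k + 1. \<Sum>w\<in>arc_lists G m. mass \<mu> w * of_bool (take k (drop i w) = v)) = real (m - k + 1) * mass \<mu> v"
    by simp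
  moreover have "(\<Sum>w\<in>arc_lists G m. mass \<mu> w * occurrences v w)
    = (\<Sum>w\<in>arc_lists G m. \<Sum>i<m - k + 1. mass \<mu> w * of_bool (take k (drop i w) = v))"
    by (intro sum.cong refl) (simp only: occ sum_distrib_left)
  ultimately show ?thesis by (simp only: sum.swap[of _ "arc_lists G m" "{..<m - k + 1}"])
qed

end

section \<open>Many words that are close to an invariant measure\<close>

context path_space
begin

text \<open>
  Closing every word up to a loop at one vertex allows arbitrary words to be concatenated. The
  closing paths depend on the end vertices of the word only, so a concatenation of
  such loops can be decoded once the end vertices are known.
\<close>

definition base :: 'v where
  "base = (SOME a. a \<in> verts G)"

definition connect :: "'v \<Rightarrow> 'v \<Rightarrow> 'e list" where
  "connect a b = (SOME p. awalk a p b)"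

definition close_up :: "'e list \<Rightarrow> 'e list" where
  "close_up w = connect base (tail G (hd w)) @ w @ connect (head G (last w)) base"

definition connect_bound :: nat where
  "connect_bound = Max ((\<lambda>(a, b). length (connect a b)) ` (verts G \<times> verts G))"

lemma base_in_verts: "base \<in> verts G"
  using strong someI_ex[of "\<lambda>a. a \<in> verts G"] by (auto simp: base_def strongly_connected_def)

lemma awalk_connect: "a \<in> verts G \<Longrightarrow> b \<in> verts G \<Longrightarrow> awalk a (connect a b) b"
  using strong someI_ex[of "\<lambda>p. awalk a p b"]
  by (auto simp: connect_def strongly_connected_def reachable_awalk)

lemma length_connect: "a \<in> verts G \<Longrightarrow> b \<in> verts G \<Longrightarrow> length (connect a b) \<le> connect_bound"
  unfolding connect_bound_def by (intro Max_ge) auto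

lemma word_ends:
  assumes "w \<in> words G m" "m > 0" shows "tail G (hd w) \<in> verts G" "head G (last w) \<in> verts G"
proof -
  have "w \<noteq> []" using assms by (auto simp: words_def)
  then show "tail G (hd w) \<in> verts G" "head G (last w) \<in> verts G"
    using awalk_word[OF assms(1)] awalk_hd_in_verts awalk_last_in_verts by blast+
qed

lemma awalk_close_up:
  assumes w: "w \<in> words G m" "m > 0" shows "awalk base (close_up w) base"
proof -
  have "w \<noteq> []" using w by (auto simp: words_def)
  then show ?thesis
    unfolding close_up_def using word_ends[OF w] base_in_verts awalk_word[OF w(1)] awalk_connect
    by (intro awalk_appendI) auto
qed

lemma length_close_up:
  assumes w: "w \<in> words G m" "m > 0" shows "length (close_up w) \<le> m + 2 * connect_bound"
  using length_connect[OF base_in_verts word_ends(1)[OF w]] length_connect[OF word_ends(2)[OF w] base_in_verts] w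
  by (simp add: close_up_def words_def)

lemma awalk_concat_close_up:
  "set ws \<subseteq> words G m \<Longrightarrow> m > 0 \<Longrightarrow> awalk base (concat (map close_up ws)) base"
proof (induction ws)
  case Nil
  then show ?case using base_in_verts by (simp add: awalk_Nil_iff)
next
  case (Cons w ws)
  then show ?case using awalk_close_up[of w m] by (auto intro: awalk_appendI)
qed

lemma length_concat_close_up:
  "set ws \<subseteq> words G m \<Longrightarrow> m > 0 \<Longrightarrow> length (concat (map close_up ws)) \<le> length ws * (m + 2 * connect_bound)"
proof (induction ws)
  case (Cons w ws)
  then show ?case using length_close_up[of w m] by simp
qed simp

abbreviation "ends w \<equiv> (tail G (hd w), head G (last w))"

lemma decode_close_up:
  assumes "concat (map close_up ws) @ r = concat (map close_up ws') @ r'" and "map ends ws = map ends ws'"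
    and "\<And>w. w \<in> set ws \<union> set ws' \<Longrightarrow> length w = m"
  shows "ws = ws'"
  using assms
proof (induction ws arbitrary: ws')
  case (Cons w ws)
  then obtain w' ws'' where ws': "ws' = w' # ws''" by (cases ws') auto
  have len: "length w = length w'" using Cons.prems(3) by (auto simp: ws')
  have "w @ connect (head G (last w)) base @ concat (map close_up ws) @ r
    = w' @ connect (head G (last w)) base @ concat (map close_up ws'') @ r'"
    using Cons.prems(1,2) by (simp add: ws' close_up_def[of w] close_up_def[of w'])
  then have "w = w'" "concat (map close_up ws) @ r = concat (map close_up ws'') @ r'"
    using len by simp_all
  moreover have "ws = ws''"
    by (rule Cons.IH) (use Cons.prems calculation in \<open>auto simp: ws'\<close>)
  ultimately show ?case by (simp add: ws')
qed simp

text \<open>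
  A path from the base vertex that pads concatenated loops to a prescribed length.
\<close>

definition filler :: "nat \<Rightarrow> 'e" where
  "filler = (SOME u. u \<in> paths G \<and> tail G (u 0) = base)"

lemma filler: "filler \<in> paths G" "tail G (filler 0) = base"
  using someI_ex[of "\<lambda>u. u \<in> paths G \<and> tail G (u 0) = base"] path_from_vertex[OF base_in_verts]
  by (auto simp: filler_def)

definition join :: "nat \<Rightarrow> 'e list list \<Rightarrow> 'e list" where
  "join n ws = window (prepend (concat (map close_up ws)) filler) 0 n"

lemma
  assumes ws: "set ws \<subseteq> words G m" "m > 0" and n: "length ws * (m + 2 * connect_bound) \<le> n"
  shows join_in_words: "join n ws \<in> words G n"
    and join_eq: "\<exists>r. join n ws = concat (map close_up ws) @ r"
proof -
  have "prepend (concat (map close_up ws)) filler \<in> paths G"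
    using awalk_concat_close_up[OF ws] filler by (rule prepend_awalk_in_paths)
  then show "join n ws \<in> words G n" unfolding join_def by (rule window_in_words)
  have "length (concat (map close_up ws)) \<le> n" using length_concat_close_up[OF ws] n by linarith
  then show "\<exists>r. join n ws = concat (map close_up ws) @ r"
    unfolding join_def by (auto simp: window_prepend)
qed

lemma occurrences_join:
  assumes ws: "set ws \<subseteq> words G m" "m > 0" and n: "length ws * (m + 2 * connect_bound) \<le> n" and v: "v \<noteq> []"
  shows "sum_list (map (occurrences v) ws) \<le> occurrences v (join n ws)"
proof -
  obtain r where r: "join n ws = concat (map close_up ws) @ r" using join_eq[OF ws n] by blast
  have "sum_list (map (occurrences v) ws) \<le> sum_list (map (occurrences v) (map close_up ws))"
    unfolding map_map comp_def close_up_def by (intro sum_list_mono occurrences_infix[OF v])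
  also have "\<dots> \<le> occurrences v (concat (map close_up ws))" by (rule occurrences_concat[OF v])
  also have "\<dots> \<le> occurrences v (join n ws)" using occurrences_append[OF v, of "concat (map close_up ws)" r] by (simp add: r)
  finally show ?thesis .
qed

text \<open>
  The join together with the end vertices of the words determines the words, and there are
  \<open>card (verts G) ^ (2 * N)\<close> possible lists of end vertices.
\<close>

lemma card_join_image:
  assumes T: "\<And>ws. ws \<in> T \<Longrightarrow> set ws \<subseteq> words G m \<and> length ws = N" and m: "m > 0"
    and n: "N * (m + 2 * connect_bound) \<le> n"
  shows "card T \<le> card (join n ` T) * card (verts G) ^ (2 * N)"
proof -
  let ?E = "{es. set es \<subseteq> verts G \<times> verts G \<and> length es = N}"
  have "inj_on (\<lambda>ws. (join n ws, map ends ws)) T"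
  proof (rule inj_onI)
    fix ws ws' assume *: "ws \<in> T" "ws' \<in> T" "(join n ws, map ends ws) = (join n ws', map ends ws')"
    obtain r where r: "join n ws = concat (map close_up ws) @ r" using join_eq[of ws m n] T[OF *(1)] m n by auto
    obtain r' where r': "join n ws' = concat (map close_up ws') @ r'" using join_eq[of ws' m n] T[OF *(2)] m n by auto
    show "ws = ws'"
    proof (rule decode_close_up)
      show "concat (map close_up ws) @ r = concat (map close_up ws') @ r'" using * r r' by simp
      show "map ends ws = map ends ws'" using * by simp
      show "length w = m" if "w \<in> set ws \<union> set ws'" for w
        using T[OF *(1)] T[OF *(2)] that by (auto simp: words_def)
    qed
  qed
  moreover have "(\<lambda>ws. (join n ws, map ends ws)) ` T \<subseteq> join n ` T \<times> ?E"
  proof (rule image_subsetI)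
    fix ws assume ws: "ws \<in> T"
    have "set (map ends ws) \<subseteq> verts G \<times> verts G"
      using T[OF ws] word_ends[OF _ m] by auto
    then show "(join n ws, map ends ws) \<in> join n ` T \<times> ?E" using ws T[OF ws] by auto
  qed
  moreover have fin: "finite (join n ` T)"
  proof (rule finite_subset[OF _ finite_words[of n]])
    show "join n ` T \<subseteq> words G n" using T m n join_in_words by blast
  qed
  moreover have "finite ?E" by (rule finite_lists_length_eq) auto
  ultimately have "card T \<le> card (join n ` T \<times> ?E)"
    by (intro card_inj_on_le) auto
  moreover have "card ?E = card (verts G) ^ (2 * N)"
    using card_lists_length_eq[of "verts G \<times> verts G" N] by (simp add: card_cartesian_product power_mult power2_eq_square)
  ultimately show ?thesis by (simp only: card_cartesian_product)
qed

end

context invariant_path_measure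
begin

text \<open>
  Take \<open>N\<close> words of length \<open>m\<close> that are typical for the distribution of \<open>\<mu>\<close> on words of this length and for
  the numbers of occurrences of all words of length \<open>k\<close>, close them up and join them. Each of them
  occupies at most \<open>m + 2 connect_bound\<close> places, and the choice of its end vertices loses at most
  \<open>2 ln (card (verts G))\<close> in the exponent; for large \<open>m\<close> both are negligible. Concatenation can only create
  further occurrences, so the frequencies are bounded from below.
\<close>

theorem many_words_near_invariant_measure:
  fixes h \<delta> \<epsilon> :: real
  assumes h: "\<And>n. n * h \<le> block_entropy \<mu> n" and k: "k > 0" and \<delta>: "\<delta> > 0" and \<epsilon>: "\<epsilon> > 0"
  shows "\<exists>n0. \<forall>n\<ge>n0. \<exists>Y\<subseteq>words G n. exp (n * (h - \<epsilon>)) \<le> card Y \<and>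
    (\<forall>y\<in>Y. \<forall>u\<in>cylinder G y. \<forall>v\<in>arc_lists G k. mass (empirical_measure G n u) v \<ge> mass \<mu> v - \<delta>)"
proof -
  define L where "L = real connect_bound"
  define c where "c = 1 + 2 * ln (card (verts G))"
  have cardV: "card (verts G) > 0" using base_in_verts finite_verts by (auto simp: card_gt_0_iff)
  (* The first summand makes the loss c and the 2 * L extra places per word cost at most \<epsilon> / 2 of the
     rate, the second keeps the share of usable positions above 1 - \<delta> / 4, the last ensures k \<le> m. *)
  obtain m :: nat where m: "real m > 2 / \<epsilon> * \<bar>c + 2 * L * h\<bar> + 4 / \<delta> * (2 * L + k) + k"
    using reals_Archimedean2 by blast
  have L: "L \<ge> 0" by (simp add: L_def)
  have m_parts: "real m \<ge> 2 / \<epsilon> * \<bar>c + 2 * L * h\<bar>" "real m \<ge> 4 / \<delta> * (2 * L + k)" "m \<ge> k"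
  proof -
    have "0 \<le> 2 / \<epsilon> * \<bar>c + 2 * L * h\<bar>" "0 \<le> 4 / \<delta> * (2 * L + k)" using \<epsilon> \<delta> L by auto
    then show "real m \<ge> 2 / \<epsilon> * \<bar>c + 2 * L * h\<bar>" "real m \<ge> 4 / \<delta> * (2 * L + k)" "m \<ge> k" using m by linarith+
  qed
  have m_pos: "m > 0" using m_parts(3) k by simp
  define R where "R = m + 2 * connect_bound"
  have R: "real R = m + 2 * L" "R > 0" "R \<ge> m" using m_pos by (simp_all add: R_def L_def)
  have rate: "(m * h - c) / R \<ge> h - \<epsilon> / 2"
  proof -
    have "c + 2 * L * h \<le> \<bar>c + 2 * L * h\<bar>" by simp
    also have "\<dots> \<le> \<epsilon> / 2 * m" using m_parts(1) \<epsilon> by (simp add: field_simps)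
    also have "\<dots> \<le> \<epsilon> / 2 * R" using \<epsilon> R by (intro mult_left_mono) auto
    finally have "(h - \<epsilon> / 2) * R \<le> m * h - c" by (simp add: R(1) algebra_simps)
    then show ?thesis using R(2) by (simp add: pos_le_divide_eq)
  qed
  have frac: "real (m - k + 1) / R \<ge> 1 - \<delta> / 4"
  proof -
    have "2 * L + k \<le> \<delta> / 4 * m" using m_parts(2) \<delta> by (simp add: field_simps)
    also have "\<dots> \<le> \<delta> / 4 * R" using \<delta> R by (intro mult_left_mono) auto
    finally have "(1 - \<delta> / 4) * R \<le> real (m - k + 1)" using m_parts(3) by (simp add: R(1) algebra_simps of_nat_diff)
    then show ?thesis using R(2) by (simp add: pos_le_divide_eq)
  qed
  define W where "W = {w \<in> arc_lists G m. mass \<mu> w > 0}"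
  have "W \<subseteq> arc_lists G m" by (auto simp: W_def)
  then have W: "finite W" "W \<subseteq> arc_lists G m" using finite_subset[OF _ finite_arc_lists] by blast+
  have W_pos: "mass \<mu> w > 0" if "w \<in> W" for w using that by (simp add: W_def)
  have W_words: "W \<subseteq> words G m"
  proof
    fix w assume w: "w \<in> W"
    then have "cylinder G w \<noteq> {}" "length w = m" by (auto simp: W_def)
    then show "w \<in> words G m" using cylinder_not_word[of w] by blast
  qed
  have W_sum: "(\<Sum>w\<in>W. mass \<mu> w * F w) = (\<Sum>w\<in>arc_lists G m. mass \<mu> w * F w)" for F :: "'e list \<Rightarrow> real"
    using W finite_arc_lists[of m] by (intro sum.mono_neutral_left) (auto simp: W_def zero_less_measure_iff)
  have W_one: "(\<Sum>w\<in>W. mass \<mu> w) = 1" using W_sum[of "\<lambda>_. 1"] sum_mass[OF \<mu>, of m] by simp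
  have W_entropy: "- (\<Sum>w\<in>W. mass \<mu> w * ln (mass \<mu> w)) = block_entropy \<mu> m"
    using W_sum[of "\<lambda>w. ln (mass \<mu> w)"] by (simp add: block_entropy_def)
  define \<eta> where "\<eta> = min 1 (\<delta> / 2)"
  have \<eta>: "\<eta> > 0" "\<eta> \<le> 1" "\<eta> \<le> \<delta> / 2" using \<delta> by (auto simp: \<eta>_def)
  define T where "T N = {ws \<in> lists_of W N. \<forall>v\<in>arc_lists G k.
    sum_list (map (\<lambda>w. real (occurrences v w)) ws) \<ge> N * ((\<Sum>w\<in>W. mass \<mu> w * occurrences v w) - \<eta>)}" for N
  have "\<exists>N0. \<forall>N\<ge>N0. exp (N * (block_entropy \<mu> m - \<eta>)) / 2 \<le> card (T N)"
    using many_typical_sequences[OF W(1) W_pos W_one finite_arc_lists \<eta>(1), of k "\<lambda>v w. real (occurrences v w)"]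
    unfolding W_entropy T_def .
  then obtain N0 where N0: "\<And>N. N \<ge> N0 \<Longrightarrow> exp (N * (block_entropy \<mu> m - \<eta>)) / 2 \<le> card (T N)"
    by blast
  define b where "b = \<bar>m * h - c\<bar>"
  (* The summands control the places left over when n is divided by R, in the frequencies and in the
     exponent; the multiple of R in n0 provides at least N0 words. *)
  obtain n1 :: nat where n1: "real n1 > 4 * m / \<delta> + 2 * (b + ln 2) / \<epsilon>" using reals_Archimedean2 by blast
  define n0 where "n0 = n1 + Suc N0 * R"
  show ?thesis
  proof (intro exI[of _ n0] allI impI)
    fix n assume n: "n \<ge> n0"
    define N where "N = n div R"
    have "n \<ge> Suc N0 * R" "n \<ge> n1" using n unfolding n0_def by linarith+
    have "Suc N0 * R div R \<le> N" unfolding N_def using \<open>n \<ge> Suc N0 * R\<close> by (rule div_le_mono)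
    then have N: "N \<ge> N0" "N > 0" using R(2) by simp_all
    have NR: "N * R \<le> n" by (simp add: N_def)
    have "N * R > 0" using N(2) R(2) by simp
    then have n_pos: "n > 0" using NR by linarith
    have N_near: "n / R - 1 \<le> N" "N \<le> n / R"
    proof -
      have "n < N * R + R" using mod_less_divisor[OF R(2), of n] div_mult_mod_eq[of n R] unfolding N_def by linarith
      then have "real n < real N * R + R" by (metis of_nat_add of_nat_less_iff of_nat_mult)
      then show "n / R - 1 \<le> N" using R(2) by (simp add: field_simps)
      have "real N * R \<le> n" using NR by (metis of_nat_le_iff of_nat_mult)
      then show "N \<le> n / R" using R(2) by (simp add: pos_le_divide_eq)
    qed
    have n_large: "m / n \<le> \<delta> / 4" "b + ln 2 \<le> n * (\<epsilon> / 2)"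
    proof -
      have "b \<ge> 0" by (simp add: b_def)
      then have "0 \<le> 2 * (b + ln 2) / \<epsilon>" "0 \<le> 4 * m / \<delta>" using \<epsilon> \<delta> by auto
      then have "4 * m / \<delta> \<le> n" "2 * (b + ln 2) / \<epsilon> \<le> n" using n1 \<open>n \<ge> n1\<close> by linarith+
      then show "m / n \<le> \<delta> / 4" "b + ln 2 \<le> n * (\<epsilon> / 2)" using \<epsilon> \<delta> n_pos by (simp_all add: field_simps)
    qed
    define Y where "Y = join n ` T N"
    have T: "set ws \<subseteq> words G m \<and> length ws = N" if "ws \<in> T N" for ws using that W_words by (auto simp: T_def)
    have NR': "N * (m + 2 * connect_bound) \<le> n" using NR by (simp add: R_def)
    have "Y \<subseteq> words G n" unfolding Y_def using T join_in_words m_pos NR' by blast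
    moreover have "exp (n * (h - \<epsilon>)) \<le> card Y"
    proof -
      have V: "real (card (verts G)) ^ (2 * N) = exp (N * (2 * ln (card (verts G))))"
        using cardV by (simp add: exp_of_nat_mult[symmetric] power_mult flip: exp_of_nat2_mult) (metis exp_ln exp_of_nat_mult of_nat_0_less_iff of_nat_mult of_nat_numeral power_mult mult.assoc mult.commute)
      have "N * (m * h - 1) \<le> N * (block_entropy \<mu> m - \<eta>)"
        using h[of m] \<eta>(2) by (intro mult_left_mono) auto
      then have "exp (N * (m * h - 1)) / 2 \<le> exp (N * (block_entropy \<mu> m - \<eta>)) / 2" by simp
      also have "\<dots> \<le> card (T N)" by (rule N0[OF N(1)])
      also have "\<dots> \<le> card Y * exp (N * (2 * ln (card (verts G))))"
        unfolding V[symmetric] Y_def using card_join_image[of "T N", OF T m_pos NR']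
        by (metis of_nat_le_iff of_nat_mult of_nat_power)
      finally have "exp (N * (m * h - 1)) / 2 * exp (- (N * (2 * ln (card (verts G))))) \<le> card Y"
        by (simp add: exp_minus field_simps)
      moreover have "exp (N * (m * h - 1)) / 2 * exp (- (N * (2 * ln (card (verts G))))) = exp (N * (m * h - c) - ln 2)"
      proof -
        have "exp a / 2 * exp (- d) = exp (a - d - ln 2)" for a d :: real
        proof -
          have "exp (- ln 2) = (1 / 2 :: real)" by (simp add: exp_minus)
          moreover have "exp (a - d - ln 2) = exp (a + - d + - ln 2)" by simp
          ultimately show ?thesis unfolding exp_add by simp
        qed
        moreover have "N * (m * h - 1) - N * (2 * ln (card (verts G))) - ln 2 = N * (m * h - c) - ln 2"
          by (simp add: c_def algebra_simps)
        ultimately show ?thesis by simp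
      qed
      moreover have "n * (h - \<epsilon>) \<le> N * (m * h - c) - ln 2"
      proof -
        have "n * (h - \<epsilon> / 2) \<le> n * ((m * h - c) / R)" using rate by (intro mult_left_mono) auto
        also have "\<dots> = (n / R) * (m * h - c)" by simp
        also have "\<dots> \<le> N * (m * h - c) + b"
        proof -
          have "(n / R - N) * (m * h - c) \<le> \<bar>n / R - N\<bar> * \<bar>m * h - c\<bar>"
            by (simp only: abs_mult[symmetric] abs_ge_self)
          also have "\<dots> \<le> 1 * \<bar>m * h - c\<bar>" using N_near by (intro mult_right_mono) auto
          finally show ?thesis by (simp add: b_def algebra_simps)
        qed
        finally show ?thesis using n_large(2) by (simp add: algebra_simps)
      qed
      then have "exp (n * (h - \<epsilon>)) \<le> exp (N * (m * h - c) - ln 2)" by simp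
      ultimately show ?thesis by linarith
    qed
    moreover have "mass (empirical_measure G n u) v \<ge> mass \<mu> v - \<delta>"
      if y: "y \<in> Y" and u: "u \<in> cylinder G y" and v: "v \<in> arc_lists G k" for y u v
    proof -
      obtain ws where ws: "ws \<in> T N" "y = join n ws" using y by (auto simp: Y_def)
      have vk: "length v = k" "v \<noteq> []" using v k by auto
      have "N * (real (m - k + 1) * mass \<mu> v - \<eta>) \<le> sum_list (map (\<lambda>w. real (occurrences v w)) ws)"
        using ws(1) v W_sum[of "\<lambda>w. occurrences v w"] sum_mass_occurrences[OF vk(1) m_parts(3)]
        by (auto simp: T_def)
      also have "\<dots> = real (sum_list (map (occurrences v) ws))" by (induction ws) auto
      also have "\<dots> \<le> occurrences v y"
        using occurrences_join[of ws m n v] T[OF ws(1)] m_pos NR' vk(2) ws(2) by simp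
      finally have "N * (real (m - k + 1) * mass \<mu> v - \<eta>) / n \<le> occurrences v y / n" by (rule divide_right_mono) simp
      also have "\<dots> \<le> mass (empirical_measure G n u) v"
        using occurrences_le_mass_empirical[OF u _ n_pos vk(2)] \<open>Y \<subseteq> words G n\<close> y by (auto simp: words_def)
      finally have emp: "N * (real (m - k + 1) * mass \<mu> v - \<eta>) / n \<le> mass (empirical_measure G n u) v" .
      have lower: "(1 - \<delta> / 2) * mass \<mu> v \<le> (N * real (m - k + 1) / n) * mass \<mu> v"
      proof (intro mult_right_mono)
        have "(n / R - 1) * real (m - k + 1) \<le> N * real (m - k + 1)" using N_near(1) by (intro mult_right_mono) auto
        then have "(n / R - 1) * real (m - k + 1) / n \<le> N * real (m - k + 1) / n" by (intro divide_right_mono) auto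
        moreover have "(n / R - 1) * real (m - k + 1) / n = real (m - k + 1) / R - real (m - k + 1) / n"
          using n_pos by (simp add: field_simps)
        moreover have "real (m - k + 1) / n \<le> m / n" using k m_parts(3) by (intro divide_right_mono) auto
        ultimately show "1 - \<delta> / 2 \<le> N * real (m - k + 1) / n" using frac n_large(1) by linarith
      qed simp
      have dev: "N * \<eta> / n \<le> \<delta> / 2"
      proof -
        have "N \<le> n" using NR R(2) by (metis One_nat_def Suc_leI mult_le_mono2 mult.right_neutral order_trans)
        then have "N * \<eta> / n \<le> n * \<eta> / n" using \<eta>(1) by (intro divide_right_mono mult_right_mono) auto
        moreover have "n * \<eta> / n = \<eta>" using n_pos by simp
        ultimately show ?thesis using \<eta>(3) by linarith
      qed
      have "\<delta> / 2 * mass \<mu> v \<le> \<delta> / 2" using \<delta> mass_le_1[OF \<mu>, of v] by simp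
      then have "mass \<mu> v - \<delta> \<le> (1 - \<delta> / 2) * mass \<mu> v - \<delta> / 2"
        by (simp add: left_diff_distrib)
      also have "\<dots> \<le> (N * real (m - k + 1) / n) * mass \<mu> v - N * \<eta> / n"
        using lower dev by (rule diff_mono)
      also have "\<dots> = N * (real (m - k + 1) * mass \<mu> v - \<eta>) / n"
        by (simp only: right_diff_distrib diff_divide_distrib mult.assoc times_divide_eq_left)
      finally show ?thesis using emp by (rule order_trans)
    qed
    ultimately show "\<exists>Y\<subseteq>words G n. exp (n * (h - \<epsilon>)) \<le> card Y \<and>
      (\<forall>y\<in>Y. \<forall>u\<in>cylinder G y. \<forall>v\<in>arc_lists G k. mass (empirical_measure G n u) v \<ge> mass \<mu> v - \<delta>)"
      by blast
  qed
qed

end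

section \<open>The variational principle for a convex constraint\<close>

context path_space
begin

text \<open>
  Concavity of \<open>- x ln x\<close>, obtained from its tangents at the mixture; the entropy of \<open>\<nu>\<close> is dropped.
\<close>

lemma block_entropy_mix_ge:
  assumes \<mu>: "\<mu> \<in> path_measures G" and \<nu>: "\<nu> \<in> path_measures G" and t: "0 < t" "t < 1"
  shows "t * block_entropy \<mu> n \<le> block_entropy (mix_measure t \<mu> \<nu>) n"
proof -
  have "mass (mix_measure t \<mu> \<nu>) v * ln (mass (mix_measure t \<mu> \<nu>) v) \<le> t * (mass \<mu> v * ln (mass \<mu> v))" for v
  proof -
    define a where "a = mass \<mu> v"
    define b where "b = mass \<nu> v"
    define x where "x = t * a + (1 - t) * b"
    have ab: "a \<ge> 0" "b \<ge> 0" "b \<le> 1" using mass_le_1[OF \<nu>, of v] by (auto simp: a_def b_def)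
    have x: "mass (mix_measure t \<mu> \<nu>) v = x" using mass_mix[OF \<mu> \<nu>, of t v] t by (simp add: x_def a_def b_def)
    have nn: "0 \<le> t * a" "0 \<le> (1 - t) * b" using ab t by auto
    have x0: "x \<ge> 0" using nn by (simp add: x_def)
    have pos: "x > 0 \<or> a = 0" "x > 0 \<or> b = 0"
    proof -
      have "a = 0 \<and> b = 0" if "x \<le> 0"
      proof -
        have "t * a = 0" "(1 - t) * b = 0" using that nn unfolding x_def by linarith+
        then show ?thesis using t by simp
      qed
      then show "x > 0 \<or> a = 0" "x > 0 \<or> b = 0" by linarith+
    qed
    have "t * (a * (ln x - ln a)) \<le> t * (x - a)"
      using mult_ln_le[OF ab(1) pos(1) x0] t by (intro mult_left_mono) auto
    moreover have "(1 - t) * (b * (ln x - ln b)) \<le> (1 - t) * (x - b)"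
      using mult_ln_le[OF ab(2) pos(2) x0] t by (intro mult_left_mono) auto
    moreover have "t * (x - a) + (1 - t) * (x - b) = 0" by (simp add: x_def algebra_simps)
    moreover have "t * (a * (ln x - ln a)) + (1 - t) * (b * (ln x - ln b))
      = x * ln x - t * (a * ln a) - (1 - t) * (b * ln b)"
      by (simp add: x_def algebra_simps)
    moreover have "(1 - t) * (b * ln b) \<le> 0"
      using ab t by (cases "b = 0") (auto intro!: mult_nonneg_nonpos)
    ultimately have "x * ln x \<le> t * (a * ln a)" by linarith
    then show ?thesis unfolding x a_def .
  qed
  then show ?thesis
    unfolding block_entropy_def by (simp add: sum_distrib_left sum_mono)
qed

text \<open>
  Shrink \<open>A\<close> to measures whose integral of \<open>\<phi>\<close> is almost that of \<open>\<mu>\<close>. This is still a weak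
  neighbourhood of \<open>\<mu>\<close>, so many words have all their empirical measures in it, and each of them contributes
  at least \<open>exp (n * (integral\<^sup>L \<mu> \<phi> - \<epsilon> / 2))\<close>.
\<close>

lemma restricted_sum_lower_bound:
  assumes \<phi>: "continuous_map (path_topology G) euclideanreal \<phi>"
    and A: "openin (weak_topology (path_topology G)) A" "A \<subseteq> Q"
    and mem: "\<mu> \<in> A" "\<mu> \<in> invariant_path_measures G"
    and h: "\<And>n. n * h \<le> block_entropy \<mu> n" and \<epsilon>: "\<epsilon> > 0"
  shows "\<exists>n0. \<forall>n\<ge>n0. exp (n * (h + integral\<^sup>L \<mu> \<phi> - \<epsilon>)) \<le> restricted_sum Q \<phi> n"
proof -
  interpret inv: invariant_path_measure G \<mu> by unfold_locales (rule mem(2))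
  have \<mu>_path: "\<mu> \<in> path_measures G" using mem(2) by (rule invariant_in_path_measures)
  let ?I = "integral\<^sup>L \<mu> \<phi>"
  define A' where "A' = A \<inter> {\<nu> \<in> path_measures G. integral\<^sup>L \<nu> \<phi> \<in> {?I - \<epsilon> / 2 <..}}"
  have "openin (weak_topology (path_topology G)) A'"
    unfolding A'_def by (intro openin_Int A(1) openin_vimage_integral[OF \<phi>] open_greaterThan)
  moreover have "\<mu> \<in> A'" using mem(1) \<mu>_path \<epsilon> by (simp add: A'_def)
  ultimately obtain \<delta> k where \<delta>: "\<delta> > 0" and k: "k > 0"
    and nbhd: "\<forall>\<nu>\<in>path_measures G. (\<forall>v\<in>arc_lists G k. mass \<nu> v \<ge> mass \<mu> v - \<delta>) \<longrightarrow> \<nu> \<in> A'"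
    using weak_neighbourhood[of A' \<mu>] \<mu>_path by blast
  obtain n0 where n0: "\<forall>n\<ge>n0. \<exists>Y\<subseteq>words G n. exp (n * (h - \<epsilon> / 2)) \<le> card Y \<and>
    (\<forall>y\<in>Y. \<forall>u\<in>cylinder G y. \<forall>v\<in>arc_lists G k. mass (empirical_measure G n u) v \<ge> mass \<mu> v - \<delta>)"
    using inv.many_words_near_invariant_measure[OF h k \<delta>, of "\<epsilon> / 2"] \<epsilon> by auto
  show ?thesis
  proof (intro exI[of _ "Suc n0"] allI impI)
    fix n assume n: "n \<ge> Suc n0"
    then have "n \<ge> n0" "n > 0" by auto
    obtain Y where Y: "Y \<subseteq> words G n" "exp (n * (h - \<epsilon> / 2)) \<le> card Y"
      and close: "\<forall>y\<in>Y. \<forall>u\<in>cylinder G y. \<forall>v\<in>arc_lists G k. mass (empirical_measure G n u) v \<ge> mass \<mu> v - \<delta>"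
      using n0[rule_format, OF \<open>n \<ge> n0\<close>] by (elim exE conjE)
    have emp: "empirical_measure G n u \<in> A'" if "y \<in> Y" "u \<in> cylinder G y" for y u
    proof -
      have "u \<in> paths G" using that(2) by (simp add: cylinder_iff)
      then have "empirical_measure G n u \<in> path_measures G" using \<open>n > 0\<close> by (rule empirical_in_path_measures)
      from bspec[OF nbhd this] bspec[OF bspec[OF close that(1)] that(2)] show ?thesis by (rule mp)
    qed
    let ?s = "\<lambda>w. SUP u\<in>cylinder G w. exp (birkhoff_sum \<phi> n u)"
    let ?W = "{w \<in> words G n. \<forall>u\<in>cylinder G w. empirical_measure G n u \<in> Q}"
    have term_ge: "exp (n * (?I - \<epsilon> / 2)) \<le> ?s y" if y: "y \<in> Y" for y
    proof -
      obtain u where u: "u \<in> cylinder G y" using cylinder_word_nonempty Y(1) y by blast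
      then have up: "u \<in> paths G" by (simp add: cylinder_iff)
      have "?I - \<epsilon> / 2 \<le> birkhoff_sum \<phi> n u / n"
        using emp[OF y u] integral_empirical[OF up \<open>n > 0\<close> \<phi>] by (simp add: A'_def)
      then have "n * (?I - \<epsilon> / 2) \<le> birkhoff_sum \<phi> n u"
        using \<open>n > 0\<close> by (simp add: pos_le_divide_eq mult.commute)
      then have "exp (n * (?I - \<epsilon> / 2)) \<le> exp (birkhoff_sum \<phi> n u)" by simp
      also have "\<dots> \<le> ?s y" by (rule cSUP_upper[OF u bdd_above_exp_birkhoff_sum[OF \<phi>]])
      finally show ?thesis .
    qed
    have "exp (n * (h + ?I - \<epsilon>)) = exp (n * (h - \<epsilon> / 2)) * exp (n * (?I - \<epsilon> / 2))"
      by (simp add: exp_add[symmetric] algebra_simps)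
    also have "\<dots> \<le> card Y * exp (n * (?I - \<epsilon> / 2))" using Y(2) by (intro mult_right_mono) auto
    also have "\<dots> = (\<Sum>y\<in>Y. exp (n * (?I - \<epsilon> / 2)))" by simp
    also have "\<dots> \<le> (\<Sum>y\<in>Y. ?s y)" using term_ge by (rule sum_mono)
    also have "\<dots> \<le> (\<Sum>y\<in>?W. ?s y)"
    proof (rule sum_mono2)
      show "finite ?W" by (rule finite_subset[OF _ finite_words[of n]]) auto
      show "Y \<subseteq> ?W" using Y(1) emp A(2) by (auto simp: A'_def)
      show "0 \<le> ?s w" if "w \<in> ?W - Y" for w
        using SUP_exp_pos[OF \<phi>, of w n] that by simp
    qed
    finally show "exp (n * (h + ?I - \<epsilon>)) \<le> restricted_sum Q \<phi> n" by (simp add: restricted_sum_def)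
  qed
qed

text \<open>
  An invariant measure on the boundary of the constraint is replaced by a mixture with an invariant
  measure in its interior. Entropy is concave, so little of it is lost.
\<close>

lemma restricted_sum_lower_bound_boundary:
  assumes \<phi>: "continuous_map (path_topology G) euclideanreal \<phi>"
    and A: "openin (weak_topology (path_topology G)) A" "A \<subseteq> Q"
    and \<mu>: "\<mu> \<in> invariant_path_measures G" and \<nu>: "\<nu> \<in> invariant_path_measures G"
    and mix: "\<And>t. 0 < t \<Longrightarrow> t < 1 \<Longrightarrow> mix_measure t \<mu> \<nu> \<in> A"
    and h: "\<And>n. n * h \<le> block_entropy \<mu> n" and \<epsilon>: "\<epsilon> > 0"
  shows "\<exists>n0. \<forall>n\<ge>n0. exp (n * (h + integral\<^sup>L \<mu> \<phi> - \<epsilon>)) \<le> restricted_sum Q \<phi> n"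
proof -
  have \<mu>p: "\<mu> \<in> path_measures G" and \<nu>p: "\<nu> \<in> path_measures G"
    using \<mu> \<nu> by (auto intro: invariant_in_path_measures)
  define t where "t j = 1 - inverse (real (Suc (Suc j)))" for j
  have inv: "inverse (real (Suc (Suc j))) < 1" for j by (simp add: inverse_eq_divide)
  have t: "0 < t j" "t j < 1" for j using inv[of j] by (simp_all add: t_def)
  have "t \<longlonglongrightarrow> 1 - 0"
    unfolding t_def by (intro tendsto_diff tendsto_const LIMSEQ_Suc[OF LIMSEQ_inverse_real_of_nat])
  then have t_lim: "t \<longlonglongrightarrow> 1" by simp
  define X where "X j = mix_measure (t j) \<mu> \<nu>" for j
  have Xp: "X j \<in> path_measures G" for j
    unfolding X_def using t[of j] by (intro mix_in_path_measures[OF \<mu>p \<nu>p]) simp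
  have "(\<lambda>j. mass (X j) v) \<longlonglongrightarrow> mass \<mu> v" for v
  proof -
    have "(\<lambda>j. t j * mass \<mu> v + (1 - t j) * mass \<nu> v) \<longlonglongrightarrow> 1 * mass \<mu> v + (1 - 1) * mass \<nu> v"
      by (intro tendsto_intros t_lim)
    moreover have "mass (X j) v = t j * mass \<mu> v + (1 - t j) * mass \<nu> v" for j
      unfolding X_def using t[of j] by (intro mass_mix[OF \<mu>p \<nu>p]) simp
    ultimately show ?thesis by simp
  qed
  then have "(\<lambda>j. t j * h + integral\<^sup>L (X j) \<phi>) \<longlonglongrightarrow> 1 * h + integral\<^sup>L \<mu> \<phi>"
    by (intro tendsto_intros t_lim tendsto_integral_if_masses_tendsto[OF \<phi> \<mu>p Xp])
  then have "eventually (\<lambda>j. t j * h + integral\<^sup>L (X j) \<phi> > h + integral\<^sup>L \<mu> \<phi> - \<epsilon> / 2) sequentially"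
    using \<epsilon> by (intro order_tendstoD(1)) auto
  then obtain j where j: "t j * h + integral\<^sup>L (X j) \<phi> > h + integral\<^sup>L \<mu> \<phi> - \<epsilon> / 2"
    by (auto simp: eventually_sequentially)
  have "n * (t j * h) \<le> block_entropy (X j) n" for n
  proof -
    have "t j * (n * h) \<le> t j * block_entropy \<mu> n" using h[of n] t[of j] by (intro mult_left_mono) auto
    also have "\<dots> \<le> block_entropy (X j) n" unfolding X_def by (rule block_entropy_mix_ge[OF \<mu>p \<nu>p t])
    finally show ?thesis by (simp add: mult.left_commute)
  qed
  moreover have "X j \<in> A" unfolding X_def by (rule mix[OF t])
  moreover have "X j \<in> invariant_path_measures G"
    unfolding X_def using t[of j] by (intro mix_invariant[OF \<mu> \<nu>]) simp
  ultimately obtain n0 where n0: "\<And>n. n \<ge> n0 \<Longrightarrow> exp (n * (t j * h + integral\<^sup>L (X j) \<phi> - \<epsilon> / 2)) \<le> restricted_sum Q \<phi> n"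
    using restricted_sum_lower_bound[OF \<phi> A, of "X j" "t j * h" "\<epsilon> / 2"] \<epsilon> by auto
  have "exp (n * (h + integral\<^sup>L \<mu> \<phi> - \<epsilon>)) \<le> exp (n * (t j * h + integral\<^sup>L (X j) \<phi> - \<epsilon> / 2))" for n :: nat
    using j by (simp add: mult_left_mono)
  then show ?thesis using n0 order_trans by blast
qed

end

section \<open>Quotients of affine maps\<close>

text \<open>
  The homothety with centre \<open>x\<close> and ratio \<open>1 - s\<close> maps a ball around \<open>y\<close> inside \<open>C\<close> to a ball around the
  mixture inside \<open>C\<close>.
\<close>

lemma mix_in_interior:
  fixes C :: "'x :: real_normed_vector set"
  assumes "convex C" "x \<in> C" "y \<in> interior C" and s: "0 \<le> s" "s < 1"
  shows "s *\<^sub>R x + (1 - s) *\<^sub>R y \<in> interior C"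
proof -
  obtain e where e: "e > 0" "ball y e \<subseteq> C" using assms(3) by (auto simp: mem_interior)
  let ?z = "s *\<^sub>R x + (1 - s) *\<^sub>R y"
  have "p \<in> C" if p: "p \<in> ball ?z ((1 - s) * e)" for p
  proof -
    define q where "q = y + (1 / (1 - s)) *\<^sub>R (p - ?z)"
    have "norm (q - y) = norm (p - ?z) / (1 - s)" using s by (simp add: q_def)
    also have "\<dots> < e" using p s by (simp add: dist_norm norm_minus_commute pos_divide_less_eq mult.commute)
    finally have "q \<in> C" using e(2) by (auto simp: dist_norm norm_minus_commute)
    moreover have "p = s *\<^sub>R x + (1 - s) *\<^sub>R q" using s by (simp add: q_def scaleR_right_distrib)
    ultimately show ?thesis using assms(1,2) s by (auto simp: convex_def)
  qed
  then show ?thesis using e(1) s by (auto simp: mem_interior intro!: exI[of _ "(1 - s) * e"])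
qed

locale affine_quotient = path_space G for G :: "('v, 'e) pre_digraph" +
  fixes \<Gamma> :: "(nat \<Rightarrow> 'e) measure \<Rightarrow> 'x :: real_normed_vector"
    and \<Delta> :: "(nat \<Rightarrow> 'e) measure \<Rightarrow> real"
    and U :: "(nat \<Rightarrow> 'e) measure \<Rightarrow> 'x"
  assumes \<Gamma>_cont: "continuous_map (weak_topology (path_topology G)) euclidean \<Gamma>"
    and \<Gamma>_affine: "affine_on_prob_measures (path_topology G) \<Gamma>"
    and \<Delta>_cont: "continuous_map (weak_topology (path_topology G)) euclideanreal \<Delta>"
    and \<Delta>_affine: "affine_on_prob_measures (path_topology G) \<Delta>"
    and \<Delta>_nonzero: "\<And>\<mu>. \<mu> \<in> path_measures G \<Longrightarrow> \<Delta> \<mu> \<noteq> 0"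
    and U_eq: "\<And>\<mu>. \<mu> \<in> path_measures G \<Longrightarrow> U \<mu> = \<Gamma> \<mu> /\<^sub>R \<Delta> \<mu>"
begin

lemma topspace_weak: "topspace (weak_topology (path_topology G)) = path_measures G"
  by (simp add: topspace_weak_topology path_measures_def)

lemma openin_vimage_U:
  assumes S: "open S"
  shows "openin (weak_topology (path_topology G)) {\<mu> \<in> path_measures G. U \<mu> \<in> S}"
proof -
  let ?D = "{p :: 'x \<times> real. snd p \<noteq> 0}"
  have D: "open ?D"
    by (intro open_Collect_neq continuous_intros)
  have "continuous_on ?D (\<lambda>p. fst p /\<^sub>R snd p)"
    by (intro continuous_intros) auto
  then have open_V: "open (?D \<inter> (\<lambda>p. fst p /\<^sub>R snd p) -` S)"
    using D S by (rule continuous_open_preimage)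
  have pair: "continuous_map (weak_topology (path_topology G)) euclidean (\<lambda>\<mu>. (\<Gamma> \<mu>, \<Delta> \<mu>))"
    using continuous_map_pairedI[OF \<Gamma>_cont \<Delta>_cont] by simp
  have "openin (weak_topology (path_topology G))
    {\<mu> \<in> path_measures G. (\<Gamma> \<mu>, \<Delta> \<mu>) \<in> ?D \<inter> (\<lambda>p. fst p /\<^sub>R snd p) -` S}"
    using openin_continuous_map_preimage[OF pair, of "?D \<inter> (\<lambda>p. fst p /\<^sub>R snd p) -` S"] open_V
    by (simp add: topspace_weak)
  moreover have "{\<mu> \<in> path_measures G. (\<Gamma> \<mu>, \<Delta> \<mu>) \<in> ?D \<inter> (\<lambda>p. fst p /\<^sub>R snd p) -` S} = {\<mu> \<in> path_measures G. U \<mu> \<in> S}"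
    using \<Delta>_nonzero U_eq by auto
  ultimately show ?thesis by simp
qed

lemma affine_mix:
  assumes "\<mu> \<in> path_measures G" "\<nu> \<in> path_measures G" "t \<in> {0..1}"
  shows "\<Gamma> (mix_measure t \<mu> \<nu>) = t *\<^sub>R \<Gamma> \<mu> + (1 - t) *\<^sub>R \<Gamma> \<nu>"
    and "\<Delta> (mix_measure t \<mu> \<nu>) = t * \<Delta> \<mu> + (1 - t) * \<Delta> \<nu>"
  using \<Gamma>_affine \<Delta>_affine assms by (auto simp: affine_on_prob_measures_def path_measures_def)

text \<open>
  Otherwise \<open>\<Delta>\<close>, being affine, would vanish at a mixture.
\<close>

lemma \<Delta>_same_sign:
  assumes \<mu>: "\<mu> \<in> path_measures G" and \<nu>: "\<nu> \<in> path_measures G"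
  shows "\<Delta> \<mu> * \<Delta> \<nu> > 0"
proof (rule ccontr)
  assume "\<not> \<Delta> \<mu> * \<Delta> \<nu> > 0"
  moreover have "\<Delta> \<mu> * \<Delta> \<nu> \<noteq> 0" using \<Delta>_nonzero \<mu> \<nu> by simp
  ultimately have neg: "\<Delta> \<mu> * \<Delta> \<nu> < 0" by linarith
  define t where "t = \<Delta> \<nu> / (\<Delta> \<nu> - \<Delta> \<mu>)"
  have ne: "\<Delta> \<nu> - \<Delta> \<mu> \<noteq> 0" using neg by (auto simp: mult_less_0_iff)
  have t: "t \<in> {0..1}" using neg by (auto simp: t_def mult_less_0_iff divide_le_eq zero_le_divide_iff)
  have "t * (\<Delta> \<nu> - \<Delta> \<mu>) = \<Delta> \<nu>" using ne by (simp add: t_def)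
  then have "\<Delta> (mix_measure t \<mu> \<nu>) = 0" unfolding affine_mix(2)[OF \<mu> \<nu> t] by (simp add: algebra_simps)
  then show False using \<Delta>_nonzero[OF mix_in_path_measures[OF \<mu> \<nu> t]] by simp
qed

text \<open>
  Since the denominator has constant sign, the quotient maps a mixture to a mixture with other weights.
\<close>

lemma U_mix:
  assumes \<mu>: "\<mu> \<in> path_measures G" and \<nu>: "\<nu> \<in> path_measures G" and t: "t \<in> {0..1}"
  shows "\<exists>s\<in>{0..1}. U (mix_measure t \<mu> \<nu>) = s *\<^sub>R U \<mu> + (1 - s) *\<^sub>R U \<nu> \<and> (t < 1 \<longrightarrow> s < 1)"
proof -
  define c where "c = \<Delta> \<nu> / \<Delta> \<mu>"
  have \<Delta>0: "\<Delta> \<mu> \<noteq> 0" "\<Delta> \<nu> \<noteq> 0" using \<Delta>_nonzero \<mu> \<nu> by auto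
  have c: "c > 0" using \<Delta>_same_sign[OF \<mu> \<nu>] by (auto simp: c_def zero_less_mult_iff zero_less_divide_iff)
  have \<nu>_c: "\<Delta> \<nu> = c * \<Delta> \<mu>" using \<Delta>0 by (simp add: c_def)
  define d where "d = t + (1 - t) * c"
  have d: "d > 0"
  proof (cases "t = 0")
    case False
    then show ?thesis using t c by (auto simp: d_def intro!: add_pos_nonneg)
  qed (use c in \<open>simp add: d_def\<close>)
  define s where "s = t / d"
  have s1: "1 - s = (1 - t) * c / d" using d by (simp add: s_def d_def field_simps)
  have nn: "0 \<le> (1 - t) * c / d" using t c d by auto
  have "U (mix_measure t \<mu> \<nu>) = (t *\<^sub>R \<Gamma> \<mu> + (1 - t) *\<^sub>R \<Gamma> \<nu>) /\<^sub>R (d * \<Delta> \<mu>)"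
    unfolding U_eq[OF mix_in_path_measures[OF \<mu> \<nu> t]] affine_mix[OF \<mu> \<nu> t] \<nu>_c d_def
    by (simp add: algebra_simps)
  also have "\<dots> = s *\<^sub>R U \<mu> + (1 - s) *\<^sub>R U \<nu>"
  proof -
    have "inverse (d * \<Delta> \<mu>) * t = s * inverse (\<Delta> \<mu>)" by (simp add: s_def divide_inverse)
    moreover have "inverse (d * \<Delta> \<mu>) * (1 - t) = (1 - s) * inverse (\<Delta> \<nu>)"
      unfolding s1 \<nu>_c using c by (simp add: divide_inverse)
    ultimately show ?thesis
      unfolding U_eq[OF \<mu>] U_eq[OF \<nu>] by (simp add: scaleR_right_distrib)
  qed
  finally have "U (mix_measure t \<mu> \<nu>) = s *\<^sub>R U \<mu> + (1 - s) *\<^sub>R U \<nu>" .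
  moreover have "s \<in> {0..1}"
  proof -
    have "s \<le> 1" using nn s1 by linarith
    moreover have "s \<ge> 0" using t d by (simp add: s_def)
    ultimately show ?thesis by simp
  qed
  moreover have "s < 1" if "t < 1"
  proof -
    have "0 < (1 - t) * c / d" using that c d by simp
    then show ?thesis using s1 by linarith
  qed
  ultimately show ?thesis by blast
qed

end

section \<open>Radius of convergence and exponential growth\<close>

text \<open>
  Comparison with a geometric series; the factor \<open>1 / n\<close> is at most \<open>1\<close>.
\<close>

lemma conv_radius_ge_if_growth_le:
  fixes Z :: "nat \<Rightarrow> real" and a :: real
  assumes nonneg: "\<And>n. Z n \<ge> 0" and growth: "eventually (\<lambda>n. Z n \<le> exp (n * a)) sequentially"
  shows "conv_radius (\<lambda>n. complex_of_real (Z n / n)) \<ge> exp (- a)"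
proof (rule conv_radius_geI_ex')
  fix r :: real assume r: "0 < r" "ereal r < ereal (exp (- a))"
  define q where "q = exp a * r"
  have q: "0 < q" "q < 1" using r by (simp_all add: q_def exp_minus field_simps)
  show "summable (\<lambda>n. complex_of_real (Z n / n) * of_real r ^ n)"
  proof (rule summable_comparison_test_ev)
    show "eventually (\<lambda>n. norm (complex_of_real (Z n / n) * of_real r ^ n) \<le> q ^ n) sequentially"
      using growth eventually_ge_at_top[of 1]
    proof eventually_elim
      case (elim n)
      have "norm (complex_of_real (Z n / n) * of_real r ^ n) = Z n / n * r ^ n"
        using nonneg[of n] r by (simp add: norm_mult norm_power norm_divide)
      also have "\<dots> \<le> exp (n * a) * r ^ n"
      proof (rule mult_right_mono)
        have "Z n * 1 \<le> Z n * n" using nonneg[of n] elim by (intro mult_left_mono) auto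
        then have "Z n / n \<le> Z n" using elim by (simp add: pos_divide_le_eq)
        then show "Z n / n \<le> exp (n * a)" using elim by linarith
      qed (use r in simp)
      also have "\<dots> = q ^ n" by (simp add: q_def power_mult_distrib exp_of_nat_mult)
      finally show ?case .
    qed
    show "summable (\<lambda>n. q ^ n)" using q by (intro summable_geometric) simp
  qed
qed

text \<open>
  Beyond the radius \<open>exp (- a)\<close> the terms are at least \<open>q ^ n / n\<close> for some \<open>q > 1\<close>, which is at least \<open>q - 1\<close> by
  Bernoulli's inequality.
\<close>

lemma conv_radius_le_if_growth_ge:
  fixes Z :: "nat \<Rightarrow> real" and a :: real
  assumes growth: "eventually (\<lambda>n. Z n \<ge> exp (n * a)) sequentially"
  shows "conv_radius (\<lambda>n. complex_of_real (Z n / n)) \<le> exp (- a)"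
proof (rule conv_radius_leI_ex')
  fix r :: real assume r: "0 < r" "ereal r > ereal (exp (- a))"
  define q where "q = exp a * r"
  have q: "q > 1" using r by (simp add: q_def exp_minus field_simps)
  show "\<not> summable (\<lambda>n. complex_of_real (Z n / n) * of_real r ^ n)"
  proof
    assume "summable (\<lambda>n. complex_of_real (Z n / n) * of_real r ^ n)"
    then have "(\<lambda>n. norm (complex_of_real (Z n / n) * of_real r ^ n)) \<longlonglongrightarrow> 0"
      by (intro tendsto_norm_zero summable_LIMSEQ_zero)
    then have "eventually (\<lambda>n. norm (complex_of_real (Z n / n) * of_real r ^ n) < q - 1) sequentially"
      using q by (intro order_tendstoD(2)) auto
    then have "eventually (\<lambda>n::nat. False) sequentially"
      using growth eventually_ge_at_top[of 1]
    proof eventually_elim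
      case (elim n)
      have "1 + n * (q - 1) \<le> q ^ n" using Bernoulli_inequality[of "q - 1" n] q by simp
      then have "n * (q - 1) \<le> q ^ n" by linarith
      then have "q - 1 \<le> q ^ n / n" using elim by (simp add: pos_le_divide_eq mult.commute)
      also have "\<dots> = exp (n * a) / n * r ^ n" by (simp add: q_def power_mult_distrib exp_of_nat_mult)
      also have "\<dots> \<le> Z n / n * r ^ n"
        using elim r by (intro mult_right_mono divide_right_mono) auto
      also have "\<dots> \<le> \<bar>Z n / n * r ^ n\<bar>" by (rule abs_ge_self)
      also have "\<dots> = norm (complex_of_real (Z n / n) * of_real r ^ n)"
        using r by (simp add: norm_mult norm_power norm_divide abs_mult)
      finally show ?case using elim by simp
    qed
    then show False by simp
  qed
qed simp

lemma fps_conv_radius_dyn_zeta: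
  "fps_conv_radius (dyn_zeta G U C \<phi>) = conv_radius (\<lambda>n. complex_of_real (partition_sum G U C \<phi> n / n))"
  by (simp add: fps_conv_radius_def dyn_zeta_def)

lemma upper_pressure_le:
  fixes a :: real
  assumes "eventually (\<lambda>n. partition_sum G U C \<phi> n \<le> exp (n * a)) sequentially"
  shows "upper_pressure G U C \<phi> \<le> ereal a"
  unfolding upper_pressure_def
proof (rule Limsup_bounded)
  show "eventually (\<lambda>n. ereal (1 / real n) * ext_ln (partition_sum G U C \<phi> n) \<le> ereal a) sequentially"
    using assms eventually_ge_at_top[of 1]
  proof eventually_elim
    case (elim n)
    let ?Z = "partition_sum G U C \<phi> n"
    show ?case
    proof (cases "?Z \<le> 0")
      case False
      then have "ln ?Z \<le> ln (exp (n * a))" using elim(1) by (intro ln_mono) auto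
      then have "ln ?Z / n \<le> a" using elim(2) by (simp add: pos_divide_le_eq mult.commute)
      then show ?thesis using False by (simp add: ext_ln_def)
    qed (use elim in \<open>simp add: ext_ln_def\<close>)
  qed
qed

lemma lower_pressure_ge:
  fixes a :: real
  assumes "eventually (\<lambda>n. partition_sum G U C \<phi> n \<ge> exp (n * a)) sequentially"
  shows "lower_pressure G U C \<phi> \<ge> ereal a"
  unfolding lower_pressure_def
proof (rule Liminf_bounded)
  show "eventually (\<lambda>n. ereal a \<le> ereal (1 / real n) * ext_ln (partition_sum G U C \<phi> n)) sequentially"
    using assms eventually_ge_at_top[of 1]
  proof eventually_elim
    case (elim n)
    let ?Z = "partition_sum G U C \<phi> n"
    have pos: "?Z > 0" using elim(1) exp_gt_zero[of "n * a"] by linarith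
    then have "n * a \<le> ln ?Z" using elim(1) by (simp add: ln_ge_iff)
    then have "a \<le> ln ?Z / n" using elim(2) by (simp add: pos_le_divide_eq mult.commute)
    then show ?case using pos by (simp add: ext_ln_def)
  qed
qed

lemma lower_pressure_le_upper_pressure: "lower_pressure G U C \<phi> \<le> upper_pressure G U C \<phi>"
  unfolding lower_pressure_def upper_pressure_def by (rule Liminf_le_Limsup) simp

lemma ereal_le_if_le_greater:
  fixes b :: real
  assumes "\<And>a. b < a \<Longrightarrow> x \<le> ereal a" shows "x \<le> ereal b"
proof (rule dense_ge)
  fix y assume "ereal b < y"
  then obtain a where "ereal b < ereal a" "ereal a < y" using ereal_dense2 by blast
  then show "x \<le> y" using assms[of a] by simp
qed

lemma ereal_ge_if_ge_less:
  fixes b :: real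
  assumes "\<And>a. a < b \<Longrightarrow> ereal a \<le> x" shows "ereal b \<le> x"
proof (rule dense_le)
  fix y assume "y < ereal b"
  then obtain a where "y < ereal a" "ereal a < ereal b" using ereal_dense2 by blast
  then show "y \<le> x" using assms[of a] by simp
qed

section \<open>The zero of the pressure\<close>

locale constrained_system = affine_quotient G \<Gamma> \<Delta> U
  for G :: "('v, 'e) pre_digraph" and \<Gamma> :: "(nat \<Rightarrow> 'e) measure \<Rightarrow> 'x :: real_normed_vector" and \<Delta> U +
  fixes C :: "'x set"
  assumes closed_C: "closed C" and convex_C: "convex C"
    and interior_C: "interior C \<inter> U ` invariant_path_measures G \<noteq> {}"
begin

definition admissible :: "(nat \<Rightarrow> 'e) measure set" where
  "admissible = {\<mu> \<in> invariant_path_measures G. U \<mu> \<in> C}"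

definition shift_entropy :: "(nat \<Rightarrow> 'e) measure \<Rightarrow> real" where
  "shift_entropy \<mu> = real_of_ereal (ks_entropy \<mu> path_shift)"

lemma
  assumes "\<mu> \<in> invariant_path_measures G"
  shows ks_entropy_eq: "ks_entropy \<mu> path_shift = ereal (shift_entropy \<mu>)"
    and shift_entropy_limit: "(\<lambda>n. block_entropy \<mu> n / n) \<longlonglongrightarrow> shift_entropy \<mu>"
    and shift_entropy_le: "n * shift_entropy \<mu> \<le> block_entropy \<mu> n"
proof -
  interpret inv: invariant_path_measure G \<mu> by unfold_locales (rule assms)
  show "ks_entropy \<mu> path_shift = ereal (shift_entropy \<mu>)"
    "(\<lambda>n. block_entropy \<mu> n / n) \<longlonglongrightarrow> shift_entropy \<mu>" "n * shift_entropy \<mu> \<le> block_entropy \<mu> n"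
    using inv.ks_entropy_eq_block_entropy_rate by (auto simp: shift_entropy_def)
qed

lemma block_entropy_nonneg: assumes "\<mu> \<in> path_measures G" shows "block_entropy \<mu> n \<ge> 0"
proof -
  have "mass \<mu> v * ln (mass \<mu> v) \<le> 0" for v
    using mass_le_1[OF assms, of v] by (cases "mass \<mu> v = 0") (auto intro!: mult_nonneg_nonpos simp: zero_less_measure_iff)
  then show ?thesis unfolding block_entropy_def by (simp add: sum_nonpos)
qed

lemma block_entropy_le_card: assumes "\<mu> \<in> path_measures G" shows "block_entropy \<mu> n \<le> card (arc_lists G n)"
proof -
  have "- (mass \<mu> v * ln (mass \<mu> v)) \<le> 1" for v
  proof -
    have "mass \<mu> v * (ln 1 - ln (mass \<mu> v)) \<le> 1 - mass \<mu> v" by (intro mult_ln_le) auto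
    then have "- (mass \<mu> v * ln (mass \<mu> v)) \<le> 1 - mass \<mu> v" by simp
    then show ?thesis using measure_nonneg[of \<mu> "cylinder G v"] by linarith
  qed
  then have "(\<Sum>v\<in>arc_lists G n. - (mass \<mu> v * ln (mass \<mu> v))) \<le> (\<Sum>v\<in>arc_lists G n. 1)" by (rule sum_mono)
  then show ?thesis unfolding block_entropy_def sum_negf[symmetric] by simp
qed

lemma shift_entropy_bounds:
  assumes "\<mu> \<in> invariant_path_measures G" shows "0 \<le> shift_entropy \<mu>" "shift_entropy \<mu> \<le> card (arc_lists G 1)"
proof -
  have \<mu>: "\<mu> \<in> path_measures G" using assms by (rule invariant_in_path_measures)
  show "0 \<le> shift_entropy \<mu>"
    by (rule LIMSEQ_le_const[OF shift_entropy_limit[OF assms]]) (use block_entropy_nonneg[OF \<mu>] in auto)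
  show "shift_entropy \<mu> \<le> card (arc_lists G 1)"
    using shift_entropy_le[OF assms, of 1] block_entropy_le_card[OF \<mu>, of 1] by simp
qed

text \<open>
  For \<open>n = 0\<close> the empirical measure is not a probability measure.
\<close>

lemma partition_sum_eq:
  assumes "n > 0"
  shows "partition_sum G U C \<phi> n = restricted_sum {\<mu> \<in> path_measures G. U \<mu> \<in> C} \<phi> n"
proof -
  have "(\<lambda>u. U (empirical_measure G n u)) ` cylinder G w \<subseteq> C \<longleftrightarrow>
    (\<forall>u\<in>cylinder G w. empirical_measure G n u \<in> {\<mu> \<in> path_measures G. U \<mu> \<in> C})" for w
    using empirical_in_path_measures[OF _ assms] cylinder_subset_paths[of G w] by blast
  then show ?thesis unfolding partition_sum_def restricted_sum_def by simp
qed

lemma partition_sum_nonneg: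
  assumes \<phi>: "continuous_map (path_topology G) euclideanreal \<phi>"
  shows "partition_sum G U C \<phi> n \<ge> 0"
  unfolding partition_sum_def using SUP_exp_pos[OF \<phi>] by (intro sum_nonneg) (auto intro: less_imp_le)

text \<open>
  The upper half of the variational principle. If the sums were large infinitely often, the invariant
  limit of the Gibbs mixtures would be admissible with \<open>shift_entropy \<mu> + \<integral>\<phi> d\<mu> \<ge> a\<close>.
\<close>

lemma partition_sum_growth_le:
  fixes a :: real
  assumes \<phi>: "continuous_map (path_topology G) euclideanreal \<phi>"
    and less: "\<And>\<mu>. \<mu> \<in> admissible \<Longrightarrow> shift_entropy \<mu> + integral\<^sup>L \<mu> \<phi> < a"
  shows "eventually (\<lambda>n. partition_sum G U C \<phi> n \<le> exp (n * a)) sequentially"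
proof (rule ccontr)
  let ?Q = "{\<mu> \<in> path_measures G. U \<mu> \<in> C}"
  assume "\<not> eventually (\<lambda>n. partition_sum G U C \<phi> n \<le> exp (n * a)) sequentially"
  then have "\<exists>n\<ge>Suc N. \<not> partition_sum G U C \<phi> n \<le> exp (n * a)" for N
    unfolding eventually_sequentially by blast
  then have large: "\<exists>n>N. partition_sum G U C \<phi> n > exp (n * a)" for N
    by (simp add: Suc_le_eq not_le)
  have "\<exists>\<mu>\<in>?Q. \<mu> \<in> invariant_path_measures G \<and> (\<forall>k. k * (a - integral\<^sup>L \<mu> \<phi>) \<le> block_entropy \<mu> k)"
  proof (rule exists_invariant_limit[OF \<phi>])
    show "mix_measure t \<mu> \<nu> \<in> ?Q" if t: "t \<in> {0..1}" and "\<mu> \<in> ?Q" "\<nu> \<in> ?Q" for t \<mu> \<nu>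
    proof -
      have \<mu>: "\<mu> \<in> path_measures G" "U \<mu> \<in> C" and \<nu>: "\<nu> \<in> path_measures G" "U \<nu> \<in> C" using that by auto
      obtain s where "s \<in> {0..1}" "U (mix_measure t \<mu> \<nu>) = s *\<^sub>R U \<mu> + (1 - s) *\<^sub>R U \<nu>"
        using U_mix[OF \<mu>(1) \<nu>(1) t] by blast
      then have "U (mix_measure t \<mu> \<nu>) \<in> C" using convexD[OF convex_C \<mu>(2) \<nu>(2), of s "1 - s"] by simp
      then show ?thesis using mix_in_path_measures[OF \<mu>(1) \<nu>(1) t] by blast
    qed
    show "\<mu> \<in> ?Q" if X: "\<And>n::nat. X n \<in> ?Q" and \<mu>: "\<mu> \<in> path_measures G"
      and lim: "\<And>v. (\<lambda>n. mass (X n) v) \<longlonglongrightarrow> mass \<mu> v" for X \<mu>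
    proof (rule ccontr)
      assume "\<mu> \<notin> ?Q"
      then have mem: "\<mu> \<in> {\<mu> \<in> path_measures G. U \<mu> \<in> - C}" using \<mu> by blast
      have "open (- C)" using closed_C by (rule open_Compl)
      then have "eventually (\<lambda>n. X n \<in> {\<mu> \<in> path_measures G. U \<mu> \<in> - C}) sequentially"
        using X by (intro eventually_in_weakly_open[OF openin_vimage_U mem \<mu> _ lim]) auto
      then obtain n where "X n \<in> {\<mu> \<in> path_measures G. U \<mu> \<in> - C}"
        by (auto simp: eventually_sequentially)
      then show False using X[of n] by blast
    qed
    show "\<exists>n>N. restricted_sum ?Q \<phi> n > 0 \<and> ln (restricted_sum ?Q \<phi> n) \<ge> n * a" for N
    proof -
      obtain n where n: "n > N" "partition_sum G U C \<phi> n > exp (n * a)" using large by blast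
      then have gt: "restricted_sum ?Q \<phi> n > exp (n * a)" using partition_sum_eq[of n] by simp
      then have pos: "restricted_sum ?Q \<phi> n > 0" using exp_gt_zero[of "n * a"] by linarith
      then have "ln (restricted_sum ?Q \<phi> n) \<ge> n * a" using gt by (simp add: ln_ge_iff)
      with n(1) pos show ?thesis by blast
    qed
  qed auto
  then obtain \<mu> where \<mu>: "U \<mu> \<in> C" "\<mu> \<in> invariant_path_measures G"
    and ge: "\<And>k. k * (a - integral\<^sup>L \<mu> \<phi>) \<le> block_entropy \<mu> k" by blast
  have "a - integral\<^sup>L \<mu> \<phi> \<le> block_entropy \<mu> k / k" if "k \<ge> 1" for k
    using ge[of k] that by (simp add: pos_le_divide_eq mult.commute)
  then have "a - integral\<^sup>L \<mu> \<phi> \<le> shift_entropy \<mu>"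
    by (intro LIMSEQ_le_const[OF shift_entropy_limit[OF \<mu>(2)]]) blast
  moreover have "\<mu> \<in> admissible" using \<mu> by (simp add: admissible_def)
  ultimately show False using less[of \<mu>] by simp
qed

text \<open>
  The lower half of the variational principle. Every proper mixture of \<open>\<mu>\<close> with an invariant measure that
  \<open>U\<close> maps to the interior of \<open>C\<close> is itself mapped to the interior, a weakly open condition.
\<close>

lemma partition_sum_growth_ge:
  fixes a :: real
  assumes \<phi>: "continuous_map (path_topology G) euclideanreal \<phi>"
    and \<mu>: "\<mu> \<in> admissible" and a: "a < shift_entropy \<mu> + integral\<^sup>L \<mu> \<phi>"
  shows "eventually (\<lambda>n. partition_sum G U C \<phi> n \<ge> exp (n * a)) sequentially"
proof -
  let ?Q = "{\<mu> \<in> path_measures G. U \<mu> \<in> C}" and ?A = "{\<mu> \<in> path_measures G. U \<mu> \<in> interior C}"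
  have \<mu>_inv: "\<mu> \<in> invariant_path_measures G" and \<mu>C: "U \<mu> \<in> C" using \<mu> by (auto simp: admissible_def)
  obtain \<nu> where \<nu>: "\<nu> \<in> invariant_path_measures G" "U \<nu> \<in> interior C" using interior_C by blast
  have \<mu>p: "\<mu> \<in> path_measures G" and \<nu>p: "\<nu> \<in> path_measures G"
    using \<mu>_inv \<nu>(1) by (auto intro: invariant_in_path_measures)
  have mix: "mix_measure t \<mu> \<nu> \<in> ?A" if t: "0 < t" "t < 1" for t
  proof -
    have t01: "t \<in> {0..1}" using t by simp
    obtain s where "s \<in> {0..1}" "s < 1" "U (mix_measure t \<mu> \<nu>) = s *\<^sub>R U \<mu> + (1 - s) *\<^sub>R U \<nu>"
      using U_mix[OF \<mu>p \<nu>p t01] t by blast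
    then show ?thesis
      using mix_in_interior[OF convex_C \<mu>C \<nu>(2), of s] mix_in_path_measures[OF \<mu>p \<nu>p t01] by simp
  qed
  define \<epsilon> where "\<epsilon> = shift_entropy \<mu> + integral\<^sup>L \<mu> \<phi> - a"
  have "?A \<subseteq> ?Q" using interior_subset by blast
  then obtain n0 where n0: "\<And>n. n \<ge> n0 \<Longrightarrow> exp (n * (shift_entropy \<mu> + integral\<^sup>L \<mu> \<phi> - \<epsilon>)) \<le> restricted_sum ?Q \<phi> n"
    using restricted_sum_lower_bound_boundary[OF \<phi> openin_vimage_U[OF open_interior] _ \<mu>_inv \<nu>(1) mix
        shift_entropy_le[OF \<mu>_inv], of ?Q \<epsilon>] a by (auto simp: \<epsilon>_def)
  show ?thesis
    unfolding eventually_sequentially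
  proof (intro exI[of _ "Suc n0"] allI impI)
    fix n assume "n \<ge> Suc n0"
    then show "exp (n * a) \<le> partition_sum G U C \<phi> n"
      using n0[of n] partition_sum_eq[of n \<phi>] by (simp add: \<epsilon>_def)
  qed
qed

context
  fixes \<Phi> :: "(nat \<Rightarrow> 'e) \<Rightarrow> real"
  assumes \<Phi>: "continuous_map (path_topology G) euclideanreal \<Phi>" and neg: "\<And>u. u \<in> paths G \<Longrightarrow> \<Phi> u < 0"
begin

definition sup_quotient :: real where
  "sup_quotient = (SUP \<mu>\<in>admissible. - (shift_entropy \<mu> / integral\<^sup>L \<mu> \<Phi>))"

text \<open>
  A negative continuous function on a compact space is bounded away from \<open>0\<close>.
\<close>

lemma potential_bounds:
  "\<exists>c M. 0 < c \<and> (\<forall>\<mu>\<in>path_measures G. c \<le> - integral\<^sup>L \<mu> \<Phi> \<and> - integral\<^sup>L \<mu> \<Phi> \<le> M)"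
proof -
  obtain w where w: "w \<in> paths G" "\<And>u. u \<in> paths G \<Longrightarrow> \<Phi> u \<le> \<Phi> w"
    using compact_attains_sup[OF compact_image_paths[OF \<Phi>]] paths_nonempty by auto
  obtain M where M: "\<And>u. u \<in> paths G \<Longrightarrow> \<bar>\<Phi> u\<bar> \<le> M" using continuous_bounded[OF \<Phi>] by metis
  have "- \<Phi> w \<le> - integral\<^sup>L \<mu> \<Phi> \<and> - integral\<^sup>L \<mu> \<Phi> \<le> M" if \<mu>: "\<mu> \<in> path_measures G" for \<mu>
  proof -
    interpret prob_space \<mu> by (rule prob_space_path_measure[OF \<mu>])
    have "integral\<^sup>L \<mu> \<Phi> \<le> \<Phi> w"
      using w(2) by (intro integral_le_const integrable_continuous[OF \<Phi> \<mu>]) (auto simp: space_path_measure[OF \<mu>])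
    moreover have "- M \<le> \<Phi> u" if u: "u \<in> paths G" for u using M[OF u] by linarith
    then have "- M \<le> integral\<^sup>L \<mu> \<Phi>"
      by (intro integral_ge_const integrable_continuous[OF \<Phi> \<mu>]) (auto simp: space_path_measure[OF \<mu>])
    ultimately show ?thesis by simp
  qed
  moreover have "- \<Phi> w > 0" using neg[OF w(1)] by simp
  ultimately show ?thesis by blast
qed

lemma admissible_path_measure: "\<mu> \<in> admissible \<Longrightarrow> \<mu> \<in> path_measures G"
  by (simp add: admissible_def invariant_in_path_measures)

lemma admissible_nonempty: "admissible \<noteq> {}"
  using interior_C interior_subset[of C] by (auto simp: admissible_def)

lemma bdd_above_quotients: "bdd_above ((\<lambda>\<mu>. - (shift_entropy \<mu> / integral\<^sup>L \<mu> \<Phi>)) ` admissible)"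
proof -
  obtain c where c: "c > 0" "\<And>\<mu>. \<mu> \<in> path_measures G \<Longrightarrow> c \<le> - integral\<^sup>L \<mu> \<Phi>"
    using potential_bounds by blast
  have "- (shift_entropy \<mu> / integral\<^sup>L \<mu> \<Phi>) \<le> card (arc_lists G 1) / c" if \<mu>: "\<mu> \<in> admissible" for \<mu>
  proof -
    have "shift_entropy \<mu> / - integral\<^sup>L \<mu> \<Phi> \<le> card (arc_lists G 1) / c"
      using c(1) c(2)[OF admissible_path_measure[OF \<mu>]] shift_entropy_bounds[of \<mu>] \<mu>
      by (intro frac_le) (auto simp: admissible_def)
    then show ?thesis by simp
  qed
  then show ?thesis by (rule bdd_aboveI2)
qed

lemma scaled_potential: "continuous_map (path_topology G) euclideanreal (\<lambda>u. s * \<Phi> u)"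
  using \<Phi> by (intro continuous_map_real_mult) auto

lemma integral_scaled: "integral\<^sup>L \<mu> (\<lambda>u. s * \<Phi> u) = s * integral\<^sup>L \<mu> \<Phi>"
  by simp

text \<open>
  With \<open>I = - \<integral>\<Phi> d\<mu>\<close> one has \<open>shift_entropy \<mu> + s \<integral>\<Phi> d\<mu> = (shift_entropy \<mu> / I - s) I\<close>, and \<open>I \<ge> c\<close> turns the
  distance of \<open>s\<close> from the supremum of the quotients into a gap of the pressure.
\<close>

lemma partition_sum_le_above_sup_quotient:
  fixes a s c :: real
  assumes c: "\<And>\<mu>. \<mu> \<in> path_measures G \<Longrightarrow> c \<le> - integral\<^sup>L \<mu> \<Phi>" "c > 0"
    and s: "sup_quotient \<le> s" and a: "a > (sup_quotient - s) * c"
  shows "eventually (\<lambda>n. partition_sum G U C (\<lambda>u. s * \<Phi> u) n \<le> exp (n * a)) sequentially"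
proof (rule partition_sum_growth_le[OF scaled_potential])
  fix \<mu> assume \<mu>: "\<mu> \<in> admissible"
  define I where "I = - integral\<^sup>L \<mu> \<Phi>"
  have I: "c \<le> I" "I > 0" using c(1)[OF admissible_path_measure[OF \<mu>]] c(2) by (auto simp: I_def)
  have "shift_entropy \<mu> / I \<le> sup_quotient"
    unfolding sup_quotient_def using cSUP_upper[OF \<mu> bdd_above_quotients] by (simp add: I_def)
  then have "shift_entropy \<mu> \<le> sup_quotient * I" using I(2) by (simp add: pos_divide_le_eq)
  moreover have "(s - sup_quotient) * c \<le> (s - sup_quotient) * I" using s I(1) by (intro mult_left_mono) auto
  ultimately show "shift_entropy \<mu> + integral\<^sup>L \<mu> (\<lambda>u. s * \<Phi> u) < a"
    using a unfolding integral_scaled I_def by (simp add: algebra_simps)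
qed

lemma partition_sum_ge_below_sup_quotient:
  fixes a s c :: real
  assumes c: "\<And>\<mu>. \<mu> \<in> path_measures G \<Longrightarrow> c \<le> - integral\<^sup>L \<mu> \<Phi>" "c > 0"
    and s: "s \<le> sup_quotient" and a: "a < (sup_quotient - s) * c"
  shows "eventually (\<lambda>n. partition_sum G U C (\<lambda>u. s * \<Phi> u) n \<ge> exp (n * a)) sequentially"
proof -
  obtain M where M: "\<And>\<mu>. \<mu> \<in> path_measures G \<Longrightarrow> - integral\<^sup>L \<mu> \<Phi> \<le> M" using potential_bounds by blast
  define \<epsilon> where "\<epsilon> = (sup_quotient - s) * c - a"
  (* A quotient within \<tau> of the supremum is good enough, since it is multiplied by at most M. *)
  define \<tau> where "\<tau> = \<epsilon> / (\<bar>M\<bar> + 1)"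
  have \<epsilon>: "\<epsilon> > 0" using a by (simp add: \<epsilon>_def)
  then have "\<tau> > 0" by (simp add: \<tau>_def)
  then have "sup_quotient - \<tau> < (SUP \<mu>\<in>admissible. - (shift_entropy \<mu> / integral\<^sup>L \<mu> \<Phi>))"
    by (simp add: sup_quotient_def)
  then obtain \<mu> where \<mu>: "\<mu> \<in> admissible" and gt: "sup_quotient - \<tau> < - (shift_entropy \<mu> / integral\<^sup>L \<mu> \<Phi>)"
    using less_cSUP_iff[OF admissible_nonempty bdd_above_quotients] by blast
  define I where "I = - integral\<^sup>L \<mu> \<Phi>"
  have I: "c \<le> I" "I > 0" "I \<le> M" using c(1)[OF admissible_path_measure[OF \<mu>]] c(2) M[OF admissible_path_measure[OF \<mu>]]
    by (auto simp: I_def)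
  have "sup_quotient - \<tau> < shift_entropy \<mu> / I" using gt by (simp add: I_def)
  then have "(sup_quotient - \<tau>) * I < shift_entropy \<mu>" using I(2) by (simp add: pos_less_divide_eq)
  moreover have "(sup_quotient - s) * c \<le> (sup_quotient - s) * I" using s I(1) by (intro mult_left_mono) auto
  moreover have "\<tau> * I \<le> \<epsilon>"
  proof -
    have "\<tau> * I \<le> \<tau> * (\<bar>M\<bar> + 1)" using I(3) \<open>\<tau> > 0\<close> by (intro mult_left_mono) auto
    also have "\<dots> = \<epsilon>"
    proof -
      have "\<bar>M\<bar> + 1 \<noteq> 0" by linarith
      then show ?thesis by (simp add: \<tau>_def)
    qed
    finally show ?thesis .
  qed
  ultimately have "a < shift_entropy \<mu> + integral\<^sup>L \<mu> (\<lambda>u. s * \<Phi> u)"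
    unfolding integral_scaled I_def \<epsilon>_def by (simp add: algebra_simps)
  then show ?thesis by (rule partition_sum_growth_ge[OF scaled_potential \<mu>])
qed

lemma pressure_zero_iff: "has_pressure G U C (\<lambda>u. s * \<Phi> u) 0 \<longleftrightarrow> s = sup_quotient"
proof -
  obtain c where c: "c > 0" "\<And>\<mu>. \<mu> \<in> path_measures G \<Longrightarrow> c \<le> - integral\<^sup>L \<mu> \<Phi>"
    using potential_bounds by blast
  let ?lo = "lower_pressure G U C (\<lambda>u. s * \<Phi> u)" and ?up = "upper_pressure G U C (\<lambda>u. s * \<Phi> u)"
  consider "s = sup_quotient" | "s > sup_quotient" | "s < sup_quotient" by linarith
  then show ?thesis
  proof cases
    case 1
    have "?up \<le> ereal a" if "a > 0" for a
      by (rule upper_pressure_le, rule partition_sum_le_above_sup_quotient[OF c(2,1)]) (use 1 that in auto)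
    then have "?up \<le> ereal 0" by (rule ereal_le_if_le_greater)
    moreover have "?lo \<ge> ereal a" if "a < 0" for a
      by (rule lower_pressure_ge, rule partition_sum_ge_below_sup_quotient[OF c(2,1)]) (use 1 that in auto)
    then have "ereal 0 \<le> ?lo" by (rule ereal_ge_if_ge_less)
    ultimately have "?up \<le> 0" "0 \<le> ?lo" by (simp_all add: zero_ereal_def)
    then have "?lo = 0" "?up = 0"
      using lower_pressure_le_upper_pressure[of G U C "\<lambda>u. s * \<Phi> u"] by (meson order.antisym order.trans)+
    then show ?thesis using 1 by (simp add: has_pressure_def)
  next
    case 2
    then have neg: "(sup_quotient - s) * c < 0" using c(1) by (simp add: mult_neg_pos)
    have "?up \<le> ereal ((sup_quotient - s) * c / 2)"
      by (rule upper_pressure_le, rule partition_sum_le_above_sup_quotient[OF c(2,1)]) (use 2 c(1) neg in auto)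
    also have "\<dots> < 0" using neg by simp
    finally show ?thesis using 2 by (auto simp: has_pressure_def)
  next
    case 3
    have "0 < ereal ((sup_quotient - s) * c / 2)" using 3 c(1) by simp
    also have "\<dots> \<le> ?lo"
      by (rule lower_pressure_ge, rule partition_sum_ge_below_sup_quotient[OF c(2,1)]) (use 3 c(1) in auto)
    finally show ?thesis using 3 by (auto simp: has_pressure_def)
  qed
qed

lemma conv_radius_one_iff: "fps_conv_radius (dyn_zeta G U C (\<lambda>u. s * \<Phi> u)) = 1 \<longleftrightarrow> s = sup_quotient"
proof -
  obtain c where c: "c > 0" "\<And>\<mu>. \<mu> \<in> path_measures G \<Longrightarrow> c \<le> - integral\<^sup>L \<mu> \<Phi>"
    using potential_bounds by blast
  let ?R = "fps_conv_radius (dyn_zeta G U C (\<lambda>u. s * \<Phi> u))"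
  have ge: "?R \<ge> ereal (exp (- a))" if "sup_quotient \<le> s" "a > (sup_quotient - s) * c" for a
    unfolding fps_conv_radius_dyn_zeta
    by (rule conv_radius_ge_if_growth_le[OF partition_sum_nonneg[OF scaled_potential]
        partition_sum_le_above_sup_quotient[OF c(2,1) that]])
  have le: "?R \<le> ereal (exp (- a))" if "s \<le> sup_quotient" "a < (sup_quotient - s) * c" for a
    unfolding fps_conv_radius_dyn_zeta
    by (rule conv_radius_le_if_growth_ge[OF partition_sum_ge_below_sup_quotient[OF c(2,1) that]])
  consider "s = sup_quotient" | "s > sup_quotient" | "s < sup_quotient" by linarith
  then show ?thesis
  proof cases
    case 1
    have "\<not> ?R < 1"
    proof
      assume "?R < 1"
      then obtain x where x: "?R < ereal x" "ereal x < 1" using ereal_dense2 by blast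
      have "0 \<le> ?R" by (simp add: fps_conv_radius_def conv_radius_nonneg)
      then have "0 < ereal x" using x(1) by (rule le_less_trans)
      then have "0 < x" "x < 1" using x(2) by (simp_all add: one_ereal_def)
      then have "ereal x \<le> ?R" using ge[of "- ln x"] 1 by simp
      then show False using x(1) by simp
    qed
    moreover have "\<not> 1 < ?R"
    proof
      assume "1 < ?R"
      then obtain x where x: "1 < ereal x" "ereal x < ?R" using ereal_dense2 by blast
      then have "1 < x" by (simp add: one_ereal_def)
      then have "?R \<le> ereal x" using le[of "- ln x"] 1 by simp
      then show False using x(2) by simp
    qed
    ultimately show ?thesis using 1 by (simp add: antisym_conv3)
  next
    case 2
    then have neg: "(sup_quotient - s) * c < 0" using c(1) by (simp add: mult_neg_pos)
    define a where "a = (sup_quotient - s) * c / 2"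
    have "a < 0" using neg by (simp add: a_def)
    then have "1 < ereal (exp (- a))" by (simp add: one_ereal_def)
    also have "\<dots> \<le> ?R" by (rule ge) (use 2 c(1) neg in \<open>auto simp: a_def\<close>)
    finally show ?thesis using 2 by auto
  next
    case 3
    define a where "a = (sup_quotient - s) * c / 2"
    have "a > 0" using 3 c(1) by (simp add: a_def)
    have "?R \<le> ereal (exp (- a))" by (rule le) (use 3 c(1) in \<open>auto simp: a_def\<close>)
    also have "\<dots> < 1" using \<open>a > 0\<close> by (simp add: one_ereal_def)
    finally show ?thesis using 3 by auto
  qed
qed

lemma sup_quotient_eq_SUP:
  "ereal sup_quotient = (SUP \<mu>\<in>{\<mu> \<in> invariant_path_measures G. U \<mu> \<in> C}. - (ks_entropy \<mu> path_shift / ereal (integral\<^sup>L \<mu> \<Phi>)))"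
proof -
  obtain c where c: "c > 0" "\<And>\<mu>. \<mu> \<in> path_measures G \<Longrightarrow> c \<le> - integral\<^sup>L \<mu> \<Phi>"
    using potential_bounds by blast
  have eq: "- (ks_entropy \<mu> path_shift / ereal (integral\<^sup>L \<mu> \<Phi>)) = ereal (- (shift_entropy \<mu> / integral\<^sup>L \<mu> \<Phi>))"
    if \<mu>: "\<mu> \<in> admissible" for \<mu>
  proof -
    have "integral\<^sup>L \<mu> \<Phi> \<noteq> 0" using c(1) c(2)[OF admissible_path_measure[OF \<mu>]] by auto
    then show ?thesis using ks_entropy_eq[of \<mu>] \<mu> by (simp add: admissible_def)
  qed
  have "(SUP \<mu>\<in>admissible. ereal (- (shift_entropy \<mu> / integral\<^sup>L \<mu> \<Phi>))) = ereal sup_quotient"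
  proof (rule SUP_eqI)
    show "ereal (- (shift_entropy \<mu> / integral\<^sup>L \<mu> \<Phi>)) \<le> ereal sup_quotient" if "\<mu> \<in> admissible" for \<mu>
      unfolding sup_quotient_def ereal_less_eq by (rule cSUP_upper[OF that bdd_above_quotients])
    show "ereal sup_quotient \<le> y" if y: "\<And>\<mu>. \<mu> \<in> admissible \<Longrightarrow> ereal (- (shift_entropy \<mu> / integral\<^sup>L \<mu> \<Phi>)) \<le> y" for y
    proof (cases y)
      case (real x)
      then show ?thesis
        unfolding sup_quotient_def using y admissible_nonempty by (auto intro!: cSUP_least)
    next
      case MInf
      then show ?thesis using y admissible_nonempty by fastforce
    qed simp
  qed
  moreover have "(SUP \<mu>\<in>admissible. - (ks_entropy \<mu> path_shift / ereal (integral\<^sup>L \<mu> \<Phi>))) =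
    (SUP \<mu>\<in>admissible. ereal (- (shift_entropy \<mu> / integral\<^sup>L \<mu> \<Phi>)))"
    by (rule SUP_cong[OF refl eq])
  ultimately show ?thesis unfolding admissible_def by (rule trans[symmetric, rotated])
qed

end

end

theorem corollary4p7:
  fixes G :: "('v, 'e) pre_digraph"
    and \<Gamma> :: "(nat \<Rightarrow> 'e) measure \<Rightarrow> 'x :: real_normed_vector"
    and \<Delta> :: "(nat \<Rightarrow> 'e) measure \<Rightarrow> real"
    and U :: "(nat \<Rightarrow> 'e) measure \<Rightarrow> 'x"
    and C :: "'x set"
    and \<Phi> :: "(nat \<Rightarrow> 'e) \<Rightarrow> real"
  assumes "fin_digraph G" and "strongly_connected G"
    and "continuous_map (weak_topology (path_topology G)) euclidean \<Gamma>"
    and "affine_on_prob_measures (path_topology G) \<Gamma>"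
    and "continuous_map (weak_topology (path_topology G)) euclideanreal \<Delta>"
    and "affine_on_prob_measures (path_topology G) \<Delta>"
    and "\<And>\<mu>. \<mu> \<in> path_measures G \<Longrightarrow> \<Delta> \<mu> \<noteq> 0"
    and "\<And>\<mu>. \<mu> \<in> path_measures G \<Longrightarrow> U \<mu> = \<Gamma> \<mu> /\<^sub>R \<Delta> \<mu>"
    and "closed C" and "convex C"
    and "interior C \<inter> U ` invariant_path_measures G \<noteq> {}"
    and "continuous_map (path_topology G) euclideanreal \<Phi>"
    and "\<And>u. u \<in> paths G \<Longrightarrow> \<Phi> u < 0"
  shows "\<exists>F :: real.
      (\<forall>s. has_pressure G U C (\<lambda>u. s * \<Phi> u) 0 \<longleftrightarrow> s = F) \<and>
      (\<forall>s. fps_conv_radius (dyn_zeta G U C (\<lambda>u. s * \<Phi> u)) = 1 \<longleftrightarrow> s = F) \<and>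
      ereal F = (SUP \<mu> \<in> {\<mu> \<in> invariant_path_measures G. U \<mu> \<in> C}.
                   - (ks_entropy \<mu> path_shift / ereal (integral\<^sup>L \<mu> \<Phi>)))"
proof -
  interpret fin_digraph G by (rule assms(1))
  obtain \<mu> where "\<mu> \<in> prob_measures (path_topology G)"
    using assms(11) by (auto simp: invariant_path_measures_def invariant_prob_measures_def)
  then have "prob_space \<mu>" "space \<mu> = paths G"
    by (auto simp: prob_measures_def topspace_path_topology)
  then have "paths G \<noteq> {}" using prob_space.not_empty by metis
  with assms interpret constrained_system G \<Gamma> \<Delta> U C
    by unfold_locales auto
  note potential = assms(12,13)
  show ?thesis
    using pressure_zero_iff[OF potential] conv_radius_one_iff[OF potential] sup_quotient_eq_SUP[OF potential] by blast
qed

end
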